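(* Let $\mathcal{V}$ be a symmetric monoidal closed category which is admissible, i.e. $\mathcal{V}$ is locally presentable and for each object $C$ the functor $C\otimes -:\mathcal{V}\to\mathcal{V}$ preserves filtered colimits. For every monoid $B$ in $\mathcal{V}$, let $H(-,B)^{\mathrm{op}}:\mathbf{Comon}(\mathcal{V})\to\mathbf{Mon}(\mathcal{V})^{\mathrm{op}}$ be the opposite of the functor $H(-,B):\mathbf{Comon}(\mathcal{V})^{\mathrm{op}}\to\mathbf{Mon}(\mathcal{V})$, $C\mapsto [C,B]$. Then $H(-,B)^{\mathrm{op}}$ has a right adjoint $P(-,B):\mathbf{Mon}(\mathcal{V})^{\mathrm{op}}\to\mathbf{Comon}(\mathcal{V})$; that is, there is a natural isomorphism $$\mathbf{Comon}(\mathcal{V})(C,P(A,B))\cong\mathbf{Mon}(\mathcal{V})^{\mathrm{op}}(H(C,B)^{\mathrm{op}},A)=\mathbf{Mon}(\mathcal{V})(A,[C,B])$$ for comonoids $C$ and monoids $A$ in $\mathcal{V}$.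
   Context: $\mathbf{Mon}(\mathcal{V})$ and $\mathbf{Comon}(\mathcal{V})$ are the categories of (not necessarily commutative, resp. cocommutative) monoids and comonoids in $\mathcal{V}$. $[-,-]$ denotes the internal hom of $\mathcal{V}$, with $-\otimes X\dashv[X,-]$. It is a lax monoidal functor $\mathcal{V}^{\mathrm{op}}\times\mathcal{V}\to\mathcal{V}$, and therefore induces a functor $H:\mathbf{Comon}(\mathcal{V})^{\mathrm{op}}\times\mathbf{Mon}(\mathcal{V})\to\mathbf{Mon}(\mathcal{V})$, $(C,A)\mapsto[C,A]$. Concretely, for a comonoid $(C,\Delta,\epsilon)$ and a monoid $(A,m,\eta)$, the monoid structure on $[C,A]$ has unit $I\to[C,A]$ the transpose of $C\xrightarrow{\epsilon}I\xrightarrow{\eta}A$, and multiplication $[C,A]\otimes[C,A]\to[C,A]$ the transpose of $$[C,A]\otimes[C,A]\otimes C\xrightarrow{1\otimes1\otimes\Delta}[C,A]\otimes[C,A]\otimes C\otimes C\xrightarrow{1\otimes s\otimes1}[C,A]\otimes C\otimes[C,A]\otimes C\xrightarrow{e\otimes e}A\otimes A\xrightarrow{m}A,$$ where $s$ is the symmetry and $e$ the evaluation. *)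

theory Defs
  imports Main "HOL-Library.FuncSet"
begin

unbundle cardinal_syntax

section \<open>Categories and functors\<close>

text \<open>
  Composition is only meaningful on composable pairs, and is written in the usual order:
  \<open>g \<cdot> f\<close> is ``first \<open>f\<close>, then \<open>g\<close>''.
\<close>

record ('o, 'a) category =
  Ob :: "'o set"
  Ar :: "'a set"
  Dom :: "'a \<Rightarrow> 'o"
  Cod :: "'a \<Rightarrow> 'o"
  Ident :: "'o \<Rightarrow> 'a"
  Comp :: "'a \<Rightarrow> 'a \<Rightarrow> 'a" (infixl "\<cdot>\<index>" 70)

definition hom :: "('o, 'a, 'z) category_scheme \<Rightarrow> 'o \<Rightarrow> 'o \<Rightarrow> 'a set" where
  "hom C X Y = {f \<in> Ar C. Dom C f = X \<and> Cod C f = Y}"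

definition category :: "('o, 'a, 'z) category_scheme \<Rightarrow> bool" where
  "category C \<longleftrightarrow>
     (\<forall>f\<in>Ar C. Dom C f \<in> Ob C \<and> Cod C f \<in> Ob C) \<and>
     (\<forall>X\<in>Ob C. Ident C X \<in> hom C X X) \<and>
     (\<forall>f\<in>Ar C. \<forall>g\<in>Ar C. Dom C g = Cod C f \<longrightarrow> g \<cdot>\<^bsub>C\<^esub> f \<in> hom C (Dom C f) (Cod C g)) \<and>
     (\<forall>f\<in>Ar C. f \<cdot>\<^bsub>C\<^esub> Ident C (Dom C f) = f \<and> Ident C (Cod C f) \<cdot>\<^bsub>C\<^esub> f = f) \<and>
     (\<forall>f\<in>Ar C. \<forall>g\<in>Ar C. \<forall>h\<in>Ar C. Dom C g = Cod C f \<longrightarrow> Dom C h = Cod C g \<longrightarrow>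
        h \<cdot>\<^bsub>C\<^esub> (g \<cdot>\<^bsub>C\<^esub> f) = (h \<cdot>\<^bsub>C\<^esub> g) \<cdot>\<^bsub>C\<^esub> f)"

definition inverse_arrows :: "('o, 'a, 'z) category_scheme \<Rightarrow> 'a \<Rightarrow> 'a \<Rightarrow> bool" where
  "inverse_arrows C f g \<longleftrightarrow>
     f \<in> Ar C \<and> g \<in> hom C (Cod C f) (Dom C f) \<and>
     g \<cdot>\<^bsub>C\<^esub> f = Ident C (Dom C f) \<and> f \<cdot>\<^bsub>C\<^esub> g = Ident C (Cod C f)"

definition iso :: "('o, 'a, 'z) category_scheme \<Rightarrow> 'o \<Rightarrow> 'o \<Rightarrow> 'a set" where
  "iso C X Y = {f \<in> hom C X Y. \<exists>g. inverse_arrows C f g}"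

definition inv_arr :: "('o, 'a, 'z) category_scheme \<Rightarrow> 'a \<Rightarrow> 'a" where
  "inv_arr C f = (THE g. inverse_arrows C f g)"

definition op_cat :: "('o, 'a, 'z) category_scheme \<Rightarrow> ('o, 'a) category" where
  "op_cat C = \<lparr>Ob = Ob C, Ar = Ar C, Dom = Cod C, Cod = Dom C, Ident = Ident C,
               Comp = (\<lambda>g f. f \<cdot>\<^bsub>C\<^esub> g)\<rparr>"

definition prod_cat ::
  "('o1, 'a1, 'y) category_scheme \<Rightarrow> ('o2, 'a2, 'z) category_scheme \<Rightarrow>
   ('o1 \<times> 'o2, 'a1 \<times> 'a2) category" where
  "prod_cat C D = \<lparr>Ob = Ob C \<times> Ob D, Ar = Ar C \<times> Ar D,
     Dom = map_prod (Dom C) (Dom D), Cod = map_prod (Cod C) (Cod D),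
     Ident = map_prod (Ident C) (Ident D),
     Comp = (\<lambda>(g, g') (f, f'). (g \<cdot>\<^bsub>C\<^esub> f, g' \<cdot>\<^bsub>D\<^esub> f'))\<rparr>"

record ('o1, 'a1, 'o2, 'a2) func =
  ObMap :: "'o1 \<Rightarrow> 'o2"
  ArMap :: "'a1 \<Rightarrow> 'a2"

definition is_functor ::
  "('o1, 'a1, 'y) category_scheme \<Rightarrow> ('o2, 'a2, 'z) category_scheme \<Rightarrow>
   ('o1, 'a1, 'o2, 'a2) func \<Rightarrow> bool" where
  "is_functor C D F \<longleftrightarrow>
     category C \<and> category D \<and>
     (\<forall>X\<in>Ob C. ObMap F X \<in> Ob D) \<and>
     (\<forall>f\<in>Ar C. ArMap F f \<in> hom D (ObMap F (Dom C f)) (ObMap F (Cod C f))) \<and>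
     (\<forall>X\<in>Ob C. ArMap F (Ident C X) = Ident D (ObMap F X)) \<and>
     (\<forall>f\<in>Ar C. \<forall>g\<in>Ar C. Dom C g = Cod C f \<longrightarrow>
        ArMap F (g \<cdot>\<^bsub>C\<^esub> f) = ArMap F g \<cdot>\<^bsub>D\<^esub> ArMap F f)"

definition comp_func ::
  "('o2, 'a2, 'o3, 'a3) func \<Rightarrow> ('o1, 'a1, 'o2, 'a2) func \<Rightarrow> ('o1, 'a1, 'o3, 'a3) func" where
  "comp_func G F = \<lparr>ObMap = ObMap G \<circ> ObMap F, ArMap = ArMap G \<circ> ArMap F\<rparr>"

text \<open>
  The opposite of \<open>F : C \<rightarrow> D\<close>, as a functor \<open>op_cat C \<rightarrow> op_cat D\<close>, has the same action
  on objects and arrows, since \<open>op_cat\<close> keeps the arrows.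
\<close>

definition op_func :: "('o1, 'a1, 'o2, 'a2) func \<Rightarrow> ('o1, 'a1, 'o2, 'a2) func" where
  "op_func F = F"

text \<open>
  \<open>G : D \<rightarrow> C\<close> is right adjoint to \<open>F : C \<rightarrow> D\<close>: there is an isomorphism
  \<open>D(F c, d) \<cong> C(c, G d)\<close>, natural in both variables.
\<close>

definition right_adjoint ::
  "('o1, 'a1, 'y) category_scheme \<Rightarrow> ('o2, 'a2, 'z) category_scheme \<Rightarrow>
   ('o1, 'a1, 'o2, 'a2) func \<Rightarrow> ('o2, 'a2, 'o1, 'a1) func \<Rightarrow> bool" where
  "right_adjoint C D F G \<longleftrightarrow>
     is_functor C D F \<and> is_functor D C G \<and>
     (\<exists>\<phi>. (\<forall>c\<in>Ob C. \<forall>d\<in>Ob D.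
              bij_betw (\<phi> c d) (hom D (ObMap F c) d) (hom C c (ObMap G d))) \<and>
          (\<forall>u\<in>Ar C. \<forall>v\<in>Ar D. \<forall>h\<in>hom D (ObMap F (Cod C u)) (Dom D v).
              \<phi> (Dom C u) (Cod D v) (v \<cdot>\<^bsub>D\<^esub> h \<cdot>\<^bsub>D\<^esub> ArMap F u)
                = ArMap G v \<cdot>\<^bsub>C\<^esub> \<phi> (Cod C u) (Dom D v) h \<cdot>\<^bsub>C\<^esub> u))"

section \<open>Smallness, colimits, local presentability\<close>

text \<open>
  Size is measured by an inaccessible cardinal \<open>\<kappa>\<close>, playing the role of a Grothendieck
  universe: a set, of any type, is small if its cardinality is below \<open>\<kappa>\<close>.
\<close>

definition regular_cardinal :: "'u rel \<Rightarrow> bool" where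
  "regular_cardinal \<mu> \<longleftrightarrow> Card_order \<mu> \<and> natLeq \<le>o \<mu> \<and> regularCard \<mu>"

definition inaccessible :: "'u rel \<Rightarrow> bool" where
  "inaccessible \<kappa> \<longleftrightarrow>
     regular_cardinal \<kappa> \<and> natLeq <o \<kappa> \<and>
     (\<forall>A::'u set. |A| <o \<kappa> \<longrightarrow> |Pow A| <o \<kappa>)"

definition small_category :: "'u rel \<Rightarrow> ('o, 'a, 'z) category_scheme \<Rightarrow> bool" where
  "small_category \<kappa> J \<longleftrightarrow> category J \<and> |Ar J| <o \<kappa>"

definition locally_small :: "'u rel \<Rightarrow> ('o, 'a, 'z) category_scheme \<Rightarrow> bool" where
  "locally_small \<kappa> C \<longleftrightarrow> (\<forall>X\<in>Ob C. \<forall>Y\<in>Ob C. |hom C X Y| <o \<kappa>)"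

definition is_cocone ::
  "('o2, 'a2, 'z) category_scheme \<Rightarrow> ('o1, 'a1, 'y) category_scheme \<Rightarrow>
   ('o1, 'a1, 'o2, 'a2) func \<Rightarrow> 'o2 \<Rightarrow> ('o1 \<Rightarrow> 'a2) \<Rightarrow> bool" where
  "is_cocone C J F X c \<longleftrightarrow>
     X \<in> Ob C \<and> (\<forall>j\<in>Ob J. c j \<in> hom C (ObMap F j) X) \<and>
     (\<forall>u\<in>Ar J. c (Cod J u) \<cdot>\<^bsub>C\<^esub> ArMap F u = c (Dom J u))"

definition is_colimit ::
  "('o2, 'a2, 'z) category_scheme \<Rightarrow> ('o1, 'a1, 'y) category_scheme \<Rightarrow>
   ('o1, 'a1, 'o2, 'a2) func \<Rightarrow> 'o2 \<Rightarrow> ('o1 \<Rightarrow> 'a2) \<Rightarrow> bool" where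
  "is_colimit C J F X c \<longleftrightarrow>
     is_cocone C J F X c \<and>
     (\<forall>Y d. is_cocone C J F Y d \<longrightarrow> (\<exists>!h. h \<in> hom C X Y \<and> (\<forall>j\<in>Ob J. h \<cdot>\<^bsub>C\<^esub> c j = d j)))"

text \<open>
  Small index categories are taken with objects and arrows in the carrier type \<open>'u\<close> of
  \<open>\<kappa>\<close>. This loses no generality: every small category, over any types, is isomorphic to one
  of this form.
\<close>

definition cocomplete :: "'u rel \<Rightarrow> ('o, 'a, 'z) category_scheme \<Rightarrow> bool" where
  "cocomplete \<kappa> C \<longleftrightarrow>
     (\<forall>(J::('u, 'u) category) F. small_category \<kappa> J \<and> is_functor J C F \<longrightarrow>
        (\<exists>X c. is_colimit C J F X c))"

text \<open>
  A category is \<open>\<mu>\<close>-filtered if every diagram in it with fewer than \<open>\<mu>\<close> arrows has a cocone.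
  For \<open>\<mu> = natLeq\<close>, i.e. aleph-zero, these are the filtered categories; in particular
  the empty diagram forces non-emptiness.
\<close>

definition filtered :: "'l rel \<Rightarrow> ('u, 'u) category \<Rightarrow> bool" where
  "filtered \<mu> J \<longleftrightarrow>
     category J \<and>
     (\<forall>(K::('u, 'u) category) F. category K \<and> |Ar K| <o \<mu> \<and> is_functor K J F \<longrightarrow>
        (\<exists>X c. is_cocone J K F X c))"

definition preserves_filtered_colimits ::
  "'u rel \<Rightarrow> 'l rel \<Rightarrow> ('o1, 'a1, 'y) category_scheme \<Rightarrow> ('o2, 'a2, 'z) category_scheme \<Rightarrow>
   ('o1, 'a1, 'o2, 'a2) func \<Rightarrow> bool" where
  "preserves_filtered_colimits \<kappa> \<mu> C D T \<longleftrightarrow>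
     (\<forall>(J::('u, 'u) category) F X c.
        small_category \<kappa> J \<and> filtered \<mu> J \<and> is_functor J C F \<and> is_colimit C J F X c \<longrightarrow>
        is_colimit D J (comp_func T F) (ObMap T X) (\<lambda>j. ArMap T (c j)))"

definition set_cat :: "'u rel \<Rightarrow> ('x set, 'x set \<times> ('x \<Rightarrow> 'x) \<times> 'x set) category" where
  "set_cat \<kappa> = \<lparr>Ob = {A. |A| <o \<kappa>},
     Ar = {(A, f, B). |A| <o \<kappa> \<and> |B| <o \<kappa> \<and> f \<in> A \<rightarrow>\<^sub>E B},
     Dom = (\<lambda>(A, f, B). A), Cod = (\<lambda>(A, f, B). B),
     Ident = (\<lambda>A. (A, restrict (\<lambda>x. x) A, A)),
     Comp = (\<lambda>(B, g, D) (A, f, B'). (A, compose A g f, D))\<rparr>"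

text \<open>
  The covariant hom-functor \<open>C(K,-)\<close> into small sets. The target consists of sets of elements
  of the sum type \<open>'a + 'u\<close>: the left summand holds the arrows of \<open>C\<close>, and the right one
  ensures that sets of every small cardinality occur, whatever the type \<open>'a\<close> is.
\<close>

definition hom_func ::
  "('o, 'a, 'z) category_scheme \<Rightarrow> 'o \<Rightarrow>
   ('o, 'a, ('a + 'u) set, ('a + 'u) set \<times> ('a + 'u \<Rightarrow> 'a + 'u) \<times> ('a + 'u) set) func" where
  "hom_func C K = \<lparr>ObMap = (\<lambda>X. Inl ` hom C K X),
     ArMap = (\<lambda>g. (Inl ` hom C K (Dom C g),
                   restrict (\<lambda>x. Inl (g \<cdot>\<^bsub>C\<^esub> projl x)) (Inl ` hom C K (Dom C g)),
                   Inl ` hom C K (Cod C g)))\<rparr>"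

definition presentable ::
  "'u rel \<Rightarrow> 'u rel \<Rightarrow> ('o, 'a, 'z) category_scheme \<Rightarrow> 'o \<Rightarrow> bool" where
  "presentable \<kappa> \<mu> C K \<longleftrightarrow>
     K \<in> Ob C \<and>
     preserves_filtered_colimits \<kappa> \<mu> C (set_cat \<kappa>)
       (hom_func C K ::
         ('o, 'a, ('a + 'u) set, ('a + 'u) set \<times> ('a + 'u \<Rightarrow> 'a + 'u) \<times> ('a + 'u) set) func)"

definition locally_presentable :: "'u rel \<Rightarrow> ('o, 'a, 'z) category_scheme \<Rightarrow> bool" where
  "locally_presentable \<kappa> C \<longleftrightarrow>
     category C \<and> locally_small \<kappa> C \<and> cocomplete \<kappa> C \<and>
     (\<exists>\<mu>::'u rel. regular_cardinal \<mu> \<and> \<mu> <o \<kappa> \<and>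
       (\<exists>S. |S| <o \<kappa> \<and> (\<forall>K\<in>S. presentable \<kappa> \<mu> C K) \<and>
         (\<forall>X\<in>Ob C. \<exists>(J::('u, 'u) category) F c.
            small_category \<kappa> J \<and> filtered \<mu> J \<and> is_functor J C F \<and>
            (\<forall>j\<in>Ob J. ObMap F j \<in> S) \<and> is_colimit C J F X c)))"

section \<open>Symmetric monoidal closed categories\<close>

text \<open>
  \<open>\<otimes>\<close> is the tensor product on objects and \<open>\<boxtimes>\<close> the one on arrows. The structural arrows are
  \<open>Assoc X Y Z : (X \<otimes> Y) \<otimes> Z \<rightarrow> X \<otimes> (Y \<otimes> Z)\<close>, \<open>LUnit X : I \<otimes> X \<rightarrow> X\<close>,
  \<open>RUnit X : X \<otimes> I \<rightarrow> X\<close>, \<open>Symm X Y : X \<otimes> Y \<rightarrow> Y \<otimes> X\<close> and the evaluation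
  \<open>Eval X Y : [X, Y] \<otimes> X \<rightarrow> Y\<close>.
\<close>

record ('o, 'a) smc_category = "('o, 'a) category" +
  TensO :: "'o \<Rightarrow> 'o \<Rightarrow> 'o" (infixl "\<otimes>\<index>" 75)
  TensA :: "'a \<Rightarrow> 'a \<Rightarrow> 'a" (infixl "\<boxtimes>\<index>" 75)
  UnitO :: "'o"
  Assoc :: "'o \<Rightarrow> 'o \<Rightarrow> 'o \<Rightarrow> 'a"
  LUnit :: "'o \<Rightarrow> 'a"
  RUnit :: "'o \<Rightarrow> 'a"
  Symm :: "'o \<Rightarrow> 'o \<Rightarrow> 'a"
  IHom :: "'o \<Rightarrow> 'o \<Rightarrow> 'o"
  Eval :: "'o \<Rightarrow> 'o \<Rightarrow> 'a"

definition tensor_func ::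
  "('o, 'a, 'z) smc_category_scheme \<Rightarrow> ('o \<times> 'o, 'a \<times> 'a, 'o, 'a) func" where
  "tensor_func V = \<lparr>ObMap = (\<lambda>(X, Y). X \<otimes>\<^bsub>V\<^esub> Y), ArMap = (\<lambda>(f, g). f \<boxtimes>\<^bsub>V\<^esub> g)\<rparr>"

definition tensor_left_func ::
  "('o, 'a, 'z) smc_category_scheme \<Rightarrow> 'o \<Rightarrow> ('o, 'a, 'o, 'a) func" where
  "tensor_left_func V X = \<lparr>ObMap = (\<lambda>Y. X \<otimes>\<^bsub>V\<^esub> Y), ArMap = (\<lambda>f. Ident V X \<boxtimes>\<^bsub>V\<^esub> f)\<rparr>"

definition monoidal :: "('o, 'a, 'z) smc_category_scheme \<Rightarrow> bool" where
  "monoidal V \<longleftrightarrow>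
     category V \<and> is_functor (prod_cat V V) V (tensor_func V) \<and> UnitO V \<in> Ob V \<and>
     (\<forall>X\<in>Ob V. \<forall>Y\<in>Ob V. \<forall>Z\<in>Ob V.
        Assoc V X Y Z \<in> iso V (X \<otimes>\<^bsub>V\<^esub> Y \<otimes>\<^bsub>V\<^esub> Z) (X \<otimes>\<^bsub>V\<^esub> (Y \<otimes>\<^bsub>V\<^esub> Z))) \<and>
     (\<forall>X\<in>Ob V. LUnit V X \<in> iso V (UnitO V \<otimes>\<^bsub>V\<^esub> X) X) \<and>
     (\<forall>X\<in>Ob V. RUnit V X \<in> iso V (X \<otimes>\<^bsub>V\<^esub> UnitO V) X) \<and>
     (\<forall>f\<in>Ar V. \<forall>g\<in>Ar V. \<forall>h\<in>Ar V.
        Assoc V (Cod V f) (Cod V g) (Cod V h) \<cdot>\<^bsub>V\<^esub> (f \<boxtimes>\<^bsub>V\<^esub> g \<boxtimes>\<^bsub>V\<^esub> h)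
          = (f \<boxtimes>\<^bsub>V\<^esub> (g \<boxtimes>\<^bsub>V\<^esub> h)) \<cdot>\<^bsub>V\<^esub> Assoc V (Dom V f) (Dom V g) (Dom V h)) \<and>
     (\<forall>f\<in>Ar V. LUnit V (Cod V f) \<cdot>\<^bsub>V\<^esub> (Ident V (UnitO V) \<boxtimes>\<^bsub>V\<^esub> f) = f \<cdot>\<^bsub>V\<^esub> LUnit V (Dom V f)) \<and>
     (\<forall>f\<in>Ar V. RUnit V (Cod V f) \<cdot>\<^bsub>V\<^esub> (f \<boxtimes>\<^bsub>V\<^esub> Ident V (UnitO V)) = f \<cdot>\<^bsub>V\<^esub> RUnit V (Dom V f)) \<and>
     (\<forall>W\<in>Ob V. \<forall>X\<in>Ob V. \<forall>Y\<in>Ob V. \<forall>Z\<in>Ob V.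
        Assoc V W X (Y \<otimes>\<^bsub>V\<^esub> Z) \<cdot>\<^bsub>V\<^esub> Assoc V (W \<otimes>\<^bsub>V\<^esub> X) Y Z
          = (Ident V W \<boxtimes>\<^bsub>V\<^esub> Assoc V X Y Z) \<cdot>\<^bsub>V\<^esub> Assoc V W (X \<otimes>\<^bsub>V\<^esub> Y) Z
              \<cdot>\<^bsub>V\<^esub> (Assoc V W X Y \<boxtimes>\<^bsub>V\<^esub> Ident V Z)) \<and>
     (\<forall>X\<in>Ob V. \<forall>Y\<in>Ob V.
        (Ident V X \<boxtimes>\<^bsub>V\<^esub> LUnit V Y) \<cdot>\<^bsub>V\<^esub> Assoc V X (UnitO V) Y = RUnit V X \<boxtimes>\<^bsub>V\<^esub> Ident V Y)"

definition symmetric_monoidal :: "('o, 'a, 'z) smc_category_scheme \<Rightarrow> bool" where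
  "symmetric_monoidal V \<longleftrightarrow>
     monoidal V \<and>
     (\<forall>X\<in>Ob V. \<forall>Y\<in>Ob V. Symm V X Y \<in> hom V (X \<otimes>\<^bsub>V\<^esub> Y) (Y \<otimes>\<^bsub>V\<^esub> X)) \<and>
     (\<forall>f\<in>Ar V. \<forall>g\<in>Ar V.
        Symm V (Cod V f) (Cod V g) \<cdot>\<^bsub>V\<^esub> (f \<boxtimes>\<^bsub>V\<^esub> g)
          = (g \<boxtimes>\<^bsub>V\<^esub> f) \<cdot>\<^bsub>V\<^esub> Symm V (Dom V f) (Dom V g)) \<and>
     (\<forall>X\<in>Ob V. \<forall>Y\<in>Ob V. Symm V Y X \<cdot>\<^bsub>V\<^esub> Symm V X Y = Ident V (X \<otimes>\<^bsub>V\<^esub> Y)) \<and>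
     (\<forall>X\<in>Ob V. \<forall>Y\<in>Ob V. \<forall>Z\<in>Ob V.
        Assoc V Y Z X \<cdot>\<^bsub>V\<^esub> Symm V X (Y \<otimes>\<^bsub>V\<^esub> Z) \<cdot>\<^bsub>V\<^esub> Assoc V X Y Z
          = (Ident V Y \<boxtimes>\<^bsub>V\<^esub> Symm V X Z) \<cdot>\<^bsub>V\<^esub> Assoc V Y X Z
              \<cdot>\<^bsub>V\<^esub> (Symm V X Y \<boxtimes>\<^bsub>V\<^esub> Ident V Z))"

text \<open>
  Closedness: the functor \<open>- \<otimes> X\<close> has a right adjoint \<open>[X, -]\<close> with counit \<open>Eval X\<close>, given
  by the universal property of the counit.
\<close>

definition symmetric_monoidal_closed :: "('o, 'a, 'z) smc_category_scheme \<Rightarrow> bool" where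
  "symmetric_monoidal_closed V \<longleftrightarrow>
     symmetric_monoidal V \<and>
     (\<forall>X\<in>Ob V. \<forall>Y\<in>Ob V.
        IHom V X Y \<in> Ob V \<and> Eval V X Y \<in> hom V (IHom V X Y \<otimes>\<^bsub>V\<^esub> X) Y \<and>
        (\<forall>Z\<in>Ob V. \<forall>f\<in>hom V (Z \<otimes>\<^bsub>V\<^esub> X) Y.
           \<exists>!g. g \<in> hom V Z (IHom V X Y) \<and> Eval V X Y \<cdot>\<^bsub>V\<^esub> (g \<boxtimes>\<^bsub>V\<^esub> Ident V X) = f))"

definition transpose ::
  "('o, 'a, 'z) smc_category_scheme \<Rightarrow> 'o \<Rightarrow> 'o \<Rightarrow> 'o \<Rightarrow> 'a \<Rightarrow> 'a" where
  "transpose V Z X Y f =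
     (THE g. g \<in> hom V Z (IHom V X Y) \<and> Eval V X Y \<cdot>\<^bsub>V\<^esub> (g \<boxtimes>\<^bsub>V\<^esub> Ident V X) = f)"

definition admissible :: "'u rel \<Rightarrow> ('o, 'a, 'z) smc_category_scheme \<Rightarrow> bool" where
  "admissible \<kappa> V \<longleftrightarrow>
     locally_presentable \<kappa> V \<and>
     (\<forall>X\<in>Ob V. preserves_filtered_colimits \<kappa> natLeq V V (tensor_left_func V X))"

section \<open>Monoids and comonoids\<close>

text \<open>
  Arrows of \<open>Mon V\<close> and \<open>Comon V\<close> carry their domain and codomain (co)monoids.
\<close>

type_synonym ('o, 'a) struct = "'o \<times> 'a \<times> 'a"

definition is_monoid :: "('o, 'a, 'z) smc_category_scheme \<Rightarrow> ('o, 'a) struct \<Rightarrow> bool" where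
  "is_monoid V = (\<lambda>(A, m, \<eta>).
     A \<in> Ob V \<and> m \<in> hom V (A \<otimes>\<^bsub>V\<^esub> A) A \<and> \<eta> \<in> hom V (UnitO V) A \<and>
     m \<cdot>\<^bsub>V\<^esub> (m \<boxtimes>\<^bsub>V\<^esub> Ident V A) = m \<cdot>\<^bsub>V\<^esub> (Ident V A \<boxtimes>\<^bsub>V\<^esub> m) \<cdot>\<^bsub>V\<^esub> Assoc V A A A \<and>
     m \<cdot>\<^bsub>V\<^esub> (\<eta> \<boxtimes>\<^bsub>V\<^esub> Ident V A) = LUnit V A \<and>
     m \<cdot>\<^bsub>V\<^esub> (Ident V A \<boxtimes>\<^bsub>V\<^esub> \<eta>) = RUnit V A)"

definition is_monoid_hom ::
  "('o, 'a, 'z) smc_category_scheme \<Rightarrow> ('o, 'a) struct \<Rightarrow> 'a \<Rightarrow> ('o, 'a) struct \<Rightarrow> bool" where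
  "is_monoid_hom V = (\<lambda>(A, m, \<eta>) f (A', m', \<eta>').
     f \<in> hom V A A' \<and> f \<cdot>\<^bsub>V\<^esub> m = m' \<cdot>\<^bsub>V\<^esub> (f \<boxtimes>\<^bsub>V\<^esub> f) \<and> f \<cdot>\<^bsub>V\<^esub> \<eta> = \<eta>')"

definition is_comonoid :: "('o, 'a, 'z) smc_category_scheme \<Rightarrow> ('o, 'a) struct \<Rightarrow> bool" where
  "is_comonoid V = (\<lambda>(C, \<Delta>, \<epsilon>).
     C \<in> Ob V \<and> \<Delta> \<in> hom V C (C \<otimes>\<^bsub>V\<^esub> C) \<and> \<epsilon> \<in> hom V C (UnitO V) \<and>
     Assoc V C C C \<cdot>\<^bsub>V\<^esub> (\<Delta> \<boxtimes>\<^bsub>V\<^esub> Ident V C) \<cdot>\<^bsub>V\<^esub> \<Delta> = (Ident V C \<boxtimes>\<^bsub>V\<^esub> \<Delta>) \<cdot>\<^bsub>V\<^esub> \<Delta> \<and>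
     LUnit V C \<cdot>\<^bsub>V\<^esub> (\<epsilon> \<boxtimes>\<^bsub>V\<^esub> Ident V C) \<cdot>\<^bsub>V\<^esub> \<Delta> = Ident V C \<and>
     RUnit V C \<cdot>\<^bsub>V\<^esub> (Ident V C \<boxtimes>\<^bsub>V\<^esub> \<epsilon>) \<cdot>\<^bsub>V\<^esub> \<Delta> = Ident V C)"

definition is_comonoid_hom ::
  "('o, 'a, 'z) smc_category_scheme \<Rightarrow> ('o, 'a) struct \<Rightarrow> 'a \<Rightarrow> ('o, 'a) struct \<Rightarrow> bool" where
  "is_comonoid_hom V = (\<lambda>(C, \<Delta>, \<epsilon>) f (C', \<Delta>', \<epsilon>').
     f \<in> hom V C C' \<and> \<Delta>' \<cdot>\<^bsub>V\<^esub> f = (f \<boxtimes>\<^bsub>V\<^esub> f) \<cdot>\<^bsub>V\<^esub> \<Delta> \<and> \<epsilon>' \<cdot>\<^bsub>V\<^esub> f = \<epsilon>)"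

type_synonym ('o, 'a) struct_arrow = "('o, 'a) struct \<times> 'a \<times> ('o, 'a) struct"

definition Mon ::
  "('o, 'a, 'z) smc_category_scheme \<Rightarrow> (('o, 'a) struct, ('o, 'a) struct_arrow) category" where
  "Mon V = \<lparr>Ob = {M. is_monoid V M},
     Ar = {(M, f, N). is_monoid V M \<and> is_monoid V N \<and> is_monoid_hom V M f N},
     Dom = (\<lambda>(M, f, N). M), Cod = (\<lambda>(M, f, N). N),
     Ident = (\<lambda>M. (M, Ident V (fst M), M)),
     Comp = (\<lambda>(N, g, P) (M, f, N'). (M, g \<cdot>\<^bsub>V\<^esub> f, P))\<rparr>"

definition Comon ::
  "('o, 'a, 'z) smc_category_scheme \<Rightarrow> (('o, 'a) struct, ('o, 'a) struct_arrow) category" where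
  "Comon V = \<lparr>Ob = {C. is_comonoid V C},
     Ar = {(C, f, D). is_comonoid V C \<and> is_comonoid V D \<and> is_comonoid_hom V C f D},
     Dom = (\<lambda>(C, f, D). C), Cod = (\<lambda>(C, f, D). D),
     Ident = (\<lambda>C. (C, Ident V (fst C), C)),
     Comp = (\<lambda>(D, g, E) (C, f, D'). (C, g \<cdot>\<^bsub>V\<^esub> f, E))\<rparr>"

section \<open>The convolution functor\<close>

text \<open>
  \<open>interchange V W X Y Z : (W \<otimes> X) \<otimes> (Y \<otimes> Z) \<rightarrow> (W \<otimes> Y) \<otimes> (X \<otimes> Z)\<close> is \<open>1 \<otimes> s \<otimes> 1\<close>
  with the associativity isomorphisms written out.
\<close>

definition interchange ::
  "('o, 'a, 'z) smc_category_scheme \<Rightarrow> 'o \<Rightarrow> 'o \<Rightarrow> 'o \<Rightarrow> 'o \<Rightarrow> 'a" where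
  "interchange V W X Y Z =
     inv_arr V (Assoc V W Y (X \<otimes>\<^bsub>V\<^esub> Z))
     \<cdot>\<^bsub>V\<^esub> (Ident V W \<boxtimes>\<^bsub>V\<^esub>
         (Assoc V Y X Z \<cdot>\<^bsub>V\<^esub> (Symm V X Y \<boxtimes>\<^bsub>V\<^esub> Ident V Z) \<cdot>\<^bsub>V\<^esub> inv_arr V (Assoc V X Y Z)))
     \<cdot>\<^bsub>V\<^esub> Assoc V W X (Y \<otimes>\<^bsub>V\<^esub> Z)"

definition convolution_mult ::
  "('o, 'a, 'z) smc_category_scheme \<Rightarrow> ('o, 'a) struct \<Rightarrow> ('o, 'a) struct \<Rightarrow> 'a" where
  "convolution_mult V = (\<lambda>(C, \<Delta>, \<epsilon>) (A, m, \<eta>).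
     let E = IHom V C A in
       transpose V (E \<otimes>\<^bsub>V\<^esub> E) C A
         (m \<cdot>\<^bsub>V\<^esub> (Eval V C A \<boxtimes>\<^bsub>V\<^esub> Eval V C A) \<cdot>\<^bsub>V\<^esub> interchange V E E C C
            \<cdot>\<^bsub>V\<^esub> (Ident V (E \<otimes>\<^bsub>V\<^esub> E) \<boxtimes>\<^bsub>V\<^esub> \<Delta>)))"

definition convolution_unit ::
  "('o, 'a, 'z) smc_category_scheme \<Rightarrow> ('o, 'a) struct \<Rightarrow> ('o, 'a) struct \<Rightarrow> 'a" where
  "convolution_unit V = (\<lambda>(C, \<Delta>, \<epsilon>) (A, m, \<eta>).
     transpose V (UnitO V) C A (\<eta> \<cdot>\<^bsub>V\<^esub> \<epsilon> \<cdot>\<^bsub>V\<^esub> LUnit V C))"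

definition convolution ::
  "('o, 'a, 'z) smc_category_scheme \<Rightarrow> ('o, 'a) struct \<Rightarrow> ('o, 'a) struct \<Rightarrow> ('o, 'a) struct" where
  "convolution V C A =
     (IHom V (fst C) (fst A), convolution_mult V C A, convolution_unit V C A)"

text \<open>
  For \<open>f : C' \<rightarrow> C\<close> and \<open>g : A \<rightarrow> A'\<close>, the arrow \<open>[f, g] : [C, A] \<rightarrow> [C', A']\<close>.
\<close>

definition ihom_arr :: "('o, 'a, 'z) smc_category_scheme \<Rightarrow> 'a \<Rightarrow> 'a \<Rightarrow> 'a" where
  "ihom_arr V f g =
     (let E = IHom V (Cod V f) (Dom V g) in
       transpose V E (Dom V f) (Cod V g)
         (g \<cdot>\<^bsub>V\<^esub> Eval V (Cod V f) (Dom V g) \<cdot>\<^bsub>V\<^esub> (Ident V E \<boxtimes>\<^bsub>V\<^esub> f)))"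

text \<open>
  \<open>H : prod_cat (op_cat (Comon V)) (Mon V) \<rightarrow> Mon V\<close>. An arrow \<open>(C', f, C)\<close> of \<open>Comon V\<close> is an
  arrow \<open>C \<rightarrow> C'\<close> of \<open>op_cat (Comon V)\<close>.
\<close>

definition H_func ::
  "('o, 'a, 'z) smc_category_scheme \<Rightarrow>
   (('o, 'a) struct \<times> ('o, 'a) struct, ('o, 'a) struct_arrow \<times> ('o, 'a) struct_arrow,
    ('o, 'a) struct, ('o, 'a) struct_arrow) func" where
  "H_func V = \<lparr>ObMap = (\<lambda>(C, A). convolution V C A),
     ArMap = (\<lambda>((C', f, C), (A, g, A')).
       (convolution V C A, ihom_arr V f g, convolution V C' A'))\<rparr>"

text \<open>\<open>H(-, B) : op_cat (Comon V) \<rightarrow> Mon V\<close>\<close>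

definition H_fix ::
  "('o, 'a, 'z) smc_category_scheme \<Rightarrow> ('o, 'a) struct \<Rightarrow>
   (('o, 'a) struct, ('o, 'a) struct_arrow, ('o, 'a) struct, ('o, 'a) struct_arrow) func" where
  "H_fix V B = \<lparr>ObMap = (\<lambda>C. ObMap (H_func V) (C, B)),
     ArMap = (\<lambda>f. ArMap (H_func V) (f, Ident (Mon V) B))\<rparr>"

end

theory Submission
  imports Defs
begin

text \<open>
  Transposition turns monoid morphisms \<open>A \<rightarrow> [C, B]\<close> into measurings \<open>A \<otimes> C \<rightarrow> B\<close>, so
  that the right adjoint at \<open>A\<close> is the comonoid of a terminal object in the category of
  measurings of \<open>A\<close> and \<open>B\<close>. This category has small colimits, created in \<open>V\<close>, and it
  remains to find a small weakly terminal set. Every arrow \<open>K \<rightarrow> C\<close> from a presentable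
  object to a comonoid factors through a comonoid \<open>D \<rightarrow> C\<close> whose underlying object is the
  colimit of a countable chain of presentable objects: the comultiplication and the comonoid
  axioms are lifted along a filtered presentation of \<open>C\<close>, one step of the chain at a time.
  Hence a small set \<open>S\<close> of measurings reaches all presentable elements of every measuring
  \<open>X\<close>. Identifying in \<open>X\<close> all parallel arrows from members of \<open>S\<close> gives a quotient that
  is determined by a relation on the presentable elements of members of \<open>S\<close>, and there is
  only a small set of such relations.
\<close>

section \<open>Small sets\<close>

text \<open>To show that a measuring is a colimit of small ones, any two factorizations of a
  presentable element would have to be linked by arrows between small measurings. Terminality can be
  had for less: it is enough that every measuring maps to a member of a small set. This is why
  quotients are used. Once all arrows from a small measuring to \<open>X\<close> have become equal,
  one arrow per small measuring is left, and that family is governed by a relation alone. The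
  comonoids built along chains are not claimed to be presentable. What counts is that a countable
  chain is a sequence in a small set, and that such sequences form a small set because
  \<open>\<kappa>\<close> is an uncountable strong limit. Countable length suffices because each
  step has to satisfy only finitely many equations between arrows out of a presentable object, and
  each of these already holds at some later index of a filtered diagram. Colimits meet tensor
  products through the internal hom: \<open>- \<otimes> X\<close> is a left adjoint, so colimits,
  and even jointly epimorphic families, survive tensoring.\<close>

lemma inj_into_field:
  fixes \<kappa> :: "'u rel" and A :: "'x set"
  assumes "Card_order \<kappa>" "|A| <o \<kappa>"
  obtains p :: "'x \<Rightarrow> 'u" where "inj_on p A"
proof -
  have "|A| \<le>o |Field \<kappa>|"
    using ordLess_imp_ordLeq[OF ordLess_ordIso_trans[OF assms(2) ordIso_symmetric[OF card_of_Field_ordIso[OF assms(1)]]]] .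
  from this[folded card_of_ordLeq] show ?thesis using that by (elim exE conjE)
qed

locale inaccessible_cardinal =
  fixes \<kappa> :: "'u rel"
  assumes inaccessible: "inaccessible \<kappa>"
begin

abbreviation small :: "'x set \<Rightarrow> bool" where
  "small A \<equiv> |A| <o \<kappa>"

lemma card: "Card_order \<kappa>" and cinf: "Cinfinite \<kappa>" and reg: "regularCard \<kappa>" and
  uncountable: "natLeq <o \<kappa>" and infinite_field: "\<not> finite (Field \<kappa>)"
proof -
  show c: "Card_order \<kappa>" and "regularCard \<kappa>" and "natLeq <o \<kappa>"
    using inaccessible by (auto simp: inaccessible_def regular_cardinal_def)
  then show "\<not> finite (Field \<kappa>)" 
    using inaccessible unfolding inaccessible_def regular_cardinal_def
    by (metis card_of_Field_ordIso infinite_iff_natLeq_ordLeq ordIso_symmetric ordLeq_ordIso_trans)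
  then show "Cinfinite \<kappa>" using c by (simp add: cinfinite_def)
qed

lemma small_subset: "small B \<Longrightarrow> A \<subseteq> B \<Longrightarrow> small A"
  by (rule ordLeq_ordLess_trans[OF card_of_mono1])

lemma small_image: "small A \<Longrightarrow> small (f ` A)"
  by (rule ordLeq_ordLess_trans[OF card_of_image])

lemma small_image_subset: "small A \<Longrightarrow> B \<subseteq> f ` A \<Longrightarrow> small B"
  using small_image small_subset by blast

lemma small_inj: "inj_on f A \<Longrightarrow> small (f ` A) \<Longrightarrow> small A"
  by (rule ordLeq_ordLess_trans[OF card_of_ordLeqI]) auto

lemma small_UN: "small I \<Longrightarrow> (\<And>i. i \<in> I \<Longrightarrow> small (A i)) \<Longrightarrow> small (\<Union>i\<in>I. A i)"
  by (rule card_of_UNION_ordLess_infinite_Field_regularCard[OF reg cinf]) auto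

lemma small_Sigma:
  assumes "small I" "\<And>i. i \<in> I \<Longrightarrow> small (A i)" shows "small (Sigma I A)"
proof -
  have *: "Sigma I A = (\<Union>i\<in>I. Pair i ` A i)" by blast
  show ?thesis unfolding * by (intro small_UN small_image assms)
qed

lemma small_Times: "small A \<Longrightarrow> small B \<Longrightarrow> small (A \<times> B)"
  by (rule small_Sigma)

lemma small_finite: "finite A \<Longrightarrow> small A"
  by (rule ordLess_transitive[OF _ uncountable]) (simp add: finite_iff_ordLess_natLeq[symmetric])

lemma small_nat: "small (UNIV :: nat set)"
  by (rule ordIso_ordLess_trans[OF card_of_nat uncountable])

lemma small_Un: "small A \<Longrightarrow> small B \<Longrightarrow> small (A \<union> B)"
  by (rule card_of_Un_ordLess_infinite_Field[OF infinite_field card])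

lemma small_Plus: "small A \<Longrightarrow> small B \<Longrightarrow> small (A <+> B)"
  unfolding Plus_def by (simp add: small_Un small_image)

text \<open>Inaccessibility bounds powersets only for sets of elements of \<open>'u\<close>. An
  injection into \<open>'u\<close> carries the bound over to sets of any type.\<close>

lemma small_Pow: fixes A :: "'x set" assumes "small A" shows "small (Pow A)"
proof -
  obtain p :: "'x \<Rightarrow> 'u" where p: "inj_on p A" using inj_into_field[OF card assms] by blast
  have "small (Pow (p ` A))"
    using inaccessible small_image[OF assms] by (auto simp: inaccessible_def)
  moreover have "(`) p ` Pow A = Pow (p ` A)" by (simp add: image_Pow_surj)
  ultimately show ?thesis using small_inj[OF inj_on_image_Pow[OF p]] by simp
qed

text \<open>A sequence is recovered from its graph, a subset of the small set of pairs of a number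
  and an element of \<open>A\<close>. This later bounds the number of countable chains; both
  uncountability and closure under powersets enter.\<close>

lemma small_sequences:
  fixes A :: "'x set" assumes "small A" shows "small {f :: nat \<Rightarrow> 'x. range f \<subseteq> A}"
proof (rule small_inj)
  show "inj_on (\<lambda>f. {(n, f n) |n. True}) {f :: nat \<Rightarrow> 'x. range f \<subseteq> A}"
    by (rule inj_onI) (fastforce simp: set_eq_iff fun_eq_iff)
  show "small ((\<lambda>f. {(n, f n) |n. True}) ` {f :: nat \<Rightarrow> 'x. range f \<subseteq> A})"
    by (rule small_subset[OF small_Pow[OF small_Times[OF small_nat assms]]]) auto
qed

end

section \<open>Categories\<close>

text \<open>Stated as a conjunction so that a single instance \<open>homD[OF f]\<close>, declared as
  a simplification rule, supplies all the typing facts on which the rules for composites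
  depend.\<close>

lemma homD: "f \<in> hom C X Y \<Longrightarrow> f \<in> Ar C \<and> Dom C f = X \<and> Cod C f = Y"
  by (simp add: hom_def)

locale cat =
  fixes C :: "('o, 'a, 'z) category_scheme" (structure)
  assumes category: "category C"
begin

lemma dom_ob [simp]: "f \<in> Ar C \<Longrightarrow> Dom C f \<in> Ob C"
  and cod_ob [simp]: "f \<in> Ar C \<Longrightarrow> Cod C f \<in> Ob C"
  using category by (auto simp: category_def)

lemma id_hom: "X \<in> Ob C \<Longrightarrow> Ident C X \<in> hom C X X"
  using category by (auto simp: category_def)

lemma id_simps [simp]:
  assumes "X \<in> Ob C"
  shows "Ident C X \<in> Ar C" "Dom C (Ident C X) = X" "Cod C (Ident C X) = X"
  using id_hom[OF assms] by (auto simp: hom_def)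

lemma comp_simps [simp]:
  assumes "f \<in> Ar C" "g \<in> Ar C" "Dom C g = Cod C f"
  shows "g \<cdot> f \<in> Ar C" "Dom C (g \<cdot> f) = Dom C f" "Cod C (g \<cdot> f) = Cod C g"
  using category assms by (auto simp: category_def hom_def)

lemma comp_hom: "f \<in> hom C X Y \<Longrightarrow> g \<in> hom C Y Z \<Longrightarrow> g \<cdot> f \<in> hom C X Z"
  by (auto simp: hom_def)

lemma comp_id_right [simp]: "f \<in> Ar C \<Longrightarrow> Dom C f = X \<Longrightarrow> f \<cdot> Ident C X = f"
  and comp_id_left [simp]: "f \<in> Ar C \<Longrightarrow> Cod C f = X \<Longrightarrow> Ident C X \<cdot> f = f"
  using category by (auto simp: category_def)

lemma comp_assoc:
  "f \<in> Ar C \<Longrightarrow> g \<in> Ar C \<Longrightarrow> h \<in> Ar C \<Longrightarrow> Dom C g = Cod C f \<Longrightarrow> Dom C h = Cod C g \<Longrightarrow>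
    (h \<cdot> g) \<cdot> f = h \<cdot> (g \<cdot> f)"
  using category by (auto simp: category_def)

text \<open>Composites are kept nested to the right, and there the left-hand side of an equation
  \<open>g \<cdot> f = k\<close> is no longer a subterm once something is composed before it. This
  form rewrites in that position.\<close>

lemma comp_reduce:
  "g \<cdot> f = k \<Longrightarrow> h \<in> Ar C \<Longrightarrow> f \<in> Ar C \<Longrightarrow> g \<in> Ar C \<Longrightarrow> Dom C f = Cod C h \<Longrightarrow> Dom C g = Cod C f \<Longrightarrow>
    g \<cdot> (f \<cdot> h) = k \<cdot> h"
  by (simp flip: comp_assoc)

end

section \<open>Diagrams on graphs\<close>

text \<open>A vertex \<open>i \<in> I\<close> is labelled by the object \<open>F i\<close>, and an edge is a triple \<open>(i, u, j)\<close>
  with \<open>u : F i \<rightarrow> F j\<close>. Working with graphs avoids the choice of index categories.\<close>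

definition graph ::
  "('o, 'a, 'z) category_scheme \<Rightarrow> 'i set \<Rightarrow> ('i \<Rightarrow> 'o) \<Rightarrow> ('i \<times> 'a \<times> 'i) set \<Rightarrow> bool" where
  "graph C I F E \<longleftrightarrow> (\<forall>i\<in>I. F i \<in> Ob C) \<and> (\<forall>(i, u, j)\<in>E. i \<in> I \<and> j \<in> I \<and> u \<in> hom C (F i) (F j))"

definition graph_cocone ::
  "('o, 'a, 'z) category_scheme \<Rightarrow> 'i set \<Rightarrow> ('i \<Rightarrow> 'o) \<Rightarrow> ('i \<times> 'a \<times> 'i) set \<Rightarrow>
   'o \<Rightarrow> ('i \<Rightarrow> 'a) \<Rightarrow> bool" where
  "graph_cocone C I F E X c \<longleftrightarrow>
     X \<in> Ob C \<and> (\<forall>i\<in>I. c i \<in> hom C (F i) X) \<and> (\<forall>(i, u, j)\<in>E. c j \<cdot>\<^bsub>C\<^esub> u = c i)"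

text \<open>The uniqueness half of a colimit, split off because it passes to tensor products on its
  own and because it alone lets equations between arrows out of a colimit be checked on the
  legs.\<close>

definition jointly_epi ::
  "('o, 'a, 'z) category_scheme \<Rightarrow> 'i set \<Rightarrow> 'o \<Rightarrow> ('i \<Rightarrow> 'a) \<Rightarrow> bool" where
  "jointly_epi C I X c \<longleftrightarrow>
     (\<forall>Y. \<forall>f\<in>hom C X Y. \<forall>g\<in>hom C X Y. (\<forall>i\<in>I. f \<cdot>\<^bsub>C\<^esub> c i = g \<cdot>\<^bsub>C\<^esub> c i) \<longrightarrow> f = g)"

definition graph_colimit ::
  "('o, 'a, 'z) category_scheme \<Rightarrow> 'i set \<Rightarrow> ('i \<Rightarrow> 'o) \<Rightarrow> ('i \<times> 'a \<times> 'i) set \<Rightarrow>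
   'o \<Rightarrow> ('i \<Rightarrow> 'a) \<Rightarrow> bool" where
  "graph_colimit C I F E X c \<longleftrightarrow>
     graph_cocone C I F E X c \<and>
     (\<forall>Y d. graph_cocone C I F E Y d \<longrightarrow> (\<exists>h\<in>hom C X Y. \<forall>i\<in>I. h \<cdot>\<^bsub>C\<^esub> c i = d i)) \<and>
     jointly_epi C I X c"

lemma (in cat) graph_cocone_comp:
  assumes c: "graph_cocone C I F E X c" and G: "graph C I F E" and f: "f \<in> hom C X Y"
  shows "graph_cocone C I F E Y (\<lambda>i. f \<cdot> c i)"
proof -
  have "(f \<cdot> c j) \<cdot> u = f \<cdot> c i" if "(i, u, j) \<in> E" for i u j
  proof -
    have "j \<in> I" "u \<in> hom C (F i) (F j)" "c j \<cdot> u = c i" 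
      using that G c by (auto simp: graph_def graph_cocone_def)
    moreover have "c j \<in> hom C (F j) X" using \<open>j \<in> I\<close> c by (auto simp: graph_cocone_def)
    ultimately show ?thesis using f comp_assoc[of u "c j" f] by (simp add: hom_def)
  qed
  then show ?thesis using c f cod_ob comp_hom unfolding graph_cocone_def by (auto simp: hom_def)
qed

lemma jointly_epiD:
  "jointly_epi C I X c \<Longrightarrow> f \<in> hom C X Y \<Longrightarrow> g \<in> hom C X Y \<Longrightarrow>
    (\<And>i. i \<in> I \<Longrightarrow> f \<cdot>\<^bsub>C\<^esub> c i = g \<cdot>\<^bsub>C\<^esub> c i) \<Longrightarrow> f = g"
  unfolding jointly_epi_def by blast

lemma graph_colimit_cocone: "graph_colimit C I F E X c \<Longrightarrow> graph_cocone C I F E X c"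
  and graph_colimit_epi: "graph_colimit C I F E X c \<Longrightarrow> jointly_epi C I X c"
  by (auto simp: graph_colimit_def)

lemma graph_colimit_desc:
  assumes "graph_colimit C I F E X c" "graph_cocone C I F E Y d"
  obtains h where "h \<in> hom C X Y" "\<And>i. i \<in> I \<Longrightarrow> h \<cdot>\<^bsub>C\<^esub> c i = d i"
  using assms unfolding graph_colimit_def by blast

definition functor_edges ::
  "('i, 'b, 'y) category_scheme \<Rightarrow> ('i, 'b, 'o, 'a) func \<Rightarrow> ('i \<times> 'a \<times> 'i) set" where
  "functor_edges J F = {(Dom J u, ArMap F u, Cod J u) | u. u \<in> Ar J}"

lemma cocone_iff_graph_cocone:
  "is_cocone C J F X c \<longleftrightarrow> graph_cocone C (Ob J) (ObMap F) (functor_edges J F) X c"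
proof -
  have "(\<forall>(i, u, j)\<in>functor_edges J F. c j \<cdot>\<^bsub>C\<^esub> u = c i) \<longleftrightarrow> (\<forall>u\<in>Ar J. c (Cod J u) \<cdot>\<^bsub>C\<^esub> ArMap F u = c (Dom J u))"
    unfolding functor_edges_def by blast
  then show ?thesis unfolding is_cocone_def graph_cocone_def by simp
qed

lemma functor_graph:
  "is_functor J C F \<Longrightarrow> graph C (Ob J) (ObMap F) (functor_edges J F)"
  unfolding graph_def functor_edges_def is_functor_def category_def by auto

text \<open>Legs are total functions on the index type, of which only the values at objects of
  \<open>J\<close> matter. This absorbs the arbitrary values that appear when indices are renamed
  back with \<open>inv_into\<close>.\<close>

lemma cocone_cong:
  assumes "category J" "\<And>j. j \<in> Ob J \<Longrightarrow> c j = d j"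
  shows "is_cocone C J F X c \<longleftrightarrow> is_cocone C J F X d"
proof -
  have "Dom J u \<in> Ob J \<and> Cod J u \<in> Ob J" if "u \<in> Ar J" for u 
    using assms(1) that by (simp add: category_def)
  then show ?thesis using assms(2) unfolding is_cocone_def by simp
qed

lemma colimit_iff_graph_colimit:
  "is_colimit C J F X c \<longleftrightarrow> graph_colimit C (Ob J) (ObMap F) (functor_edges J F) X c"
  (is "?l \<longleftrightarrow> ?r")
  if "category C" "is_functor J C F"
proof 
  assume l: ?l
  have cc: "is_cocone C J F X c" using l by (simp add: is_colimit_def)
  interpret cat C using that(1) by unfold_locales
  have "jointly_epi C (Ob J) X c"
    unfolding jointly_epi_def
  proof (intro allI ballI impI)
    fix Y f g assume f: "f \<in> hom C X Y" and g: "g \<in> hom C X Y" and e: "\<forall>i\<in>Ob J. f \<cdot>\<^bsub>C\<^esub> c i = g \<cdot>\<^bsub>C\<^esub> c i"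
    have "is_cocone C J F Y (\<lambda>j. f \<cdot>\<^bsub>C\<^esub> c j)"
      using graph_cocone_comp[OF _ functor_graph[OF that(2)] f] cc 
      unfolding cocone_iff_graph_cocone by blast
    then have "\<exists>!h. h \<in> hom C X Y \<and> (\<forall>j\<in>Ob J. h \<cdot>\<^bsub>C\<^esub> c j = f \<cdot>\<^bsub>C\<^esub> c j)"
      using l by (simp add: is_colimit_def)
    then show "f = g" using f g e by metis
  qed
  then show ?r using l unfolding is_colimit_def graph_colimit_def cocone_iff_graph_cocone by blast
next
  assume r: ?r
  show ?l unfolding is_colimit_def cocone_iff_graph_cocone
  proof (intro conjI allI impI ex_ex1I)
    show "graph_cocone C (Ob J) (ObMap F) (functor_edges J F) X c" using r by (simp add: graph_colimit_def)
    fix Y d assume "graph_cocone C (Ob J) (ObMap F) (functor_edges J F) Y d"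
    then show "\<exists>h. h \<in> hom C X Y \<and> (\<forall>j\<in>Ob J. h \<cdot>\<^bsub>C\<^esub> c j = d j)"
      using r unfolding graph_colimit_def by blast
  next
    fix Y d h h' assume "h \<in> hom C X Y \<and> (\<forall>j\<in>Ob J. h \<cdot>\<^bsub>C\<^esub> c j = d j)" "h' \<in> hom C X Y \<and> (\<forall>j\<in>Ob J. h' \<cdot>\<^bsub>C\<^esub> c j = d j)"
    then show "h = h'" using r jointly_epiD[of C "Ob J" X c h Y h'] unfolding graph_colimit_def by simp
  qed
qed

text \<open>The barycentric subdivision of a graph has no composable non-identity arrows, so that it
  is a category; a cocone on it is the same as a cocone on the graph.\<close>

definition subdivision ::
  "'i set \<Rightarrow> ('i \<times> 'a \<times> 'i) set \<Rightarrow>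
   ('i + 'i \<times> 'a \<times> 'i, ('i + 'i \<times> 'a \<times> 'i) + ('i \<times> 'a \<times> 'i) \<times> bool) category" where
  "subdivision I E = \<lparr>Ob = I <+> E, Ar = (I <+> E) <+> E \<times> UNIV,
     Dom = case_sum (\<lambda>x. x) (\<lambda>(e, b). Inr e),
     Cod = case_sum (\<lambda>x. x) (\<lambda>((i, u, j), b). Inl (if b then j else i)),
     Ident = Inl,
     Comp = (\<lambda>g f. case g of Inl _ \<Rightarrow> f | Inr _ \<Rightarrow> g)\<rparr>"

text \<open>The vertex of an edge \<open>(i, u, j)\<close> carries the label \<open>F i\<close>, so
  that the leg there can only be a copy of the leg at \<open>i\<close> and a cocone gains no new
  data.\<close>

definition subdivision_func ::
  "('o, 'a, 'z) category_scheme \<Rightarrow> ('i \<Rightarrow> 'o) \<Rightarrow>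
   ('i + 'i \<times> 'a \<times> 'i, ('i + 'i \<times> 'a \<times> 'i) + ('i \<times> 'a \<times> 'i) \<times> bool, 'o, 'a) func" where
  "subdivision_func C F = 
    (let G = case_sum F (\<lambda>(i, u, j). F i) in
     \<lparr>ObMap = G, ArMap = case_sum (\<lambda>x. Ident C (G x))
       (\<lambda>((i, u, j), b). if b then u else Ident C (F i))\<rparr>)"

lemma subdivision_simps [simp]:
  "Inl i \<in> Ob (subdivision I E) \<longleftrightarrow> i \<in> I"
  "Inr e \<in> Ob (subdivision I E) \<longleftrightarrow> e \<in> E"
  "Inl x \<in> Ar (subdivision I E) \<longleftrightarrow> x \<in> Ob (subdivision I E)"
  "Inr (e, b) \<in> Ar (subdivision I E) \<longleftrightarrow> e \<in> E"
  "Dom (subdivision I E) (Inl x) = x" "Cod (subdivision I E) (Inl x) = x"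
  "Dom (subdivision I E) (Inr (e, b)) = Inr e" 
  "Cod (subdivision I E) (Inr ((i, u, j), b)) = Inl (if b then j else i)"
  "Ident (subdivision I E) x = Inl x"
  "Inl x \<cdot>\<^bsub>subdivision I E\<^esub> f = f" "Inr a \<cdot>\<^bsub>subdivision I E\<^esub> f = Inr a"
  by (auto simp: subdivision_def)

lemma subdivision_func_simps [simp]:
  "ObMap (subdivision_func C F) (Inl i) = F i"
  "ObMap (subdivision_func C F) (Inr (i, u, j)) = F i"
  "ArMap (subdivision_func C F) (Inl x) = Ident C (ObMap (subdivision_func C F) x)"
  "ArMap (subdivision_func C F) (Inr ((i, u, j), b)) = (if b then u else Ident C (F i))"
  by (auto simp: subdivision_func_def Let_def)

lemma subdivision_ar_cases:
  assumes "a \<in> Ar (subdivision I E)"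
  obtains x where "x \<in> Ob (subdivision I E)" "a = Inl x"
  | i u j b where "(i, u, j) \<in> E" "a = Inr ((i, u, j), b)"
  using assms by (cases a) auto

lemma subdivision_ob_cases:
  assumes "x \<in> Ob (subdivision I E)"
  obtains i where "i \<in> I" "x = Inl i" | i u j where "(i, u, j) \<in> E" "x = Inr (i, u, j)"
  using assms by (cases x) auto

lemma category_subdivision:
  assumes "\<And>i u j. (i, u, j) \<in> E \<Longrightarrow> i \<in> I \<and> j \<in> I"
  shows "category (subdivision I E)"
  unfolding category_def hom_def
proof (intro conjI ballI impI)
  fix f g h assume "f \<in> Ar (subdivision I E)" "g \<in> Ar (subdivision I E)" "h \<in> Ar (subdivision I E)"
  then show "h \<cdot>\<^bsub>subdivision I E\<^esub> (g \<cdot>\<^bsub>subdivision I E\<^esub> f) = h \<cdot>\<^bsub>subdivision I E\<^esub> g \<cdot>\<^bsub>subdivision I E\<^esub> f"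
    by (elim subdivision_ar_cases) simp_all
next
  fix f g assume fg: "f \<in> Ar (subdivision I E)" "g \<in> Ar (subdivision I E)"
    "Dom (subdivision I E) g = Cod (subdivision I E) f"
  show "g \<cdot>\<^bsub>subdivision I E\<^esub> f \<in> {h \<in> Ar (subdivision I E). Dom (subdivision I E) h = Dom (subdivision I E) f \<and>
     Cod (subdivision I E) h = Cod (subdivision I E) g}"
    using fg by (elim subdivision_ar_cases) auto
qed (use assms in \<open>fastforce elim!: subdivision_ar_cases subdivision_ob_cases\<close>)+

lemma functor_subdivision:
  assumes C: "category C" and G: "graph C I F E"
  shows "is_functor (subdivision I E) C (subdivision_func C F)"
proof -
  interpret cat C using C by unfold_locales
  have e: "i \<in> I \<and> j \<in> I \<and> u \<in> hom C (F i) (F j)" if "(i, u, j) \<in> E" for i u j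
    using G that by (auto simp: graph_def)
  have i: "F i \<in> Ob C" if "i \<in> I" for i using G that by (auto simp: graph_def)
  have S: "category (subdivision I E)" using e by (intro category_subdivision) auto
  have ob: "ObMap (subdivision_func C F) x \<in> Ob C" if "x \<in> Ob (subdivision I E)" for x
    using that by (rule subdivision_ob_cases) (use e i in auto)
  have ar: "ArMap (subdivision_func C F) f \<in> hom C (ObMap (subdivision_func C F) (Dom (subdivision I E) f))
      (ObMap (subdivision_func C F) (Cod (subdivision I E) f))" if "f \<in> Ar (subdivision I E)" for f
    using that by (rule subdivision_ar_cases) (use e i ob id_hom in \<open>auto\<close>)
  have "ArMap (subdivision_func C F) (g \<cdot>\<^bsub>subdivision I E\<^esub> f) = ArMap (subdivision_func C F) g \<cdot>\<^bsub>C\<^esub> ArMap (subdivision_func C F) f"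
    if fg: "f \<in> Ar (subdivision I E)" "g \<in> Ar (subdivision I E)" "Dom (subdivision I E) g = Cod (subdivision I E) f" for f g
    using fg(2)
  proof (rule subdivision_ar_cases)
    fix x assume "x \<in> Ob (subdivision I E)" "g = Inl x"
    then show ?thesis using fg ar[OF fg(1)] by (auto dest!: homD)
  next
    fix i u j b assume g: "(i, u, j) \<in> E" "g = Inr ((i, u, j), b)"
    show ?thesis using fg(1)
    proof (rule subdivision_ar_cases)
      fix x assume "f = Inl x"
      then show ?thesis using fg g ar[OF fg(2)] by (auto dest!: homD)
    qed (use fg g in \<open>auto split: if_splits\<close>)
  qed
  then show ?thesis using C S ob ar unfolding is_functor_def by simp
qed

text \<open>The arrow marked \<open>False\<close>, from an edge to its source, carries an identity
  and forces the leg at the edge. The arrow marked \<open>True\<close> then gives the cocone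
  equation of the graph.\<close>

lemma graph_cocone_of_subdivision:
  assumes C: "category C" and G: "graph C I F E" 
    and c: "is_cocone C (subdivision I E) (subdivision_func C F) X c"
  shows "graph_cocone C I F E X (c \<circ> Inl)"
    and "\<And>i u j. (i, u, j) \<in> E \<Longrightarrow> c (Inr (i, u, j)) = c (Inl i)"
proof -
  interpret cat C using C by unfold_locales
  have ob: "X \<in> Ob C" "c x \<in> hom C (ObMap (subdivision_func C F) x) X" if "x \<in> Ob (subdivision I E)" for x
    using c that by (auto simp: is_cocone_def)
  have X: "X \<in> Ob C" using c by (auto simp: is_cocone_def)
  have e: "i \<in> I \<and> j \<in> I \<and> u \<in> hom C (F i) (F j)" if "(i, u, j) \<in> E" for i u j
    using G that by (auto simp: graph_def)
  have ar: "c (Cod (subdivision I E) a) \<cdot>\<^bsub>C\<^esub> ArMap (subdivision_func C F) a = c (Dom (subdivision I E) a)"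
    if "a \<in> Ar (subdivision I E)" for a
    using c that by (auto simp: is_cocone_def)
  show 1: "c (Inr (i, u, j)) = c (Inl i)" if "(i, u, j) \<in> E" for i u j
    using ar[of "Inr ((i, u, j), False)"] ob(2)[of "Inl i"] e[OF that] that by (simp add: hom_def)
  have "c (Inl j) \<cdot>\<^bsub>C\<^esub> u = c (Inl i)" if "(i, u, j) \<in> E" for i u j
    using ar[of "Inr ((i, u, j), True)"] 1 that by simp
  then show "graph_cocone C I F E X (c \<circ> Inl)"
    using X ob(2)[of "Inl _"] unfolding graph_cocone_def by auto
qed

lemma subdivision_cocone_of_graph:
  assumes C: "category C" and G: "graph C I F E" and d: "graph_cocone C I F E X d"
  shows "is_cocone C (subdivision I E) (subdivision_func C F) X (case_sum d (\<lambda>(i, u, j). d i))"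
proof -
  interpret cat C using C by unfold_locales
  have e: "i \<in> I \<and> j \<in> I \<and> u \<in> hom C (F i) (F j) \<and> d j \<cdot>\<^bsub>C\<^esub> u = d i" if "(i, u, j) \<in> E" for i u j
    using G d that by (auto simp: graph_def graph_cocone_def)
  have i: "F i \<in> Ob C \<and> d i \<in> hom C (F i) X" if "i \<in> I" for i
    using G d that by (auto simp: graph_def graph_cocone_def)
  have X: "X \<in> Ob C" using d by (simp add: graph_cocone_def)
  have ob: "case_sum d (\<lambda>(i, u, j). d i) x \<in> hom C (ObMap (subdivision_func C F) x) X"
    if "x \<in> Ob (subdivision I E)" for x
    using that by (rule subdivision_ob_cases) (use e i in auto)
  have "case_sum d (\<lambda>(i, u, j). d i) (Cod (subdivision I E) a) \<cdot>\<^bsub>C\<^esub> ArMap (subdivision_func C F) a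
    = case_sum d (\<lambda>(i, u, j). d i) (Dom (subdivision I E) a)" if "a \<in> Ar (subdivision I E)" for a
    using that
  proof (rule subdivision_ar_cases)
    fix x assume "x \<in> Ob (subdivision I E)" "a = Inl x"
    then show ?thesis using ob[of x] by (simp add: hom_def)
  next
    fix i u j b assume "(i, u, j) \<in> E" "a = Inr ((i, u, j), b)"
    then show ?thesis using e[of i u j] i[of i] by (simp add: hom_def)
  qed
  then show ?thesis using X ob unfolding is_cocone_def by simp
qed

section \<open>Renaming the objects and arrows of an index category\<close>

definition image_cat ::
  "('i \<Rightarrow> 'u) \<Rightarrow> ('b \<Rightarrow> 'v) \<Rightarrow> ('i, 'b, 'y) category_scheme \<Rightarrow> ('u, 'v) category" where
  "image_cat p q J = (let r = inv_into (Ob J) p; s = inv_into (Ar J) q in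
     \<lparr>Ob = p ` Ob J, Ar = q ` Ar J, Dom = p \<circ> Dom J \<circ> s, Cod = p \<circ> Cod J \<circ> s,
      Ident = q \<circ> Ident J \<circ> r, Comp = (\<lambda>g f. q (s g \<cdot>\<^bsub>J\<^esub> s f))\<rparr>)"

definition image_func ::
  "('i \<Rightarrow> 'u) \<Rightarrow> ('b \<Rightarrow> 'v) \<Rightarrow> ('i, 'b, 'y) category_scheme \<Rightarrow> ('i, 'b, 'o, 'a) func \<Rightarrow>
    ('u, 'v, 'o, 'a) func" where
  "image_func p q J F = \<lparr>ObMap = ObMap F \<circ> inv_into (Ob J) p, ArMap = ArMap F \<circ> inv_into (Ar J) q\<rparr>"

context
  fixes J :: "('i, 'b, 'y) category_scheme" and p :: "'i \<Rightarrow> 'u" and q :: "'b \<Rightarrow> 'v"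
  assumes J: "category J" and p: "inj_on p (Ob J)" and q: "inj_on q (Ar J)"
begin

interpretation cat J using J by unfold_locales

lemma image_cat_simps:
  "Ob (image_cat p q J) = p ` Ob J" "Ar (image_cat p q J) = q ` Ar J"
  "f \<in> Ar J \<Longrightarrow> Dom (image_cat p q J) (q f) = p (Dom J f)"
  "f \<in> Ar J \<Longrightarrow> Cod (image_cat p q J) (q f) = p (Cod J f)"
  "X \<in> Ob J \<Longrightarrow> Ident (image_cat p q J) (p X) = q (Ident J X)"
  "f \<in> Ar J \<Longrightarrow> g \<in> Ar J \<Longrightarrow> q g \<cdot>\<^bsub>image_cat p q J\<^esub> q f = q (g \<cdot>\<^bsub>J\<^esub> f)"
  using p q by (simp_all add: image_cat_def Let_def)

lemma category_image_cat: "category (image_cat p q J)"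
  using p q unfolding category_def
  by (auto simp: image_cat_simps hom_def inj_on_eq_iff comp_assoc)

lemma functor_image: "is_functor J C F \<Longrightarrow> is_functor (image_cat p q J) C (image_func p q J F)"
  using p q category_image_cat unfolding is_functor_def
  by (auto simp: image_cat_simps hom_def inj_on_eq_iff image_func_def)

lemma cocone_image_iff:
  "is_cocone C (image_cat p q J) (image_func p q J F) X c \<longleftrightarrow> is_cocone C J F X (c \<circ> p)"
  using p q unfolding is_cocone_def
  by (auto simp: image_cat_simps image_func_def)

end

text \<open>The hypothesis \<open>cocomplete\<close> speaks only of index categories inside
  \<open>'u\<close>. The graph is subdivided into a category, which is small and hence can be
  renamed into \<open>'u\<close>; cocones on the graph, on the subdivision and on the renamed
  category correspond to each other, and so do the universal arrows.\<close>

lemma (in inaccessible_cardinal) small_graph_colimit: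
  fixes C :: "('o, 'a, 'z) category_scheme" and I :: "'i set"
  assumes C: "category C" "cocomplete \<kappa> C" and G: "graph C I F E" and I: "small I" and E: "small E"
  obtains X c where "graph_colimit C I F E X c"
proof -
  let ?J = "subdivision I E" and ?G = "subdivision_func C F"
  have F: "is_functor ?J C ?G" by (rule functor_subdivision[OF C(1) G])
  then have J: "category ?J" by (simp add: is_functor_def)
  have O: "small (Ob ?J)" and A: "small (Ar ?J)"
    unfolding subdivision_def using I E by (simp_all add: small_Plus small_Times small_finite)
  obtain p :: "_ \<Rightarrow> 'u" where p: "inj_on p (Ob ?J)" using inj_into_field[OF card O] by blast
  obtain q :: "_ \<Rightarrow> 'u" where q: "inj_on q (Ar ?J)" using inj_into_field[OF card A] by blast
  let ?K = "image_cat p q ?J" and ?H = "image_func p q ?J ?G"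
  have "small (Ar ?K)" using A by (simp add: image_cat_simps[OF J p q] small_image)
  then have "small_category \<kappa> ?K \<and> is_functor ?K C ?H"
    using category_image_cat[OF J p q] functor_image[OF J p q F] by (simp add: small_category_def)
  then obtain X c where c: "is_colimit C ?K ?H X c" using C(2) unfolding cocomplete_def by blast
  have cc: "is_cocone C ?J ?G X (c \<circ> p)" 
    using c unfolding is_colimit_def cocone_image_iff[OF J p q] by (rule conjunct1)
  have gc: "graph_cocone C I F E X (c \<circ> p \<circ> Inl)"
    using graph_cocone_of_subdivision(1)[OF C(1) G cc] .
  have uniq: "\<exists>!h. h \<in> hom C X Y \<and> (\<forall>i\<in>I. h \<cdot>\<^bsub>C\<^esub> (c \<circ> p \<circ> Inl) i = d i)" 
    if d: "graph_cocone C I F E Y d" for Y d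
  proof -
    let ?d = "case_sum d (\<lambda>(i, u, j). d i)"
    have "is_cocone C ?J ?G Y ?d" by (rule subdivision_cocone_of_graph[OF C(1) G d])
    moreover have "is_cocone C ?J ?G Y ((?d \<circ> inv_into (Ob ?J) p) \<circ> p) = is_cocone C ?J ?G Y ?d"
      using p by (intro cocone_cong[OF J]) simp
    ultimately have "is_cocone C ?K ?H Y (?d \<circ> inv_into (Ob ?J) p)"
      unfolding cocone_image_iff[OF J p q] by simp
    with c have "\<exists>!h. h \<in> hom C X Y \<and> (\<forall>j\<in>Ob ?K. h \<cdot>\<^bsub>C\<^esub> c j = (?d \<circ> inv_into (Ob ?J) p) j)"
      unfolding is_colimit_def by (elim conjE allE impE)
    then have *: "\<exists>!h. h \<in> hom C X Y \<and> (\<forall>j\<in>Ob ?J. h \<cdot>\<^bsub>C\<^esub> c (p j) = ?d j)"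
      using p by (simp add: image_cat_simps[OF J p q])
    interpret cat C using C(1) by unfold_locales
    \<comment> \<open>The vertices coming from edges impose no further condition on
      \<open>h\<close>, since their legs repeat the legs at the sources.\<close>
    have "(\<forall>j\<in>Ob ?J. h \<cdot>\<^bsub>C\<^esub> c (p j) = ?d j) \<longleftrightarrow> (\<forall>i\<in>I. h \<cdot>\<^bsub>C\<^esub> (c \<circ> p \<circ> Inl) i = d i)" for h
    proof -
      have "c (p (Inr (i, u, j))) = c (p (Inl i)) \<and> i \<in> I" if "(i, u, j) \<in> E" for i u j
        using graph_cocone_of_subdivision(2)[OF C(1) G cc that] that G by (auto simp: graph_def)
      then have "(\<forall>j\<in>Ob ?J. h \<cdot>\<^bsub>C\<^esub> c (p j) = ?d j)" if "\<forall>i\<in>I. h \<cdot>\<^bsub>C\<^esub> (c \<circ> p \<circ> Inl) i = d i"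
        using that by (intro ballI) (erule subdivision_ob_cases, simp_all)
      moreover have "h \<cdot>\<^bsub>C\<^esub> (c \<circ> p \<circ> Inl) i = d i" if "\<forall>j\<in>Ob ?J. h \<cdot>\<^bsub>C\<^esub> c (p j) = ?d j" "i \<in> I" for i
        using that(1)[rule_format, of "Inl i"] that(2) by simp
      ultimately show ?thesis by blast
    qed
    then show ?thesis using * by simp
  qed
  have "jointly_epi C I X (c \<circ> p \<circ> Inl)"
    unfolding jointly_epi_def
  proof (intro allI ballI impI)
    interpret cat C using C(1) by unfold_locales
    fix Y f g assume f: "f \<in> hom C X Y" and g: "g \<in> hom C X Y" 
      and e: "\<forall>i\<in>I. f \<cdot>\<^bsub>C\<^esub> (c \<circ> p \<circ> Inl) i = g \<cdot>\<^bsub>C\<^esub> (c \<circ> p \<circ> Inl) i"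
    have "graph_cocone C I F E Y (\<lambda>i. f \<cdot>\<^bsub>C\<^esub> (c \<circ> p \<circ> Inl) i)"
      by (rule graph_cocone_comp[OF gc G f])
    from uniq[OF this] show "f = g" using f g e by (elim ex1E) (blast intro: trans sym)
  qed
  moreover have "\<exists>h\<in>hom C X Y. \<forall>i\<in>I. h \<cdot>\<^bsub>C\<^esub> (c \<circ> p \<circ> Inl) i = d i"
    if "graph_cocone C I F E Y d" for Y d
    using uniq[OF that] by (elim ex1E) blast
  ultimately have "graph_colimit C I F E X (c \<circ> p \<circ> Inl)" 
    using gc unfolding graph_colimit_def by (intro conjI allI impI)
  then show ?thesis by (rule that)
qed

section \<open>Filtered categories and presentable objects\<close>

lemma finite_inj_into_infinite:
  assumes "finite B" "infinite (UNIV :: 'u set)"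
  obtains p :: "'x \<Rightarrow> 'u" where "inj_on p B"
proof -
  obtain T :: "'u set" where "finite T" "card T = card B" 
    using infinite_arbitrarily_large[OF assms(2)] by blast
  then obtain p where "bij_betw p B T" using finite_same_card_bij[OF assms(1)] by metis
  then show ?thesis using that bij_betw_imp_inj_on by blast
qed

text \<open>Filteredness, too, is tested only on categories inside \<open>'u\<close>. The
  subdivision of a finite graph is finite, so it fits into the infinite type \<open>'u\<close> and
  has fewer than \<open>\<mu>\<close> arrows.\<close>

lemma filtered_graph_cocone:
  fixes J :: "('u, 'u) category" and I :: "'i set"
  assumes J: "filtered \<mu> J" and \<mu>: "natLeq \<le>o \<mu>" and u: "infinite (UNIV :: 'u set)"
    and G: "graph J I F E" and fin: "finite I" "finite E"
  obtains X c where "graph_cocone J I F E X c"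
proof -
  let ?K = "subdivision I E"
  have cJ: "category J" using J by (simp add: filtered_def)
  have F: "is_functor ?K J (subdivision_func J F)" by (rule functor_subdivision[OF cJ G])
  then have K: "category ?K" by (simp add: is_functor_def)
  have O: "finite (Ob ?K)" and A: "finite (Ar ?K)" using fin by (auto simp: subdivision_def)
  obtain p :: "_ \<Rightarrow> 'u" where p: "inj_on p (Ob ?K)" using finite_inj_into_infinite[OF O u] .
  obtain q :: "_ \<Rightarrow> 'u" where q: "inj_on q (Ar ?K)" using finite_inj_into_infinite[OF A u] .
  let ?L = "image_cat p q ?K" and ?H = "image_func p q ?K (subdivision_func J F)"
  have "|Ar ?L| <o natLeq"
    using A by (simp add: image_cat_simps[OF K p q] finite_iff_ordLess_natLeq[symmetric])
  then have "|Ar ?L| <o \<mu>" using \<mu> by (rule ordLess_ordLeq_trans)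
  then have "\<exists>X c. is_cocone J ?L ?H X c"
    using J category_image_cat[OF K p q] functor_image[OF K p q F] unfolding filtered_def by simp
  then obtain X c where "is_cocone J ?K (subdivision_func J F) X (c \<circ> p)"
    unfolding cocone_image_iff[OF K p q] by (elim exE)
  from graph_cocone_of_subdivision(1)[OF cJ G this] show ?thesis by (rule that)
qed

locale filtered_category = cat J for J :: "('u, 'u) category" (structure) +
  fixes \<mu> :: "'l rel"
  assumes filtered: "filtered \<mu> J" and aleph0_le: "natLeq \<le>o \<mu>" and infinite_univ: "infinite (UNIV :: 'u set)"
begin

lemmas finite_graph_cocone = filtered_graph_cocone[OF filtered aleph0_le infinite_univ]

lemma filtered_span:
  assumes "u \<in> hom J i j" "v \<in> hom J i k"
  obtains l a b where "a \<in> hom J j l" "b \<in> hom J k l" "a \<cdot> u = b \<cdot> v"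
proof -
  have "i \<in> Ob J" "j \<in> Ob J" "k \<in> Ob J" using assms by (auto simp: hom_def)
  \<comment> \<open>The vertices are positions in a list and not the objects themselves, so that
    they remain distinct when some of \<open>i\<close>, \<open>j\<close>, \<open>k\<close>
    coincide.\<close>
  then have "graph J {0::nat, 1, 2} ((!) [i, j, k]) {(0, u, 1), (0, v, 2)}"
    using assms by (auto simp: graph_def)
  then obtain l c where c: "graph_cocone J {0::nat, 1, 2} ((!) [i, j, k]) {(0, u, 1), (0, v, 2)} l c"
    by (rule finite_graph_cocone) auto
  show ?thesis by (rule that[of "c 1" l "c 2"]) (use c in \<open>auto simp: graph_cocone_def\<close>)
qed

lemma filtered_upper:
  assumes "i \<in> Ob J" "j \<in> Ob J"
  obtains k u v where "u \<in> hom J i k" "v \<in> hom J j k"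
proof -
  have "graph J {0::nat, 1} ((!) [i, j]) {}"
    using assms by (auto simp: graph_def)
  then obtain l c where c: "graph_cocone J {0::nat, 1} ((!) [i, j]) {} l c"
    by (rule finite_graph_cocone) auto
  show ?thesis by (rule that[of "c 0" l "c 1"]) (use c in \<open>auto simp: graph_cocone_def\<close>)
qed

lemma filtered_coequalize:
  assumes "u \<in> hom J i j" "v \<in> hom J i j"
  obtains k w where "w \<in> hom J j k" "w \<cdot> u = w \<cdot> v"
proof -
  have "i \<in> Ob J" "j \<in> Ob J" using assms by (auto simp: hom_def)
  then have "graph J {0::nat, 1} ((!) [i, j]) {(0, u, 1), (0, v, 1)}"
    using assms by (auto simp: graph_def)
  then obtain l c where c: "graph_cocone J {0::nat, 1} ((!) [i, j]) {(0, u, 1), (0, v, 1)} l c"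
    by (rule finite_graph_cocone) auto
  show ?thesis by (rule that[of "c 1" l]) (use c in \<open>auto simp: graph_cocone_def\<close>)
qed

end

text \<open>A colimit of sets is tested against maps into the two-element set \<open>{Inr a, Inr b}\<close>,
  that is, against predicates.\<close>

lemma ex1_unique: "\<exists>!x. P x \<Longrightarrow> P x \<Longrightarrow> P y \<Longrightarrow> x = y"
  by blast

context
  fixes \<kappa> \<mu> :: "'u rel" and C :: "('o, 'a, 'z) category_scheme" and K X :: 'o
    and J :: "('u, 'u) category" and F c and a b :: 'u
  assumes \<kappa>: "inaccessible \<kappa>" and ab: "a \<noteq> b" 
    and C: "category C" and K: "presentable \<kappa> \<mu> C K"
    and J: "small_category \<kappa> J" "filtered \<mu> J" and F: "is_functor J C F" and X: "is_colimit C J F X c"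
begin

interpretation inaccessible_cardinal \<kappa> using \<kappa> by unfold_locales
interpretation cat C using C by unfold_locales

private abbreviation "Hm \<equiv> (\<lambda>Y. Inl ` hom C K Y) :: 'o \<Rightarrow> ('a + 'u) set"
private abbreviation "two \<equiv> {Inr a, Inr b} :: ('a + 'u) set"
private definition "indicator_arr Q Y = (Hm Y, restrict (\<lambda>x. if Q (projl x) then Inr a else Inr b :: 'a + 'u) (Hm Y), two)"

private lemma leg: "j \<in> Ob J \<Longrightarrow> c j \<in> hom C (ObMap F j) X"
  using X by (simp add: is_colimit_def is_cocone_def)

private lemma ar_functor: "u \<in> Ar J \<Longrightarrow> ArMap F u \<in> hom C (ObMap F (Dom J u)) (ObMap F (Cod J u)) \<and> Dom J u \<in> Ob J \<and> Cod J u \<in> Ob J"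
  using F by (auto simp: is_functor_def category_def)

private lemma hom_colimit:
  "is_colimit (set_cat \<kappa>) J (comp_func (hom_func C K) F) (Hm X) (\<lambda>j. ArMap (hom_func C K :: ('o, 'a, ('a + 'u) set, _) func) (c j))"
proof -
  have "is_colimit (set_cat \<kappa>) J (comp_func (hom_func C K) F) (ObMap (hom_func C K :: ('o, 'a, ('a + 'u) set, _) func) X) 
     (\<lambda>j. ArMap (hom_func C K :: ('o, 'a, ('a + 'u) set, _) func) (c j))"
    using K J F X unfolding presentable_def preserves_filtered_colimits_def by blast
  then show ?thesis by (simp add: hom_func_def)
qed

private lemma small_Hm: "small (Hm X)" "j \<in> Ob J \<Longrightarrow> small (Hm (ObMap F j))"
proof -
  have *: "is_cocone (set_cat \<kappa>) J (comp_func (hom_func C K) F) (Hm X) (\<lambda>j. ArMap (hom_func C K :: ('o, 'a, ('a + 'u) set, _) func) (c j))"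
    using hom_colimit by (simp add: is_colimit_def)
  then show "small (Hm X)" by (simp add: is_cocone_def set_cat_def)
  show "small (Hm (ObMap F j))" if "j \<in> Ob J"
    using * that leg[OF that] by (auto simp: is_cocone_def set_cat_def hom_func_def hom_def)
qed

private lemma indicator_arr_comp:
  assumes f: "f \<in> hom C Y Z"
  shows "indicator_arr Q Z \<cdot>\<^bsub>set_cat \<kappa>\<^esub> ArMap (hom_func C K) f = indicator_arr (\<lambda>g. Q (f \<cdot>\<^bsub>C\<^esub> g)) Y"
proof -
  have "f \<cdot>\<^bsub>C\<^esub> g \<in> hom C K Z" if "g \<in> hom C K Y" for g using that f comp_hom by blast
  then show ?thesis
    using f unfolding indicator_arr_def set_cat_def hom_func_def
    by (auto simp: compose_def hom_def fun_eq_iff restrict_def)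
qed

private lemma indicator_arr_hom: "small (Hm Y) \<Longrightarrow> indicator_arr Q Y \<in> hom (set_cat \<kappa>) (Hm Y) two"
  by (auto simp: indicator_arr_def hom_def set_cat_def small_finite)

private lemma indicator_arr_eqD: "indicator_arr Q Y = indicator_arr Q' Y \<Longrightarrow> f \<in> hom C K Y \<Longrightarrow> Q f \<longleftrightarrow> Q' f"
proof -
  assume "indicator_arr Q Y = indicator_arr Q' Y" and f: "f \<in> hom C K Y"
  then have "(if Q f then Inr a else Inr b :: 'a + 'u) = (if Q' f then Inr a else Inr b)"
    by (auto simp: indicator_arr_def fun_eq_iff restrict_def dest: spec[of _ "Inl f"])
  then show "Q f \<longleftrightarrow> Q' f" using ab by (auto split: if_splits)
qed

private lemma indicator_arr_cong: "(\<And>f. f \<in> hom C K Y \<Longrightarrow> Q f \<longleftrightarrow> Q' f) \<Longrightarrow> indicator_arr Q Y = indicator_arr Q' Y"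
  unfolding indicator_arr_def by (intro arg_cong2[where f = Pair] refl restrict_ext) auto

text \<open>For indicator functions the cocone equation says precisely that the predicates are
  invariant along the transition arrows. Cocones of sets can thus be replaced by invariant families
  of predicates.\<close>

private lemma hom_functor_cocone:
  assumes P: "\<And>u f. u \<in> Ar J \<Longrightarrow> f \<in> hom C K (ObMap F (Dom J u)) \<Longrightarrow> P (Dom J u) f \<longleftrightarrow> P (Cod J u) (ArMap F u \<cdot>\<^bsub>C\<^esub> f)"
  shows "is_cocone (set_cat \<kappa>) J (comp_func (hom_func C K) F) two (\<lambda>j. indicator_arr (P j) (ObMap F j))"
  unfolding is_cocone_def
proof (intro conjI ballI)
  show "two \<in> Ob (set_cat \<kappa>)" by (simp add: set_cat_def small_finite)
  fix j assume "j \<in> Ob J" then show "indicator_arr (P j) (ObMap F j) \<in> hom (set_cat \<kappa>) (ObMap (comp_func (hom_func C K) F) j) two"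
    using indicator_arr_hom small_Hm(2) by (simp add: comp_func_def hom_func_def)
next
  fix u assume u: "u \<in> Ar J"
  have "indicator_arr (P (Cod J u)) (ObMap F (Cod J u)) \<cdot>\<^bsub>set_cat \<kappa>\<^esub> ArMap (hom_func C K) (ArMap F u) = 
      indicator_arr (\<lambda>g. P (Cod J u) (ArMap F u \<cdot>\<^bsub>C\<^esub> g)) (ObMap F (Dom J u))"
    using ar_functor[OF u] by (intro indicator_arr_comp) simp
  also have "\<dots> = indicator_arr (P (Dom J u)) (ObMap F (Dom J u))" using P[OF u] by (intro indicator_arr_cong) simp
  finally show "indicator_arr (P (Cod J u)) (ObMap F (Cod J u)) \<cdot>\<^bsub>set_cat \<kappa>\<^esub> ArMap (comp_func (hom_func C K) F) u = 
      indicator_arr (P (Dom J u)) (ObMap F (Dom J u))" by (simp add: comp_func_def)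
qed

text \<open>If \<open>f\<close> came from no stage, then the singleton of \<open>f\<close> and the
  empty predicate would restrict to the same predicates at all stages. Both would then be the arrow
  induced by one cocone, although they differ at \<open>f\<close>.\<close>

lemma presentable_factor:
  assumes f: "f \<in> hom C K X"
  obtains j g where "j \<in> Ob J" "g \<in> hom C K (ObMap F j)" "f = c j \<cdot>\<^bsub>C\<^esub> g"
proof -
  have "\<exists>j\<in>Ob J. \<exists>g\<in>hom C K (ObMap F j). f = c j \<cdot>\<^bsub>C\<^esub> g"
  proof (rule ccontr)
    assume n: "\<not> ?thesis"
    have u: "\<exists>!h. h \<in> hom (set_cat \<kappa>) (Hm X) two \<and> 
        (\<forall>j\<in>Ob J. h \<cdot>\<^bsub>set_cat \<kappa>\<^esub> ArMap (hom_func C K) (c j) = indicator_arr (\<lambda>_. False) (ObMap F j))"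
      using hom_colimit hom_functor_cocone[of "\<lambda>_ _. False"] unfolding is_colimit_def by simp
    have *: "indicator_arr (\<lambda>g. g = f) X \<cdot>\<^bsub>set_cat \<kappa>\<^esub> ArMap (hom_func C K) (c j) = indicator_arr (\<lambda>_. False) (ObMap F j)" 
      "indicator_arr (\<lambda>g. False) X \<cdot>\<^bsub>set_cat \<kappa>\<^esub> ArMap (hom_func C K) (c j) = indicator_arr (\<lambda>_. False) (ObMap F j)" if "j \<in> Ob J" for j
      unfolding indicator_arr_comp[OF leg[OF that]] using n that by (auto intro!: indicator_arr_cong)
    have "indicator_arr (\<lambda>g. g = f) X = indicator_arr (\<lambda>g. False) X"
      by (rule ex1_unique[OF u]) (simp_all add: * indicator_arr_hom[OF small_Hm(1)])
    from indicator_arr_eqD[OF this f] show False by simp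
  qed
  then show ?thesis using that by blast
qed

text \<open>The predicate ``eventually identified with \<open>f\<close>'' is compatible with the diagram, hence
  factors through the colimit.\<close>

lemma presentable_eq:
  assumes j: "j \<in> Ob J" and f: "f \<in> hom C K (ObMap F j)" and g: "g \<in> hom C K (ObMap F j)" 
    and fg: "c j \<cdot>\<^bsub>C\<^esub> f = c j \<cdot>\<^bsub>C\<^esub> g" and \<mu>: "natLeq \<le>o \<mu>"
  obtains k u where "u \<in> hom J j k" "ArMap F u \<cdot>\<^bsub>C\<^esub> f = ArMap F u \<cdot>\<^bsub>C\<^esub> g"
proof -
  interpret J: cat J using J by unfold_locales (simp add: filtered_def)
  have inf: "infinite (UNIV :: 'u set)" using infinite_field finite_subset subset_UNIV by blast
  interpret J: filtered_category J \<mu> using J \<mu> inf by unfold_locales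
  have F_comp: "ArMap F (v \<cdot>\<^bsub>J\<^esub> u) = ArMap F v \<cdot>\<^bsub>C\<^esub> ArMap F u" if "u \<in> Ar J" "v \<in> Ar J" "Dom J v = Cod J u" for u v
    using F that by (simp add: is_functor_def)
  have F_hom: "ArMap F u \<in> hom C (ObMap F i) (ObMap F k)" if "u \<in> hom J i k" for u i k
    using that ar_functor by (auto simp: hom_def)
  have F_comp': "ArMap F v \<cdot>\<^bsub>C\<^esub> (ArMap F u \<cdot>\<^bsub>C\<^esub> h) = ArMap F (v \<cdot>\<^bsub>J\<^esub> u) \<cdot>\<^bsub>C\<^esub> h" 
    if "u \<in> hom J i k" "v \<in> hom J k l" "h \<in> hom C K (ObMap F i)" for u v h i k l
    using that F_comp[of u v] F_hom[OF that(1)] F_hom[OF that(2)] comp_assoc[of h "ArMap F u" "ArMap F v"]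
    by (auto simp: hom_def)
  define P where "P = (\<lambda>i h. \<exists>k u v. u \<in> hom J j k \<and> v \<in> hom J i k \<and> ArMap F u \<cdot>\<^bsub>C\<^esub> f = ArMap F v \<cdot>\<^bsub>C\<^esub> h)"
  have P: "P (Dom J w) h \<longleftrightarrow> P (Cod J w) (ArMap F w \<cdot>\<^bsub>C\<^esub> h)" 
    if w: "w \<in> Ar J" and h: "h \<in> hom C K (ObMap F (Dom J w))" for w h
  proof
    have w': "w \<in> hom J (Dom J w) (Cod J w)" using w by (simp add: hom_def)
    {
      assume "P (Cod J w) (ArMap F w \<cdot>\<^bsub>C\<^esub> h)"
      then obtain k u v where *: "u \<in> hom J j k" "v \<in> hom J (Cod J w) k" "ArMap F u \<cdot>\<^bsub>C\<^esub> f = ArMap F v \<cdot>\<^bsub>C\<^esub> (ArMap F w \<cdot>\<^bsub>C\<^esub> h)"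
        unfolding P_def by blast
      then show "P (Dom J w) h" unfolding P_def F_comp'[OF w' *(2) h]
        using J.comp_hom[OF w' *(2)] by blast
    next
      assume "P (Dom J w) h"
      then obtain k u v where *: "u \<in> hom J j k" "v \<in> hom J (Dom J w) k" "ArMap F u \<cdot>\<^bsub>C\<^esub> f = ArMap F v \<cdot>\<^bsub>C\<^esub> h"
        unfolding P_def by blast
      \<comment> \<open>A witness \<open>v\<close> out of the domain of \<open>w\<close> has to
        become a witness out of its codomain. Completing \<open>v\<close> and \<open>w\<close> to a
        commuting square provides one.\<close>
      obtain l x y where xy: "x \<in> hom J k l" "y \<in> hom J (Cod J w) l" "x \<cdot>\<^bsub>J\<^esub> v = y \<cdot>\<^bsub>J\<^esub> w"
        using J.filtered_span[OF *(2) w'] .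
      have "ArMap F (x \<cdot>\<^bsub>J\<^esub> u) \<cdot>\<^bsub>C\<^esub> f = ArMap F x \<cdot>\<^bsub>C\<^esub> (ArMap F v \<cdot>\<^bsub>C\<^esub> h)"
        using F_comp'[OF *(1) xy(1) f] *(3) by simp
      also have "\<dots> = ArMap F y \<cdot>\<^bsub>C\<^esub> (ArMap F w \<cdot>\<^bsub>C\<^esub> h)"
        unfolding F_comp'[OF *(2) xy(1) h] F_comp'[OF w' xy(2) h] xy(3) ..
      finally show "P (Cod J w) (ArMap F w \<cdot>\<^bsub>C\<^esub> h)"
        unfolding P_def using J.comp_hom[OF *(1) xy(1)] xy(2) by blast
    }
  qed
  have "\<exists>!h. h \<in> hom (set_cat \<kappa>) (Hm X) two \<and> 
      (\<forall>j\<in>Ob J. h \<cdot>\<^bsub>set_cat \<kappa>\<^esub> ArMap (hom_func C K) (c j) = indicator_arr (P j) (ObMap F j))"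
    using hom_colimit hom_functor_cocone[of P, OF P] unfolding is_colimit_def by simp
  then obtain h where h: "h \<in> hom (set_cat \<kappa>) (Hm X) two" 
    "\<And>j. j \<in> Ob J \<Longrightarrow> h \<cdot>\<^bsub>set_cat \<kappa>\<^esub> ArMap (hom_func C K) (c j) = indicator_arr (P j) (ObMap F j)" by blast
  \<comment> \<open>Every arrow into the two-element set is the indicator of the preimage of
    \<open>Inr a\<close>. Hence the induced arrow \<open>h\<close> is again a predicate, now on
    arrows from \<open>K\<close> to \<open>X\<close>.\<close>
  have hh: "h = indicator_arr (\<lambda>x. fst (snd h) (Inl x) = Inr a) X" 
  proof -
    obtain h' where h': "h = (Hm X, h', two)" "h' \<in> Hm X \<rightarrow>\<^sub>E two" using h(1) by (auto simp: set_cat_def hom_def)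
    have "h' = (\<lambda>x\<in>Hm X. if h' (Inl (projl x)) = Inr a then Inr a else Inr b)"
    proof (rule ext)
      fix x show "h' x = (\<lambda>x\<in>Hm X. if h' (Inl (projl x)) = Inr a then Inr a else Inr b) x"
        using h'(2) by (cases "x \<in> Hm X") (auto simp: PiE_iff extensional_def)
    qed
    then show ?thesis unfolding indicator_arr_def h'(1) by simp
  qed
  define Q where "Q = (\<lambda>x. fst (snd h) (Inl x) = Inr a)"
  have hQ: "h = indicator_arr Q X" unfolding Q_def by (rule hh)
  have "indicator_arr (\<lambda>g. Q (c j \<cdot>\<^bsub>C\<^esub> g)) (ObMap F j) = indicator_arr Q X \<cdot>\<^bsub>set_cat \<kappa>\<^esub> ArMap (hom_func C K) (c j)"
    by (rule indicator_arr_comp[OF leg[OF j], symmetric])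
  also have "\<dots> = h \<cdot>\<^bsub>set_cat \<kappa>\<^esub> ArMap (hom_func C K) (c j)" by (rule arg_cong[OF hQ[symmetric]])
  also have "\<dots> = indicator_arr (P j) (ObMap F j)" by (rule h(2)[OF j])
  finally have "indicator_arr (\<lambda>g. Q (c j \<cdot>\<^bsub>C\<^esub> g)) (ObMap F j) = indicator_arr (P j) (ObMap F j)" .
  from indicator_arr_eqD[OF this f] indicator_arr_eqD[OF this g] fg have "P j f \<longleftrightarrow> P j g" by simp
  moreover have "P j f" unfolding P_def using J.id_hom[OF j] by blast
  ultimately obtain k u v where uv: "u \<in> hom J j k" "v \<in> hom J j k" "ArMap F u \<cdot>\<^bsub>C\<^esub> f = ArMap F v \<cdot>\<^bsub>C\<^esub> g"
    unfolding P_def by blast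
  \<comment> \<open>The witnesses \<open>u\<close> and \<open>v\<close> may be different parallel
    arrows of \<open>J\<close>. Coequalizing them yields one transition arrow that identifies
    \<open>f\<close> with \<open>g\<close>.\<close>
  obtain l w where w: "w \<in> hom J k l" "w \<cdot>\<^bsub>J\<^esub> u = w \<cdot>\<^bsub>J\<^esub> v" using J.filtered_coequalize[OF uv(1,2)] .
  have "ArMap F (w \<cdot>\<^bsub>J\<^esub> u) \<cdot>\<^bsub>C\<^esub> f = ArMap F (w \<cdot>\<^bsub>J\<^esub> u) \<cdot>\<^bsub>C\<^esub> g"
    using F_comp'[OF uv(1) w(1) f] F_comp'[OF uv(2) w(1) g] w(2) uv(3) by simp
  then show ?thesis using that J.comp_hom[OF uv(1) w(1)] by blast
qed

end

section \<open>Symmetric monoidal closed categories\<close>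

locale smc_cat = cat V for V :: "('o, 'a, 'z) smc_category_scheme" (structure) +
  assumes smc: "symmetric_monoidal_closed V"
begin

lemma sym_mon: "symmetric_monoidal V" and mon: "monoidal V"
  using smc by (auto simp: symmetric_monoidal_closed_def symmetric_monoidal_def)

abbreviation unit_ob ("I") where "I \<equiv> UnitO V"
abbreviation one ("\<one>") where "\<one> \<equiv> Ident V"
abbreviation assoc_arr ("\<alpha>") where "\<alpha> \<equiv> Assoc V"
abbreviation assoc_inv ("\<alpha>''") where "\<alpha>' X Y Z \<equiv> inv_arr V (Assoc V X Y Z)"
abbreviation lunit_arr ("\<lambda>\<^sub>I") where "\<lambda>\<^sub>I \<equiv> LUnit V"
abbreviation runit_arr ("\<rho>\<^sub>I") where "\<rho>\<^sub>I \<equiv> RUnit V"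
abbreviation symm_arr ("\<sigma>") where "\<sigma> \<equiv> Symm V"

lemma tensor_functor: "is_functor (prod_cat V V) V (tensor_func V)"
  using mon by (simp add: monoidal_def)

lemma tens_ob [simp]: "X \<in> Ob V \<Longrightarrow> Y \<in> Ob V \<Longrightarrow> X \<otimes> Y \<in> Ob V"
  using tensor_functor by (auto simp: is_functor_def prod_cat_def tensor_func_def)

lemma tens_simps [simp]:
  assumes "f \<in> Ar V" "g \<in> Ar V"
  shows "f \<boxtimes> g \<in> Ar V" "Dom V (f \<boxtimes> g) = Dom V f \<otimes> Dom V g" "Cod V (f \<boxtimes> g) = Cod V f \<otimes> Cod V g"
proof -
  have "\<forall>f\<in>Ar (prod_cat V V). ArMap (tensor_func V) f \<in> hom V (ObMap (tensor_func V) (Dom (prod_cat V V) f)) (ObMap (tensor_func V) (Cod (prod_cat V V) f))"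
    using tensor_functor by (simp add: is_functor_def)
  then show "f \<boxtimes> g \<in> Ar V" "Dom V (f \<boxtimes> g) = Dom V f \<otimes> Dom V g" "Cod V (f \<boxtimes> g) = Cod V f \<otimes> Cod V g"
    using assms by (auto simp: prod_cat_def tensor_func_def hom_def)
qed

lemma tens_hom: "f \<in> hom V X Y \<Longrightarrow> g \<in> hom V X' Y' \<Longrightarrow> f \<boxtimes> g \<in> hom V (X \<otimes> X') (Y \<otimes> Y')"
  by (auto simp: hom_def)

lemma tens_id [simp]: "X \<in> Ob V \<Longrightarrow> Y \<in> Ob V \<Longrightarrow> \<one> X \<boxtimes> \<one> Y = \<one> (X \<otimes> Y)"
  using tensor_functor by (auto simp: is_functor_def prod_cat_def tensor_func_def)

lemma tens_comp:
  assumes "f \<in> Ar V" "g \<in> Ar V" "f' \<in> Ar V" "g' \<in> Ar V" "Dom V g = Cod V f" "Dom V g' = Cod V f'"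
  shows "(g \<boxtimes> g') \<cdot> (f \<boxtimes> f') = (g \<cdot> f) \<boxtimes> (g' \<cdot> f')"
proof -
  have "\<forall>f\<in>Ar (prod_cat V V). \<forall>g\<in>Ar (prod_cat V V). Dom (prod_cat V V) g = Cod (prod_cat V V) f \<longrightarrow> 
     ArMap (tensor_func V) (g \<cdot>\<^bsub>prod_cat V V\<^esub> f) = ArMap (tensor_func V) g \<cdot> ArMap (tensor_func V) f"
    using tensor_functor by (simp add: is_functor_def)
  then show ?thesis using assms by (auto simp: prod_cat_def tensor_func_def)
qed

lemma tens_comp_assoc:
  assumes "f \<in> Ar V" "g \<in> Ar V" "f' \<in> Ar V" "g' \<in> Ar V" "Dom V g = Cod V f" "Dom V g' = Cod V f'"
    and "h \<in> Ar V" "Cod V h = Dom V f \<otimes> Dom V f'"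
  shows "(g \<boxtimes> g') \<cdot> ((f \<boxtimes> f') \<cdot> h) = ((g \<cdot> f) \<boxtimes> (g' \<cdot> f')) \<cdot> h"
  using assms by (simp add: tens_comp flip: comp_assoc)

lemmas merge = tens_comp tens_comp_assoc comp_assoc

lemma whisker_left: 
  "X \<in> Ob V \<Longrightarrow> f \<in> Ar V \<Longrightarrow> g \<in> Ar V \<Longrightarrow> Dom V g = Cod V f \<Longrightarrow> \<one> X \<boxtimes> (g \<cdot> f) = (\<one> X \<boxtimes> g) \<cdot> (\<one> X \<boxtimes> f)"
  and whisker_right: 
  "X \<in> Ob V \<Longrightarrow> f \<in> Ar V \<Longrightarrow> g \<in> Ar V \<Longrightarrow> Dom V g = Cod V f \<Longrightarrow> (g \<cdot> f) \<boxtimes> \<one> X = (g \<boxtimes> \<one> X) \<cdot> (f \<boxtimes> \<one> X)"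
  by (simp_all add: tens_comp)

lemmas whisker = whisker_left whisker_right comp_assoc

lemma inverse_unique:
  assumes "inverse_arrows V f g" shows "inv_arr V f = g"
  unfolding inv_arr_def
proof (rule the_equality)
  fix h assume "inverse_arrows V f h"
  then have "h = h \<cdot> (f \<cdot> g)" "(h \<cdot> f) \<cdot> g = g" using assms by (auto simp: inverse_arrows_def hom_def)
  then show "h = g" using \<open>inverse_arrows V f h\<close> assms comp_assoc[of g f h] by (auto simp: inverse_arrows_def hom_def)
qed (rule assms)

lemma inv_arr: "f \<in> iso V X Y \<Longrightarrow> inverse_arrows V f (inv_arr V f)"
  using inverse_unique by (auto simp: iso_def)

lemma unit_ob [simp]: "I \<in> Ob V" using mon by (simp add: monoidal_def)

lemma assoc_iso: "X \<in> Ob V \<Longrightarrow> Y \<in> Ob V \<Longrightarrow> Z \<in> Ob V \<Longrightarrow> \<alpha> X Y Z \<in> iso V (X \<otimes> Y \<otimes> Z) (X \<otimes> (Y \<otimes> Z))"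
  and lunit_iso: "X \<in> Ob V \<Longrightarrow> \<lambda>\<^sub>I X \<in> iso V (I \<otimes> X) X"
  and runit_iso: "X \<in> Ob V \<Longrightarrow> \<rho>\<^sub>I X \<in> iso V (X \<otimes> I) X"
  using mon by (simp_all add: monoidal_def)

lemma assoc_simps [simp]:
  assumes "X \<in> Ob V" "Y \<in> Ob V" "Z \<in> Ob V"
  shows "\<alpha> X Y Z \<in> Ar V" "Dom V (\<alpha> X Y Z) = X \<otimes> Y \<otimes> Z" "Cod V (\<alpha> X Y Z) = X \<otimes> (Y \<otimes> Z)"
    "\<alpha>' X Y Z \<in> Ar V" "Dom V (\<alpha>' X Y Z) = X \<otimes> (Y \<otimes> Z)" "Cod V (\<alpha>' X Y Z) = X \<otimes> Y \<otimes> Z"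
    "\<alpha> X Y Z \<cdot> \<alpha>' X Y Z = \<one> (X \<otimes> (Y \<otimes> Z))" "\<alpha>' X Y Z \<cdot> \<alpha> X Y Z = \<one> (X \<otimes> Y \<otimes> Z)"
  using assoc_iso[OF assms] inv_arr[OF assoc_iso[OF assms]] by (auto simp: iso_def hom_def inverse_arrows_def)

lemma unit_simps [simp]:
  assumes "X \<in> Ob V"
  shows "\<lambda>\<^sub>I X \<in> Ar V" "Dom V (\<lambda>\<^sub>I X) = I \<otimes> X" "Cod V (\<lambda>\<^sub>I X) = X"
    "\<rho>\<^sub>I X \<in> Ar V" "Dom V (\<rho>\<^sub>I X) = X \<otimes> I" "Cod V (\<rho>\<^sub>I X) = X"
  using lunit_iso[OF assms] runit_iso[OF assms] by (auto simp: iso_def hom_def)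

lemma assoc_cancel [simp]:
  assumes "X \<in> Ob V" "Y \<in> Ob V" "Z \<in> Ob V" "f \<in> Ar V"
  shows "Cod V f = X \<otimes> (Y \<otimes> Z) \<Longrightarrow> \<alpha> X Y Z \<cdot> (\<alpha>' X Y Z \<cdot> f) = f"
    "Cod V f = X \<otimes> Y \<otimes> Z \<Longrightarrow> \<alpha>' X Y Z \<cdot> (\<alpha> X Y Z \<cdot> f) = f"
  using assms by (simp_all flip: comp_assoc)

lemma iso_cancel_left:
  assumes "k \<in> iso V Y Z" "f \<in> hom V X Y" "g \<in> hom V X Y" "k \<cdot> f = k \<cdot> g" shows "f = g"
proof -
  have k: "k \<in> Ar V" "Dom V k = Y" "Cod V k = Z" using assms(1) by (auto simp: iso_def hom_def)
  obtain k' where k': "k' \<in> Ar V" "Dom V k' = Z" "Cod V k' = Y" "k' \<cdot> k = \<one> Y"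
    using assms(1) by (auto simp: iso_def inverse_arrows_def hom_def)
  have "k' \<cdot> (k \<cdot> h) = h" if "h \<in> hom V X Y" for h 
    using comp_reduce[OF k'(4)] that k k' by (simp add: hom_def)
  from this[OF assms(2)] this[OF assms(3)] show ?thesis unfolding assms(4) by (rule trans[OF sym])
qed

lemma iso_cancel_right:
  assumes "k \<in> iso V X Y" "f \<in> hom V Y Z" "g \<in> hom V Y Z" "f \<cdot> k = g \<cdot> k" shows "f = g"
proof -
  have k: "k \<in> Ar V" "Dom V k = X" "Cod V k = Y" using assms(1) by (auto simp: iso_def hom_def)
  obtain k' where k': "k' \<in> Ar V" "Dom V k' = Y" "Cod V k' = X" "k \<cdot> k' = \<one> Y"
    using assms(1) by (auto simp: iso_def inverse_arrows_def hom_def)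
  have "(h \<cdot> k) \<cdot> k' = h" if "h \<in> hom V Y Z" for h
    using that k k' by (simp add: hom_def comp_assoc)
  from this[OF assms(2)] this[OF assms(3)] show ?thesis unfolding assms(4) by (rule trans[OF sym])
qed

lemma assoc_nat:
  assumes "f \<in> Ar V" "g \<in> Ar V" "h \<in> Ar V" "Dom V f = X" "Dom V g = Y" "Dom V h = Z" "Cod V f = X'" "Cod V g = Y'" "Cod V h = Z'"
  shows "\<alpha> X' Y' Z' \<cdot> (f \<boxtimes> g \<boxtimes> h) = (f \<boxtimes> (g \<boxtimes> h)) \<cdot> \<alpha> X Y Z"
  using mon assms by (auto simp: monoidal_def)

lemma assoc_inv_nat:
  assumes "f \<in> Ar V" "g \<in> Ar V" "h \<in> Ar V" "Dom V f = X" "Dom V g = Y" "Dom V h = Z" "Cod V f = X'" "Cod V g = Y'" "Cod V h = Z'"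
  shows "\<alpha>' X' Y' Z' \<cdot> (f \<boxtimes> (g \<boxtimes> h)) = (f \<boxtimes> g \<boxtimes> h) \<cdot> \<alpha>' X Y Z"
proof -
  have [simp]: "X \<in> Ob V" "Y \<in> Ob V" "Z \<in> Ob V" "X' \<in> Ob V" "Y' \<in> Ob V" "Z' \<in> Ob V" using assms dom_ob cod_ob by blast+
  have "\<alpha> X' Y' Z' \<cdot> (\<alpha>' X' Y' Z' \<cdot> (f \<boxtimes> (g \<boxtimes> h))) = \<alpha> X' Y' Z' \<cdot> ((f \<boxtimes> g \<boxtimes> h) \<cdot> \<alpha>' X Y Z)"
    using assms by (simp add: comp_reduce[OF assoc_nat[OF assms]] comp_assoc)
  then show ?thesis
    by (rule iso_cancel_left[OF assoc_iso[of X' Y' Z'], rotated 5]) (simp_all add: hom_def assms)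
qed

lemma lunit_nat: "f \<in> Ar V \<Longrightarrow> Dom V f = X \<Longrightarrow> Cod V f = Y \<Longrightarrow> \<lambda>\<^sub>I Y \<cdot> (\<one> I \<boxtimes> f) = f \<cdot> \<lambda>\<^sub>I X"
  and runit_nat: "f \<in> Ar V \<Longrightarrow> Dom V f = X \<Longrightarrow> Cod V f = Y \<Longrightarrow> \<rho>\<^sub>I Y \<cdot> (f \<boxtimes> \<one> I) = f \<cdot> \<rho>\<^sub>I X"
  using mon by (auto simp: monoidal_def)

lemma pentagon:
  "W \<in> Ob V \<Longrightarrow> X \<in> Ob V \<Longrightarrow> Y \<in> Ob V \<Longrightarrow> Z \<in> Ob V \<Longrightarrow>
   (\<one> W \<boxtimes> \<alpha> X Y Z) \<cdot> (\<alpha> W (X \<otimes> Y) Z \<cdot> (\<alpha> W X Y \<boxtimes> \<one> Z)) = \<alpha> W X (Y \<otimes> Z) \<cdot> \<alpha> (W \<otimes> X) Y Z"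
  using mon by (simp add: monoidal_def comp_assoc)

lemma triangle: "X \<in> Ob V \<Longrightarrow> Y \<in> Ob V \<Longrightarrow> (\<one> X \<boxtimes> \<lambda>\<^sub>I Y) \<cdot> \<alpha> X I Y = \<rho>\<^sub>I X \<boxtimes> \<one> Y"
  using mon by (simp add: monoidal_def)

lemma symm_simps [simp]:
  assumes "X \<in> Ob V" "Y \<in> Ob V"
  shows "\<sigma> X Y \<in> Ar V" "Dom V (\<sigma> X Y) = X \<otimes> Y" "Cod V (\<sigma> X Y) = Y \<otimes> X" "\<sigma> Y X \<cdot> \<sigma> X Y = \<one> (X \<otimes> Y)"
  using sym_mon assms by (auto simp: symmetric_monoidal_def hom_def)

lemma symm_cancel [simp]:
  "X \<in> Ob V \<Longrightarrow> Y \<in> Ob V \<Longrightarrow> f \<in> Ar V \<Longrightarrow> Cod V f = X \<otimes> Y \<Longrightarrow> \<sigma> Y X \<cdot> (\<sigma> X Y \<cdot> f) = f"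
  by (simp flip: comp_assoc)

lemma symm_iso: "X \<in> Ob V \<Longrightarrow> Y \<in> Ob V \<Longrightarrow> \<sigma> X Y \<in> iso V (X \<otimes> Y) (Y \<otimes> X)"
  by (auto simp: iso_def hom_def inverse_arrows_def intro!: exI[of _ "\<sigma> Y X"])

lemma symm_nat:
  "f \<in> Ar V \<Longrightarrow> g \<in> Ar V \<Longrightarrow> Dom V f = X \<Longrightarrow> Dom V g = Y \<Longrightarrow> Cod V f = X' \<Longrightarrow> Cod V g = Y' \<Longrightarrow>
   \<sigma> X' Y' \<cdot> (f \<boxtimes> g) = (g \<boxtimes> f) \<cdot> \<sigma> X Y"
  using sym_mon by (auto simp: symmetric_monoidal_def)

lemma hexagon:
  "X \<in> Ob V \<Longrightarrow> Y \<in> Ob V \<Longrightarrow> Z \<in> Ob V \<Longrightarrow>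
   \<alpha> Y Z X \<cdot> (\<sigma> X (Y \<otimes> Z) \<cdot> \<alpha> X Y Z) = (\<one> Y \<boxtimes> \<sigma> X Z) \<cdot> (\<alpha> Y X Z \<cdot> (\<sigma> X Y \<boxtimes> \<one> Z))"
  using sym_mon by (simp add: symmetric_monoidal_def comp_assoc)

section \<open>Coherence\<close>

lemma iso_comp: "f \<in> iso V X Y \<Longrightarrow> g \<in> iso V Y Z \<Longrightarrow> g \<cdot> f \<in> iso V X Z"
proof -
  assume f: "f \<in> iso V X Y" and g: "g \<in> iso V Y Z"
  then obtain f' g' where "inverse_arrows V f f'" "inverse_arrows V g g'" by (auto simp: iso_def)
  then have "inverse_arrows V (g \<cdot> f) (f' \<cdot> g')"
    using f g by (auto simp: iso_def inverse_arrows_def hom_def comp_assoc comp_reduce[of f' f] comp_reduce[of g' g] comp_reduce[of f f'] comp_reduce[of g g'])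
  then show ?thesis using f g by (auto simp: iso_def hom_def)
qed

lemma iso_tens: "f \<in> iso V X Y \<Longrightarrow> g \<in> iso V X' Y' \<Longrightarrow> f \<boxtimes> g \<in> iso V (X \<otimes> X') (Y \<otimes> Y')"
proof -
  assume f: "f \<in> iso V X Y" and g: "g \<in> iso V X' Y'"
  then obtain f' g' where "inverse_arrows V f f'" "inverse_arrows V g g'" by (auto simp: iso_def)
  then have "inverse_arrows V (f \<boxtimes> g) (f' \<boxtimes> g')"
    using f g by (auto simp: iso_def inverse_arrows_def hom_def merge)
  then show ?thesis using f g by (auto simp: iso_def hom_def)
qed

lemma iso_id: "X \<in> Ob V \<Longrightarrow> \<one> X \<in> iso V X X"
  by (auto simp: iso_def hom_def inverse_arrows_def intro!: exI[of _ "\<one> X"])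

text \<open>Naturality of the unitor makes tensoring with \<open>I\<close> isomorphic to the
  identity functor. A coherence equation may therefore be tensored with \<open>I\<close>, which
  brings the pentagon into play, and the extra factor is cancelled afterwards.\<close>

lemma unit_left_faithful:
  assumes f: "f \<in> hom V X Y" and g: "g \<in> hom V X Y" and e: "\<one> I \<boxtimes> f = \<one> I \<boxtimes> g" shows "f = g"
proof -
  note [simp] = homD[OF f] homD[OF g]
  have X: "X \<in> Ob V" using dom_ob[of f] by simp
  have "f \<cdot> \<lambda>\<^sub>I X = g \<cdot> \<lambda>\<^sub>I X" using lunit_nat[of f X Y] lunit_nat[of g X Y] e by simp
  then show ?thesis by (rule iso_cancel_right[OF lunit_iso[OF X] f g])
qed

lemma unit_right_faithful:
  assumes f: "f \<in> hom V X Y" and g: "g \<in> hom V X Y" and e: "f \<boxtimes> \<one> I = g \<boxtimes> \<one> I" shows "f = g"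
proof -
  note [simp] = homD[OF f] homD[OF g]
  have X: "X \<in> Ob V" using dom_ob[of f] by simp
  have "f \<cdot> \<rho>\<^sub>I X = g \<cdot> \<rho>\<^sub>I X" using runit_nat[of f X Y] runit_nat[of g X Y] e by simp
  then show ?thesis by (rule iso_cancel_right[OF runit_iso[OF X] f g])
qed

text \<open>Kelly's derivation: among the axioms only the triangle, with the unit in the middle,
  relates unitors to associators. Tensoring with \<open>I\<close> on the left and precomposing with
  the isomorphism \<open>?k\<close> exposes the pentagon on \<open>I\<close>, \<open>I\<close>,
  \<open>X\<close>, \<open>Y\<close>, after which both sides reduce to instances of the
  triangle.\<close>

lemma lunit_tensor:
  assumes [simp]: "X \<in> Ob V" "Y \<in> Ob V" shows "\<lambda>\<^sub>I (X \<otimes> Y) \<cdot> \<alpha> I X Y = \<lambda>\<^sub>I X \<boxtimes> \<one> Y"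
proof (rule unit_left_faithful)
  let ?k = "\<alpha> I (I \<otimes> X) Y \<cdot> (\<alpha> I I X \<boxtimes> \<one> Y)"
  have k: "?k \<in> iso V (I \<otimes> I \<otimes> X \<otimes> Y) (I \<otimes> (I \<otimes> X \<otimes> Y))"
    by (intro iso_comp[of _ _ "I \<otimes> (I \<otimes> X) \<otimes> Y"] iso_tens assoc_iso iso_id) simp_all
  have "(\<one> I \<boxtimes> (\<lambda>\<^sub>I (X \<otimes> Y) \<cdot> \<alpha> I X Y)) \<cdot> ?k = (\<one> I \<boxtimes> \<lambda>\<^sub>I (X \<otimes> Y)) \<cdot> (\<alpha> I I (X \<otimes> Y) \<cdot> \<alpha> (I \<otimes> I) X Y)"
    by (simp add: whisker pentagon)
  also have "\<dots> = (\<rho>\<^sub>I I \<boxtimes> \<one> (X \<otimes> Y)) \<cdot> \<alpha> (I \<otimes> I) X Y"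
    by (rule comp_reduce[OF triangle]) simp_all
  also have "\<dots> = \<alpha> I X Y \<cdot> (\<rho>\<^sub>I I \<boxtimes> \<one> X \<boxtimes> \<one> Y)"
    by (subst assoc_nat) simp_all
  also have "\<dots> = (\<alpha> I X Y \<cdot> (\<one> I \<boxtimes> \<lambda>\<^sub>I X \<boxtimes> \<one> Y)) \<cdot> (\<alpha> I I X \<boxtimes> \<one> Y)"
    by (simp add: triangle merge)
  also have "\<dots> = (\<one> I \<boxtimes> (\<lambda>\<^sub>I X \<boxtimes> \<one> Y)) \<cdot> ?k"
    by (subst assoc_nat[of _ _ _ I "I \<otimes> X" Y]) (simp_all add: comp_assoc)
  finally show "\<one> I \<boxtimes> (\<lambda>\<^sub>I (X \<otimes> Y) \<cdot> \<alpha> I X Y) = \<one> I \<boxtimes> (\<lambda>\<^sub>I X \<boxtimes> \<one> Y)"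
    by (rule iso_cancel_right[OF k, rotated 2]) (auto simp: hom_def)
qed (auto simp: hom_def)

text \<open>Mirror image of the argument for the left unitor, by way of the pentagon on
  \<open>X\<close>, \<open>Y\<close>, \<open>I\<close>, \<open>I\<close>.\<close>

lemma runit_tensor:
  assumes [simp]: "X \<in> Ob V" "Y \<in> Ob V" shows "(\<one> X \<boxtimes> \<rho>\<^sub>I Y) \<cdot> \<alpha> X Y I = \<rho>\<^sub>I (X \<otimes> Y)"
proof (rule unit_right_faithful)
  have "\<alpha> X Y I \<cdot> (((\<one> X \<boxtimes> \<rho>\<^sub>I Y) \<cdot> \<alpha> X Y I) \<boxtimes> \<one> I) = (\<alpha> X Y I \<cdot> (\<one> X \<boxtimes> \<rho>\<^sub>I Y \<boxtimes> \<one> I)) \<cdot> (\<alpha> X Y I \<boxtimes> \<one> I)"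
    by (simp add: whisker)
  also have "\<dots> = (\<one> X \<boxtimes> (\<rho>\<^sub>I Y \<boxtimes> \<one> I)) \<cdot> (\<alpha> X (Y \<otimes> I) I \<cdot> (\<alpha> X Y I \<boxtimes> \<one> I))"
    by (subst assoc_nat[of _ _ _ X "Y \<otimes> I" I]) (simp_all add: comp_assoc)
  also have "\<dots> = (\<one> X \<boxtimes> (\<one> Y \<boxtimes> \<lambda>\<^sub>I I)) \<cdot> ((\<one> X \<boxtimes> \<alpha> Y I I) \<cdot> (\<alpha> X (Y \<otimes> I) I \<cdot> (\<alpha> X Y I \<boxtimes> \<one> I)))"
    by (simp add: triangle[symmetric] whisker del: tens_id)
  also have "\<dots> = ((\<one> X \<boxtimes> (\<one> Y \<boxtimes> \<lambda>\<^sub>I I)) \<cdot> \<alpha> X Y (I \<otimes> I)) \<cdot> \<alpha> (X \<otimes> Y) I I"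
    by (simp add: pentagon comp_assoc)
  also have "\<dots> = (\<alpha> X Y I \<cdot> (\<one> (X \<otimes> Y) \<boxtimes> \<lambda>\<^sub>I I)) \<cdot> \<alpha> (X \<otimes> Y) I I"
    by (subst assoc_nat[symmetric]) simp_all
  also have "\<dots> = \<alpha> X Y I \<cdot> (\<rho>\<^sub>I (X \<otimes> Y) \<boxtimes> \<one> I)"
    by (simp add: comp_assoc triangle)
  finally show "((\<one> X \<boxtimes> \<rho>\<^sub>I Y) \<cdot> \<alpha> X Y I) \<boxtimes> \<one> I = \<rho>\<^sub>I (X \<otimes> Y) \<boxtimes> \<one> I"
    by (rule iso_cancel_left[OF assoc_iso[of X Y I], rotated 5]) (auto simp: hom_def)
qed (auto simp: hom_def)

text \<open>The hexagon on \<open>X\<close>, \<open>I\<close>, \<open>I\<close>, read through the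
  unitors: naturality of the symmetry along the unitor of \<open>I\<close> turns its left side into
  a triangle, and the remaining symmetry cancels because it is invertible.\<close>

lemma lunit_symm:
  assumes [simp]: "X \<in> Ob V" shows "\<lambda>\<^sub>I X \<cdot> \<sigma> X I = \<rho>\<^sub>I X"
proof (rule unit_right_faithful)
  have "\<sigma> X I \<cdot> ((\<lambda>\<^sub>I X \<cdot> \<sigma> X I) \<boxtimes> \<one> I) = \<sigma> X I \<cdot> (\<lambda>\<^sub>I (X \<otimes> I) \<cdot> (\<alpha> I X I \<cdot> (\<sigma> X I \<boxtimes> \<one> I)))"
    by (simp add: whisker lunit_tensor[symmetric])
  also have "\<dots> = \<lambda>\<^sub>I (I \<otimes> X) \<cdot> ((\<one> I \<boxtimes> \<sigma> X I) \<cdot> (\<alpha> I X I \<cdot> (\<sigma> X I \<boxtimes> \<one> I)))"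
    by (simp add: comp_reduce[OF lunit_nat[of "\<sigma> X I" "X \<otimes> I" "I \<otimes> X"]] comp_assoc)
  also have "\<dots> = \<lambda>\<^sub>I (I \<otimes> X) \<cdot> (\<alpha> I I X \<cdot> (\<sigma> X (I \<otimes> I) \<cdot> \<alpha> X I I))"
    by (simp add: hexagon)
  also have "\<dots> = (\<lambda>\<^sub>I I \<boxtimes> \<one> X) \<cdot> (\<sigma> X (I \<otimes> I) \<cdot> \<alpha> X I I)"
    by (rule comp_reduce[OF lunit_tensor]) simp_all
  also have "\<dots> = (\<sigma> X I \<cdot> (\<one> X \<boxtimes> \<lambda>\<^sub>I I)) \<cdot> \<alpha> X I I"
    by (subst symm_nat[of _ _ X "I \<otimes> I"]) (simp_all add: comp_assoc)
  also have "\<dots> = \<sigma> X I \<cdot> (\<rho>\<^sub>I X \<boxtimes> \<one> I)"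
    by (simp add: comp_assoc triangle)
  finally show "(\<lambda>\<^sub>I X \<cdot> \<sigma> X I) \<boxtimes> \<one> I = \<rho>\<^sub>I X \<boxtimes> \<one> I"
    by (rule iso_cancel_left[OF symm_iso[of X I], rotated 4]) (auto simp: hom_def)
qed (auto simp: hom_def)

lemma runit_symm:
  assumes [simp]: "X \<in> Ob V" shows "\<rho>\<^sub>I X \<cdot> \<sigma> I X = \<lambda>\<^sub>I X"
  by (simp add: lunit_symm[symmetric] comp_assoc)

section \<open>Exchange of adjacent factors and the middle-four interchange\<close>

definition swap_left :: "'o \<Rightarrow> 'o \<Rightarrow> 'o \<Rightarrow> 'a" ("\<chi>") where
  "\<chi> X Y Z = \<alpha> Y X Z \<cdot> (\<sigma> X Y \<boxtimes> \<one> Z) \<cdot> \<alpha>' X Y Z"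

lemma swap_left_simps [simp]:
  assumes "X \<in> Ob V" "Y \<in> Ob V" "Z \<in> Ob V"
  shows "\<chi> X Y Z \<in> Ar V" "Dom V (\<chi> X Y Z) = X \<otimes> (Y \<otimes> Z)" "Cod V (\<chi> X Y Z) = Y \<otimes> (X \<otimes> Z)"
  using assms by (simp_all add: swap_left_def)

lemma swap_left_nat:
  assumes "f \<in> Ar V" "g \<in> Ar V" "h \<in> Ar V" "Dom V f = X" "Dom V g = Y" "Dom V h = Z" "Cod V f = X'" "Cod V g = Y'" "Cod V h = Z'"
  shows "\<chi> X' Y' Z' \<cdot> (f \<boxtimes> (g \<boxtimes> h)) = (g \<boxtimes> (f \<boxtimes> h)) \<cdot> \<chi> X Y Z"
proof -
  have [simp]: "X \<in> Ob V" "Y \<in> Ob V" "Z \<in> Ob V" "X' \<in> Ob V" "Y' \<in> Ob V" "Z' \<in> Ob V" using assms dom_ob cod_ob by blast+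
  note [simp] = assms
  have "\<chi> X' Y' Z' \<cdot> (f \<boxtimes> (g \<boxtimes> h)) = \<alpha> Y' X' Z' \<cdot> ((\<sigma> X' Y' \<boxtimes> \<one> Z') \<cdot> ((f \<boxtimes> g \<boxtimes> h) \<cdot> \<alpha>' X Y Z))"
    by (simp add: swap_left_def comp_assoc assoc_inv_nat[of f g h X Y Z])
  also have "\<dots> = \<alpha> Y' X' Z' \<cdot> ((g \<boxtimes> f \<boxtimes> h) \<cdot> ((\<sigma> X Y \<boxtimes> \<one> Z) \<cdot> \<alpha>' X Y Z))"
    by (simp add: merge symm_nat[of f g X Y])
  also have "\<dots> = (g \<boxtimes> (f \<boxtimes> h)) \<cdot> \<chi> X Y Z"
    by (simp add: swap_left_def comp_assoc comp_reduce[OF assoc_nat[of g f h Y X Z]])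
  finally show ?thesis .
qed

lemma swap_left_inverse [simp]:
  assumes [simp]: "X \<in> Ob V" "Y \<in> Ob V" "Z \<in> Ob V"
  shows "\<chi> Y X Z \<cdot> \<chi> X Y Z = \<one> (X \<otimes> (Y \<otimes> Z))"
  by (simp add: swap_left_def merge)

text \<open>By the pentagon and naturality of the associator, exchanging the first two factors does
  not depend on how the tail behind them is bracketed.\<close>

lemma swap_left_tail:
  assumes [simp]: "X \<in> Ob V" "Y \<in> Ob V" "Z \<in> Ob V" "W \<in> Ob V"
  shows "(\<one> Y \<boxtimes> \<alpha> X Z W) \<cdot> (\<alpha> Y (X \<otimes> Z) W \<cdot> (\<chi> X Y Z \<boxtimes> \<one> W)) =
     \<chi> X Y (Z \<otimes> W) \<cdot> ((\<one> X \<boxtimes> \<alpha> Y Z W) \<cdot> \<alpha> X (Y \<otimes> Z) W)"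
proof -
  have p: "\<alpha> (X \<otimes> Y) Z W \<cdot> (\<alpha>' X Y Z \<boxtimes> \<one> W) = \<alpha>' X Y (Z \<otimes> W) \<cdot> ((\<one> X \<boxtimes> \<alpha> Y Z W) \<cdot> \<alpha> X (Y \<otimes> Z) W)"
  proof -
    have "\<alpha>' X Y (Z \<otimes> W) \<cdot> ((\<one> X \<boxtimes> \<alpha> Y Z W) \<cdot> \<alpha> X (Y \<otimes> Z) W) = 
       \<alpha>' X Y (Z \<otimes> W) \<cdot> (((\<one> X \<boxtimes> \<alpha> Y Z W) \<cdot> (\<alpha> X (Y \<otimes> Z) W \<cdot> (\<alpha> X Y Z \<boxtimes> \<one> W))) \<cdot> (\<alpha>' X Y Z \<boxtimes> \<one> W))"
      by (simp add: merge)
    then show ?thesis by (simp add: pentagon comp_assoc)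
  qed
  have "(\<one> Y \<boxtimes> \<alpha> X Z W) \<cdot> (\<alpha> Y (X \<otimes> Z) W \<cdot> (\<chi> X Y Z \<boxtimes> \<one> W)) = 
     ((\<one> Y \<boxtimes> \<alpha> X Z W) \<cdot> (\<alpha> Y (X \<otimes> Z) W \<cdot> (\<alpha> Y X Z \<boxtimes> \<one> W))) \<cdot> ((\<sigma> X Y \<boxtimes> \<one> Z \<boxtimes> \<one> W) \<cdot> (\<alpha>' X Y Z \<boxtimes> \<one> W))"
    by (simp add: swap_left_def whisker)
  also have "\<dots> = \<alpha> Y X (Z \<otimes> W) \<cdot> ((\<alpha> (Y \<otimes> X) Z W \<cdot> (\<sigma> X Y \<boxtimes> \<one> Z \<boxtimes> \<one> W)) \<cdot> (\<alpha>' X Y Z \<boxtimes> \<one> W))"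
    by (simp add: pentagon comp_assoc)
  also have "\<alpha> (Y \<otimes> X) Z W \<cdot> (\<sigma> X Y \<boxtimes> \<one> Z \<boxtimes> \<one> W) = (\<sigma> X Y \<boxtimes> (\<one> Z \<boxtimes> \<one> W)) \<cdot> \<alpha> (X \<otimes> Y) Z W"
    by (rule assoc_nat) simp_all
  finally show ?thesis by (simp add: comp_assoc p swap_left_def)
qed

text \<open>The hexagon in front of a tail: moving \<open>X\<close> past
  \<open>Y \<otimes> Y'\<close> means moving it past \<open>Y\<close> and then past
  \<open>Y'\<close>. The facts \<open>p1\<close>, \<open>p2\<close> and \<open>p3\<close> are three
  pentagons that carry the tail \<open>Z\<close> through the associators of the hexagon.\<close>

lemma swap_left_tensor_right:
  assumes [simp]: "X \<in> Ob V" "Y \<in> Ob V" "Y' \<in> Ob V" "Z \<in> Ob V"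
  shows "\<alpha> Y Y' (X \<otimes> Z) \<cdot> \<chi> X (Y \<otimes> Y') Z = 
    (\<one> Y \<boxtimes> \<chi> X Y' Z) \<cdot> (\<chi> X Y (Y' \<otimes> Z) \<cdot> (\<one> X \<boxtimes> \<alpha> Y Y' Z))"
proof -
  have hex: "\<sigma> X (Y \<otimes> Y') = \<alpha>' Y Y' X \<cdot> ((\<one> Y \<boxtimes> \<sigma> X Y') \<cdot> (\<alpha> Y X Y' \<cdot> ((\<sigma> X Y \<boxtimes> \<one> Y') \<cdot> \<alpha>' X Y Y')))"
  proof -
    have "\<sigma> X (Y \<otimes> Y') = \<alpha>' Y Y' X \<cdot> ((\<alpha> Y Y' X \<cdot> (\<sigma> X (Y \<otimes> Y') \<cdot> \<alpha> X Y Y')) \<cdot> \<alpha>' X Y Y')"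
      by (simp add: comp_assoc)
    then show ?thesis unfolding hexagon[OF assms(1-3)] by (simp add: comp_assoc)
  qed
  have p1: "\<alpha> Y Y' (X \<otimes> Z) \<cdot> (\<alpha> (Y \<otimes> Y') X Z \<cdot> (\<alpha>' Y Y' X \<boxtimes> \<one> Z)) = (\<one> Y \<boxtimes> \<alpha> Y' X Z) \<cdot> \<alpha> Y (Y' \<otimes> X) Z"
  proof -
    have "\<alpha> Y Y' (X \<otimes> Z) \<cdot> (\<alpha> (Y \<otimes> Y') X Z \<cdot> (\<alpha>' Y Y' X \<boxtimes> \<one> Z)) = 
       ((\<one> Y \<boxtimes> \<alpha> Y' X Z) \<cdot> (\<alpha> Y (Y' \<otimes> X) Z \<cdot> (\<alpha> Y Y' X \<boxtimes> \<one> Z))) \<cdot> (\<alpha>' Y Y' X \<boxtimes> \<one> Z)"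
      by (simp only: pentagon assms) (simp add: comp_assoc)
    then show ?thesis by (simp add: merge)
  qed
  have p2: "\<alpha> Y (X \<otimes> Y') Z \<cdot> (\<alpha> Y X Y' \<boxtimes> \<one> Z) = (\<one> Y \<boxtimes> \<alpha>' X Y' Z) \<cdot> (\<alpha> Y X (Y' \<otimes> Z) \<cdot> \<alpha> (Y \<otimes> X) Y' Z)"
    by (simp only: pentagon[symmetric] assms) (simp add: merge)
  have p3: "\<alpha> (X \<otimes> Y) Y' Z \<cdot> ((\<alpha>' X Y Y' \<boxtimes> \<one> Z) \<cdot> \<alpha>' X (Y \<otimes> Y') Z) = \<alpha>' X Y (Y' \<otimes> Z) \<cdot> (\<one> X \<boxtimes> \<alpha> Y Y' Z)"
  proof -
    have "\<alpha>' X Y (Y' \<otimes> Z) \<cdot> (\<one> X \<boxtimes> \<alpha> Y Y' Z) = 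
     \<alpha>' X Y (Y' \<otimes> Z) \<cdot> (((\<one> X \<boxtimes> \<alpha> Y Y' Z) \<cdot> (\<alpha> X (Y \<otimes> Y') Z \<cdot> (\<alpha> X Y Y' \<boxtimes> \<one> Z))) \<cdot> ((\<alpha>' X Y Y' \<boxtimes> \<one> Z) \<cdot> \<alpha>' X (Y \<otimes> Y') Z))"
      by (simp add: merge)
    then show ?thesis by (simp only: pentagon assms) (simp add: comp_assoc)
  qed
  have "\<alpha> Y Y' (X \<otimes> Z) \<cdot> \<chi> X (Y \<otimes> Y') Z = 
     (\<alpha> Y Y' (X \<otimes> Z) \<cdot> (\<alpha> (Y \<otimes> Y') X Z \<cdot> (\<alpha>' Y Y' X \<boxtimes> \<one> Z))) \<cdot> ((\<one> Y \<boxtimes> \<sigma> X Y' \<boxtimes> \<one> Z) \<cdot> ((\<alpha> Y X Y' \<boxtimes> \<one> Z) \<cdot> 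
       ((\<sigma> X Y \<boxtimes> \<one> Y' \<boxtimes> \<one> Z) \<cdot> ((\<alpha>' X Y Y' \<boxtimes> \<one> Z) \<cdot> \<alpha>' X (Y \<otimes> Y') Z))))"
    by (simp add: swap_left_def hex whisker)
  also have "\<dots> = (\<one> Y \<boxtimes> \<alpha> Y' X Z) \<cdot> ((\<alpha> Y (Y' \<otimes> X) Z \<cdot> (\<one> Y \<boxtimes> \<sigma> X Y' \<boxtimes> \<one> Z)) \<cdot> ((\<alpha> Y X Y' \<boxtimes> \<one> Z) \<cdot> 
       ((\<sigma> X Y \<boxtimes> \<one> Y' \<boxtimes> \<one> Z) \<cdot> ((\<alpha>' X Y Y' \<boxtimes> \<one> Z) \<cdot> \<alpha>' X (Y \<otimes> Y') Z))))"
    by (simp only: p1) (simp add: comp_assoc)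
  also have "\<alpha> Y (Y' \<otimes> X) Z \<cdot> (\<one> Y \<boxtimes> \<sigma> X Y' \<boxtimes> \<one> Z) = (\<one> Y \<boxtimes> (\<sigma> X Y' \<boxtimes> \<one> Z)) \<cdot> \<alpha> Y (X \<otimes> Y') Z"
    by (rule assoc_nat) simp_all
  also have "(\<one> Y \<boxtimes> \<alpha> Y' X Z) \<cdot> ((\<one> Y \<boxtimes> (\<sigma> X Y' \<boxtimes> \<one> Z)) \<cdot> \<alpha> Y (X \<otimes> Y') Z \<cdot> ((\<alpha> Y X Y' \<boxtimes> \<one> Z) \<cdot> 
       ((\<sigma> X Y \<boxtimes> \<one> Y' \<boxtimes> \<one> Z) \<cdot> ((\<alpha>' X Y Y' \<boxtimes> \<one> Z) \<cdot> \<alpha>' X (Y \<otimes> Y') Z)))) = 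
       (\<one> Y \<boxtimes> \<alpha> Y' X Z) \<cdot> ((\<one> Y \<boxtimes> (\<sigma> X Y' \<boxtimes> \<one> Z)) \<cdot> ((\<alpha> Y (X \<otimes> Y') Z \<cdot> (\<alpha> Y X Y' \<boxtimes> \<one> Z)) \<cdot> 
       ((\<sigma> X Y \<boxtimes> \<one> Y' \<boxtimes> \<one> Z) \<cdot> ((\<alpha>' X Y Y' \<boxtimes> \<one> Z) \<cdot> \<alpha>' X (Y \<otimes> Y') Z))))"
    by (simp add: comp_assoc)
  also have "\<dots> = (\<one> Y \<boxtimes> \<chi> X Y' Z) \<cdot> (\<alpha> Y X (Y' \<otimes> Z) \<cdot> ((\<alpha> (Y \<otimes> X) Y' Z \<cdot> (\<sigma> X Y \<boxtimes> \<one> Y' \<boxtimes> \<one> Z)) \<cdot> 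
         ((\<alpha>' X Y Y' \<boxtimes> \<one> Z) \<cdot> \<alpha>' X (Y \<otimes> Y') Z)))"
    unfolding p2 by (simp add: swap_left_def whisker)
  also have "\<alpha> (Y \<otimes> X) Y' Z \<cdot> (\<sigma> X Y \<boxtimes> \<one> Y' \<boxtimes> \<one> Z) = (\<sigma> X Y \<boxtimes> (\<one> Y' \<boxtimes> \<one> Z)) \<cdot> \<alpha> (X \<otimes> Y) Y' Z"
    by (rule assoc_nat) simp_all
  finally show ?thesis by (simp add: comp_assoc p3 swap_left_def[of X Y])
qed

text \<open>Since \<open>\<chi> Y X Z\<close> and \<open>\<chi> X Y Z\<close> are mutually inverse,
  this is the law for a tensor product on the right, read backwards.\<close>

lemma swap_left_tensor_left:
  assumes [simp]: "X \<in> Ob V" "X' \<in> Ob V" "Y \<in> Ob V" "Z \<in> Ob V"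
  shows "(\<one> Y \<boxtimes> \<alpha> X X' Z) \<cdot> \<chi> (X \<otimes> X') Y Z = 
    \<chi> X Y (X' \<otimes> Z) \<cdot> ((\<one> X \<boxtimes> \<chi> X' Y Z) \<cdot> \<alpha> X X' (Y \<otimes> Z))"
proof -
  have "\<chi> X Y (X' \<otimes> Z) \<cdot> ((\<one> X \<boxtimes> \<chi> X' Y Z) \<cdot> ((\<alpha> X X' (Y \<otimes> Z) \<cdot> \<chi> Y (X \<otimes> X') Z) \<cdot> \<chi> (X \<otimes> X') Y Z)) = 
    (\<one> Y \<boxtimes> \<alpha> X X' Z) \<cdot> \<chi> (X \<otimes> X') Y Z"
    unfolding swap_left_tensor_right[OF assms(3,1,2,4)] by (simp add: merge comp_reduce[OF swap_left_inverse])
  then show ?thesis by (simp add: comp_assoc)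
qed

abbreviation interchange_arr ("\<tau>") where "\<tau> \<equiv> interchange V"

text \<open>Up to associators the interchange is one exchange of adjacent factors behind
  \<open>W\<close>, so its laws reduce to those of \<open>\<chi>\<close>.\<close>

lemma interchange_eq: "\<tau> W X Y Z = \<alpha>' W Y (X \<otimes> Z) \<cdot> (\<one> W \<boxtimes> \<chi> X Y Z) \<cdot> \<alpha> W X (Y \<otimes> Z)"
  by (simp add: interchange_def swap_left_def)

lemma interchange_simps [simp]:
  assumes "W \<in> Ob V" "X \<in> Ob V" "Y \<in> Ob V" "Z \<in> Ob V"
  shows "\<tau> W X Y Z \<in> Ar V" "Dom V (\<tau> W X Y Z) = W \<otimes> X \<otimes> (Y \<otimes> Z)" "Cod V (\<tau> W X Y Z) = W \<otimes> Y \<otimes> (X \<otimes> Z)"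
  using assms by (simp_all add: interchange_eq)

lemma interchange_nat:
  assumes "e \<in> Ar V" "f \<in> Ar V" "g \<in> Ar V" "h \<in> Ar V" "Dom V e = W" "Dom V f = X" "Dom V g = Y" "Dom V h = Z" 
    "Cod V e = W'" "Cod V f = X'" "Cod V g = Y'" "Cod V h = Z'"
  shows "\<tau> W' X' Y' Z' \<cdot> (e \<boxtimes> f \<boxtimes> (g \<boxtimes> h)) = (e \<boxtimes> g \<boxtimes> (f \<boxtimes> h)) \<cdot> \<tau> W X Y Z"
proof -
  have [simp]: "X \<in> Ob V" "Y \<in> Ob V" "Z \<in> Ob V" "X' \<in> Ob V" "Y' \<in> Ob V" "Z' \<in> Ob V" 
    "W \<in> Ob V" "W' \<in> Ob V" using assms dom_ob cod_ob by blast+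
  note [simp] = assms
  have "\<tau> W' X' Y' Z' \<cdot> (e \<boxtimes> f \<boxtimes> (g \<boxtimes> h)) = \<alpha>' W' Y' (X' \<otimes> Z') \<cdot> ((\<one> W' \<boxtimes> \<chi> X' Y' Z') \<cdot> ((e \<boxtimes> (f \<boxtimes> (g \<boxtimes> h))) \<cdot> \<alpha> W X (Y \<otimes> Z)))"
    by (simp add: interchange_eq comp_assoc assoc_nat[of e f "g \<boxtimes> h" W X "Y \<otimes> Z"])
  also have "\<dots> = \<alpha>' W' Y' (X' \<otimes> Z') \<cdot> ((e \<boxtimes> (g \<boxtimes> (f \<boxtimes> h))) \<cdot> ((\<one> W \<boxtimes> \<chi> X Y Z) \<cdot> \<alpha> W X (Y \<otimes> Z)))"
    by (simp add: merge swap_left_nat[of f g h X Y Z])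
  also have "\<dots> = (e \<boxtimes> g \<boxtimes> (f \<boxtimes> h)) \<cdot> \<tau> W X Y Z"
    by (simp add: interchange_eq comp_assoc comp_reduce[OF assoc_inv_nat[of e g "f \<boxtimes> h" W Y "X \<otimes> Z"]])
  finally show ?thesis .
qed

text \<open>Meant for the left unit law of convolution: after the counit has turned one copy of the
  comonoid into \<open>I\<close>, this removes the interchange that remains.\<close>

lemma interchange_unit_left:
  assumes [simp]: "X \<in> Ob V" "Y \<in> Ob V"
  shows "\<lambda>\<^sub>I (X \<otimes> Y) \<cdot> ((\<lambda>\<^sub>I I \<boxtimes> \<one> (X \<otimes> Y)) \<cdot> \<tau> I X I Y) = \<lambda>\<^sub>I X \<boxtimes> \<lambda>\<^sub>I Y"
proof -
  have l: "(\<lambda>\<^sub>I I \<boxtimes> \<one> (X \<otimes> Y)) \<cdot> \<alpha>' I I (X \<otimes> Y) = \<lambda>\<^sub>I (I \<otimes> (X \<otimes> Y))"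
    by (simp add: lunit_tensor[symmetric] comp_assoc)
  have m: "\<lambda>\<^sub>I (X \<otimes> Y) \<cdot> \<chi> X I Y = \<one> X \<boxtimes> \<lambda>\<^sub>I Y"
  proof -
    have "\<lambda>\<^sub>I (X \<otimes> Y) \<cdot> \<chi> X I Y = (\<lambda>\<^sub>I X \<boxtimes> \<one> Y) \<cdot> ((\<sigma> X I \<boxtimes> \<one> Y) \<cdot> \<alpha>' X I Y)"
      by (simp add: swap_left_def comp_assoc comp_reduce[OF lunit_tensor])
    also have "\<dots> = ((\<one> X \<boxtimes> \<lambda>\<^sub>I Y) \<cdot> \<alpha> X I Y) \<cdot> \<alpha>' X I Y"
      by (simp add: merge lunit_symm triangle)
    finally show ?thesis by (simp add: comp_assoc)
  qed
  have "\<lambda>\<^sub>I (X \<otimes> Y) \<cdot> ((\<lambda>\<^sub>I I \<boxtimes> \<one> (X \<otimes> Y)) \<cdot> \<tau> I X I Y) = 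
    \<lambda>\<^sub>I (X \<otimes> Y) \<cdot> ((\<lambda>\<^sub>I (I \<otimes> (X \<otimes> Y)) \<cdot> (\<one> I \<boxtimes> \<chi> X I Y)) \<cdot> \<alpha> I X (I \<otimes> Y))"
    by (simp add: interchange_eq comp_assoc comp_reduce[OF l])
  also have "\<lambda>\<^sub>I (I \<otimes> (X \<otimes> Y)) \<cdot> (\<one> I \<boxtimes> \<chi> X I Y) = \<chi> X I Y \<cdot> \<lambda>\<^sub>I (X \<otimes> (I \<otimes> Y))"
    by (rule lunit_nat) simp_all
  finally show ?thesis
    by (simp add: comp_assoc comp_reduce[OF m] lunit_tensor merge)
qed

lemma interchange_unit_right:
  assumes [simp]: "X \<in> Ob V" "Y \<in> Ob V"
  shows "\<rho>\<^sub>I (X \<otimes> Y) \<cdot> ((\<one> (X \<otimes> Y) \<boxtimes> \<lambda>\<^sub>I I) \<cdot> \<tau> X I Y I) = \<rho>\<^sub>I X \<boxtimes> \<rho>\<^sub>I Y"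
proof -
  have r: "\<rho>\<^sub>I (X \<otimes> Y) \<cdot> \<alpha>' X Y I = \<one> X \<boxtimes> \<rho>\<^sub>I Y"
    by (simp add: runit_tensor[symmetric] comp_assoc)
  have l: "(\<lambda>\<^sub>I Y \<boxtimes> \<one> I) \<cdot> \<alpha>' I Y I = \<lambda>\<^sub>I (Y \<otimes> I)"
    by (simp add: lunit_tensor[symmetric] comp_assoc)
  have m: "(\<one> Y \<boxtimes> \<lambda>\<^sub>I I) \<cdot> \<chi> I Y I = \<lambda>\<^sub>I (Y \<otimes> I)"
    by (simp add: swap_left_def comp_assoc comp_reduce[OF triangle] merge runit_symm l)
  have n: "(\<one> (X \<otimes> Y) \<boxtimes> \<lambda>\<^sub>I I) \<cdot> \<alpha>' X Y (I \<otimes> I) = \<alpha>' X Y I \<cdot> (\<one> X \<boxtimes> (\<one> Y \<boxtimes> \<lambda>\<^sub>I I))"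
    by (subst assoc_inv_nat[of _ _ _ X Y "I \<otimes> I"]) simp_all
  have "\<rho>\<^sub>I (X \<otimes> Y) \<cdot> ((\<one> (X \<otimes> Y) \<boxtimes> \<lambda>\<^sub>I I) \<cdot> \<tau> X I Y I) = (\<one> X \<boxtimes> \<rho>\<^sub>I Y) \<cdot> ((\<one> X \<boxtimes> ((\<one> Y \<boxtimes> \<lambda>\<^sub>I I) \<cdot> \<chi> I Y I)) \<cdot> \<alpha> X I (Y \<otimes> I))"
    by (simp add: interchange_eq comp_assoc comp_reduce[OF n] comp_reduce[OF r] whisker)
  also have "\<dots> = (\<one> X \<boxtimes> \<rho>\<^sub>I Y) \<cdot> (\<rho>\<^sub>I X \<boxtimes> \<one> (Y \<otimes> I))"
    unfolding m by (simp add: triangle)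
  finally show ?thesis by (simp add: merge)
qed

text \<open>Both sides are compared after reassociating the target to the right, where each becomes a
  composite of instances of \<open>swap_left\<close>.\<close>

lemma interchange_assoc:
  assumes [simp]: "a \<in> Ob V" "b \<in> Ob V" "c \<in> Ob V" "x \<in> Ob V" "y \<in> Ob V" "z \<in> Ob V"
  shows "\<alpha> (a \<otimes> x) (b \<otimes> y) (c \<otimes> z) \<cdot> ((\<tau> a b x y \<boxtimes> \<one> (c \<otimes> z)) \<cdot> \<tau> (a \<otimes> b) c (x \<otimes> y) z) =
    (\<one> (a \<otimes> x) \<boxtimes> \<tau> b c y z) \<cdot> (\<tau> a (b \<otimes> c) x (y \<otimes> z) \<cdot> (\<alpha> a b c \<boxtimes> \<alpha> x y z))" (is "?L = ?R")
proof -
  let ?N = "(\<one> a \<boxtimes> (\<one> x \<boxtimes> \<alpha> b y (c \<otimes> z))) \<cdot> \<alpha> a x (b \<otimes> y \<otimes> (c \<otimes> z))"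
  \<comment> \<open>Passing from \<open>a b c x y z\<close> to \<open>a x b y c z\<close> takes
    three adjacent exchanges. In \<open>?K\<close> they occur in the order \<open>c\<close> past
    \<open>x\<close>, \<open>b\<close> past \<open>x\<close>, \<open>c\<close> past
    \<open>y\<close>.\<close>
  let ?K = "(\<one> a \<boxtimes> ((\<one> x \<boxtimes> (\<one> b \<boxtimes> \<chi> c y z)) \<cdot> (\<chi> b x (c \<otimes> (y \<otimes> z)) \<cdot> (\<one> b \<boxtimes> \<chi> c x (y \<otimes> z)))))
     \<cdot> (\<alpha> a b (c \<otimes> (x \<otimes> (y \<otimes> z))) \<cdot> (\<alpha> (a \<otimes> b) c (x \<otimes> (y \<otimes> z)) \<cdot> (\<one> (a \<otimes> b \<otimes> c) \<boxtimes> \<alpha> x y z)))"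
  have N: "?N \<in> iso V (a \<otimes> x \<otimes> (b \<otimes> y \<otimes> (c \<otimes> z))) (a \<otimes> (x \<otimes> (b \<otimes> (y \<otimes> (c \<otimes> z)))))"
    by (intro iso_comp[of _ _ "a \<otimes> (x \<otimes> (b \<otimes> y \<otimes> (c \<otimes> z)))"] iso_tens assoc_iso iso_id) simp_all
  have R: "?N \<cdot> ?R = ?K"
  proof -
    have 1: "\<alpha> a x (b \<otimes> y \<otimes> (c \<otimes> z)) \<cdot> (\<one> (a \<otimes> x) \<boxtimes> \<tau> b c y z) = (\<one> a \<boxtimes> (\<one> x \<boxtimes> \<tau> b c y z)) \<cdot> \<alpha> a x (b \<otimes> c \<otimes> (y \<otimes> z))"
      using assoc_nat[of "\<one> a" "\<one> x" "\<tau> b c y z" a x "b \<otimes> c \<otimes> (y \<otimes> z)" a x "b \<otimes> y \<otimes> (c \<otimes> z)"] by simp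
    have 2: "\<alpha> b y (c \<otimes> z) \<cdot> \<tau> b c y z = (\<one> b \<boxtimes> \<chi> c y z) \<cdot> \<alpha> b c (y \<otimes> z)"
      by (simp add: interchange_eq comp_assoc)
    have "?N \<cdot> ?R = (\<one> a \<boxtimes> (\<one> x \<boxtimes> (\<alpha> b y (c \<otimes> z) \<cdot> \<tau> b c y z))) \<cdot> ((\<one> a \<boxtimes> \<chi> (b \<otimes> c) x (y \<otimes> z)) \<cdot> (\<alpha> a (b \<otimes> c) (x \<otimes> (y \<otimes> z)) \<cdot> (\<alpha> a b c \<boxtimes> \<alpha> x y z)))"
      by (simp add: comp_assoc comp_reduce[OF 1] interchange_eq[of a] whisker)
    also have "\<dots> = (\<one> a \<boxtimes> ((\<one> x \<boxtimes> (\<one> b \<boxtimes> \<chi> c y z)) \<cdot> ((\<one> x \<boxtimes> \<alpha> b c (y \<otimes> z)) \<cdot> \<chi> (b \<otimes> c) x (y \<otimes> z)))) \<cdot> (\<alpha> a (b \<otimes> c) (x \<otimes> (y \<otimes> z)) \<cdot> (\<alpha> a b c \<boxtimes> \<alpha> x y z))"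
      unfolding 2 by (simp add: whisker)
    also have "\<dots> = (\<one> a \<boxtimes> ((\<one> x \<boxtimes> (\<one> b \<boxtimes> \<chi> c y z)) \<cdot> (\<chi> b x (c \<otimes> (y \<otimes> z)) \<cdot> (\<one> b \<boxtimes> \<chi> c x (y \<otimes> z))))) \<cdot> 
       (((\<one> a \<boxtimes> \<alpha> b c (x \<otimes> (y \<otimes> z))) \<cdot> (\<alpha> a (b \<otimes> c) (x \<otimes> (y \<otimes> z)) \<cdot> (\<alpha> a b c \<boxtimes> \<one> (x \<otimes> (y \<otimes> z))))) \<cdot> (\<one> (a \<otimes> b \<otimes> c) \<boxtimes> \<alpha> x y z))"
      by (simp add: swap_left_tensor_left whisker) (simp add: tens_comp)
    also have "\<dots> = ?K" by (simp only: pentagon assms tens_ob) (simp add: comp_assoc)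
    finally show ?thesis .
  qed
  have L: "?N \<cdot> ?L = ?K"
  proof -
    have p: "\<alpha> a x (b \<otimes> y \<otimes> (c \<otimes> z)) \<cdot> (\<alpha> (a \<otimes> x) (b \<otimes> y) (c \<otimes> z) \<cdot> (\<alpha>' a x (b \<otimes> y) \<boxtimes> \<one> (c \<otimes> z))) = 
      (\<one> a \<boxtimes> \<alpha> x (b \<otimes> y) (c \<otimes> z)) \<cdot> \<alpha> a (x \<otimes> (b \<otimes> y)) (c \<otimes> z)" (is "?l = _")
    proof -
      have "?l = ((\<one> a \<boxtimes> \<alpha> x (b \<otimes> y) (c \<otimes> z)) \<cdot> (\<alpha> a (x \<otimes> (b \<otimes> y)) (c \<otimes> z) \<cdot> (\<alpha> a x (b \<otimes> y) \<boxtimes> \<one> (c \<otimes> z)))) \<cdot> (\<alpha>' a x (b \<otimes> y) \<boxtimes> \<one> (c \<otimes> z))"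
        by (simp only: pentagon assms tens_ob) (simp add: comp_assoc)
      then show ?thesis by (simp add: merge)
    qed
    have n: "\<alpha> a (x \<otimes> (b \<otimes> y)) (c \<otimes> z) \<cdot> (\<one> a \<boxtimes> \<chi> b x y \<boxtimes> \<one> (c \<otimes> z)) = (\<one> a \<boxtimes> (\<chi> b x y \<boxtimes> \<one> (c \<otimes> z))) \<cdot> \<alpha> a (b \<otimes> (x \<otimes> y)) (c \<otimes> z)"
      by (rule assoc_nat) simp_all
    have q: "\<alpha> (a \<otimes> b) (x \<otimes> y) (c \<otimes> z) \<cdot> \<tau> (a \<otimes> b) c (x \<otimes> y) z = (\<one> (a \<otimes> b) \<boxtimes> \<chi> c (x \<otimes> y) z) \<cdot> \<alpha> (a \<otimes> b) c (x \<otimes> y \<otimes> z)"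
      by (simp add: interchange_eq comp_assoc)
    have r: "\<alpha> a b (x \<otimes> y \<otimes> (c \<otimes> z)) \<cdot> (\<one> (a \<otimes> b) \<boxtimes> \<chi> c (x \<otimes> y) z) = (\<one> a \<boxtimes> (\<one> b \<boxtimes> \<chi> c (x \<otimes> y) z)) \<cdot> \<alpha> a b (c \<otimes> (x \<otimes> y \<otimes> z))"
      using assoc_nat[of "\<one> a" "\<one> b" "\<chi> c (x \<otimes> y) z" a b "c \<otimes> (x \<otimes> y \<otimes> z)" a b "x \<otimes> y \<otimes> (c \<otimes> z)"] by simp
    \<comment> \<open>The left side moves \<open>c\<close> past \<open>y\<close> before it moves
      \<open>b\<close> past \<open>x\<close>. These exchanges act on disjoint factors and commute by
      naturality.\<close>
    have s: "\<chi> b x (y \<otimes> (c \<otimes> z)) \<cdot> (\<one> b \<boxtimes> (\<one> x \<boxtimes> \<chi> c y z)) = (\<one> x \<boxtimes> (\<one> b \<boxtimes> \<chi> c y z)) \<cdot> \<chi> b x (c \<otimes> (y \<otimes> z))"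
      by (rule swap_left_nat) simp_all
    have t: "(\<one> a \<boxtimes> (\<one> b \<boxtimes> (\<one> c \<boxtimes> \<alpha> x y z))) \<cdot> \<alpha> a b (c \<otimes> (x \<otimes> y \<otimes> z)) = \<alpha> a b (c \<otimes> (x \<otimes> (y \<otimes> z))) \<cdot> (\<one> (a \<otimes> b) \<boxtimes> (\<one> c \<boxtimes> \<alpha> x y z))"
      using assoc_nat[of "\<one> a" "\<one> b" "\<one> c \<boxtimes> \<alpha> x y z" a b "c \<otimes> (x \<otimes> y \<otimes> z)" a b "c \<otimes> (x \<otimes> (y \<otimes> z))"] by simp
    have u: "(\<one> (a \<otimes> b) \<boxtimes> (\<one> c \<boxtimes> \<alpha> x y z)) \<cdot> \<alpha> (a \<otimes> b) c (x \<otimes> y \<otimes> z) = \<alpha> (a \<otimes> b) c (x \<otimes> (y \<otimes> z)) \<cdot> (\<one> (a \<otimes> b \<otimes> c) \<boxtimes> \<alpha> x y z)"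
      using assoc_nat[of "\<one> (a \<otimes> b)" "\<one> c" "\<alpha> x y z" "a \<otimes> b" c "x \<otimes> y \<otimes> z" "a \<otimes> b" c "x \<otimes> (y \<otimes> z)"] by simp
    have 1: "?N \<cdot> ?L = (\<one> a \<boxtimes> (\<one> x \<boxtimes> \<alpha> b y (c \<otimes> z))) \<cdot> ((\<alpha> a x (b \<otimes> y \<otimes> (c \<otimes> z)) \<cdot> (\<alpha> (a \<otimes> x) (b \<otimes> y) (c \<otimes> z) \<cdot> (\<alpha>' a x (b \<otimes> y) \<boxtimes> \<one> (c \<otimes> z)))) \<cdot> 
       ((\<one> a \<boxtimes> \<chi> b x y \<boxtimes> \<one> (c \<otimes> z)) \<cdot> ((\<alpha> a b (x \<otimes> y) \<boxtimes> \<one> (c \<otimes> z)) \<cdot> \<tau> (a \<otimes> b) c (x \<otimes> y) z)))"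
      by (simp add: interchange_eq[of a b x y] whisker)
    have 2: "\<dots> = (\<one> a \<boxtimes> ((\<one> x \<boxtimes> \<alpha> b y (c \<otimes> z)) \<cdot> (\<alpha> x (b \<otimes> y) (c \<otimes> z) \<cdot> (\<chi> b x y \<boxtimes> \<one> (c \<otimes> z))))) \<cdot> 
       (\<alpha> a (b \<otimes> (x \<otimes> y)) (c \<otimes> z) \<cdot> ((\<alpha> a b (x \<otimes> y) \<boxtimes> \<one> (c \<otimes> z)) \<cdot> \<tau> (a \<otimes> b) c (x \<otimes> y) z))"
      unfolding p by (simp add: comp_assoc comp_reduce[OF n] whisker)
    have 3: "\<dots> = (\<one> a \<boxtimes> (\<chi> b x (y \<otimes> (c \<otimes> z)) \<cdot> (\<one> b \<boxtimes> \<alpha> x y (c \<otimes> z)))) \<cdot> 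
       (((\<one> a \<boxtimes> \<alpha> b (x \<otimes> y) (c \<otimes> z)) \<cdot> (\<alpha> a (b \<otimes> (x \<otimes> y)) (c \<otimes> z) \<cdot> (\<alpha> a b (x \<otimes> y) \<boxtimes> \<one> (c \<otimes> z)))) \<cdot> \<tau> (a \<otimes> b) c (x \<otimes> y) z)"
      unfolding swap_left_tail[OF assms(2,4,5) tens_ob[OF assms(3,6)]] by (simp add: whisker)
    have 4: "\<dots> = (\<one> a \<boxtimes> (\<chi> b x (y \<otimes> (c \<otimes> z)) \<cdot> (\<one> b \<boxtimes> \<alpha> x y (c \<otimes> z)))) \<cdot> 
       (\<alpha> a b (x \<otimes> y \<otimes> (c \<otimes> z)) \<cdot> ((\<one> (a \<otimes> b) \<boxtimes> \<chi> c (x \<otimes> y) z) \<cdot> \<alpha> (a \<otimes> b) c (x \<otimes> y \<otimes> z)))"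
      by (simp only: pentagon assms tens_ob) (simp add: comp_assoc q)
    have 5: "\<dots> = (\<one> a \<boxtimes> (\<chi> b x (y \<otimes> (c \<otimes> z)) \<cdot> (\<one> b \<boxtimes> (\<alpha> x y (c \<otimes> z) \<cdot> \<chi> c (x \<otimes> y) z)))) \<cdot> 
       (\<alpha> a b (c \<otimes> (x \<otimes> y \<otimes> z)) \<cdot> \<alpha> (a \<otimes> b) c (x \<otimes> y \<otimes> z))"
      by (simp add: comp_reduce[OF r] whisker)
    have 6: "\<dots> = (\<one> a \<boxtimes> ((\<chi> b x (y \<otimes> (c \<otimes> z)) \<cdot> (\<one> b \<boxtimes> (\<one> x \<boxtimes> \<chi> c y z))) \<cdot> (\<one> b \<boxtimes> \<chi> c x (y \<otimes> z)))) \<cdot> 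
       ((\<one> a \<boxtimes> (\<one> b \<boxtimes> (\<one> c \<boxtimes> \<alpha> x y z))) \<cdot> (\<alpha> a b (c \<otimes> (x \<otimes> y \<otimes> z)) \<cdot> \<alpha> (a \<otimes> b) c (x \<otimes> y \<otimes> z)))"
      unfolding swap_left_tensor_right[OF assms(3,4,5,6)] by (simp add: whisker)
    have 7: "\<dots> = ?K"
      unfolding s by (simp add: comp_assoc comp_reduce[OF t] u)
    show ?thesis using 1 2 3 4 5 6 7 by simp
  qed
  show ?thesis by (rule iso_cancel_left[OF N]) (simp_all add: hom_def L R)
qed

end

context smc_cat
begin

section \<open>Internal homs and joint epimorphisms\<close>

lemma ihom_simps [simp]:
  assumes "X \<in> Ob V" "Y \<in> Ob V"
  shows "IHom V X Y \<in> Ob V" "Eval V X Y \<in> Ar V" "Dom V (Eval V X Y) = IHom V X Y \<otimes> X" "Cod V (Eval V X Y) = Y"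
  using smc assms by (auto simp: symmetric_monoidal_closed_def hom_def)

lemma transpose_ex1:
  "X \<in> Ob V \<Longrightarrow> Y \<in> Ob V \<Longrightarrow> Z \<in> Ob V \<Longrightarrow> f \<in> hom V (Z \<otimes> X) Y \<Longrightarrow>
    \<exists>!g. g \<in> hom V Z (IHom V X Y) \<and> Eval V X Y \<cdot> (g \<boxtimes> \<one> X) = f"
  using smc unfolding symmetric_monoidal_closed_def by blast

lemma transpose:
  assumes "X \<in> Ob V" "Y \<in> Ob V" "Z \<in> Ob V" "f \<in> hom V (Z \<otimes> X) Y"
  shows "transpose V Z X Y f \<in> hom V Z (IHom V X Y)" "Eval V X Y \<cdot> (transpose V Z X Y f \<boxtimes> \<one> X) = f"
  using theI'[OF transpose_ex1[OF assms]] by (auto simp: transpose_def)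

text \<open>The uniqueness of transposes in the form in which it is used: two arrows into an
  internal hom are equal once they agree after evaluation.\<close>

lemma eval_cancel:
  assumes "X \<in> Ob V" "Y \<in> Ob V" and g: "g \<in> hom V Z (IHom V X Y)" "g' \<in> hom V Z (IHom V X Y)" 
    "Eval V X Y \<cdot> (g \<boxtimes> \<one> X) = Eval V X Y \<cdot> (g' \<boxtimes> \<one> X)"
  shows "g = g'"
proof -
  have "Z \<in> Ob V" using dom_ob[of g] g by (auto simp: hom_def)
  moreover have "Eval V X Y \<cdot> (g \<boxtimes> \<one> X) \<in> hom V (Z \<otimes> X) Y" using assms by (auto simp: hom_def)
  ultimately show ?thesis by (rule ex1_unique[OF transpose_ex1[OF assms(1,2)]]) (use g in simp_all)
qed

text \<open>Arrows out of \<open>Y \<otimes> X\<close> correspond to arrows out of \<open>Y\<close>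
  into an internal hom, and precomposition with \<open>c i \<boxtimes> \<one> X\<close> corresponds
  to precomposition with \<open>c i\<close>.\<close>

lemma jointly_epi_tensor_right:
  assumes c: "jointly_epi V J Y c" "\<And>i. i \<in> J \<Longrightarrow> c i \<in> hom V (F i) Y" and [simp]: "X \<in> Ob V" "Y \<in> Ob V"
  shows "jointly_epi V J (Y \<otimes> X) (\<lambda>i. c i \<boxtimes> \<one> X)"
  unfolding jointly_epi_def
proof (intro allI ballI impI)
  fix Z f g assume f: "f \<in> hom V (Y \<otimes> X) Z" and g: "g \<in> hom V (Y \<otimes> X) Z" and e: "\<forall>i\<in>J. f \<cdot> (c i \<boxtimes> \<one> X) = g \<cdot> (c i \<boxtimes> \<one> X)"
  note [simp] = homD[OF f] homD[OF g]
  have Z[simp]: "Z \<in> Ob V" using cod_ob[of f] by simp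
  note tf = transpose[OF assms(3) Z assms(4) f] and tg = transpose[OF assms(3) Z assms(4) g]
  note [simp] = homD[OF tf(1)] homD[OF tg(1)]
  have "transpose V Y X Z f = transpose V Y X Z g"
  proof (rule jointly_epiD[OF c(1) tf(1) tg(1)])
    fix i assume i: "i \<in> J"
    note [simp] = homD[OF c(2)[OF i]]
    show "transpose V Y X Z f \<cdot> c i = transpose V Y X Z g \<cdot> c i"
    proof (rule eval_cancel[OF assms(3) Z])
      show "Eval V X Z \<cdot> ((transpose V Y X Z f \<cdot> c i) \<boxtimes> \<one> X) = Eval V X Z \<cdot> ((transpose V Y X Z g \<cdot> c i) \<boxtimes> \<one> X)"
        using e i by (simp add: whisker comp_reduce[OF tf(2)] comp_reduce[OF tg(2)])
    qed (auto simp: hom_def)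
  qed
  from arg_cong[OF this, of "\<lambda>k. Eval V X Z \<cdot> (k \<boxtimes> \<one> X)"] show "f = g"
    unfolding tf(2) tg(2) .
qed

lemma jointly_epi_tensor_left:
  assumes c: "jointly_epi V J Y c" "\<And>i. i \<in> J \<Longrightarrow> c i \<in> hom V (F i) Y" and [simp]: "X \<in> Ob V" "Y \<in> Ob V"
  shows "jointly_epi V J (X \<otimes> Y) (\<lambda>i. \<one> X \<boxtimes> c i)"
  unfolding jointly_epi_def
proof (intro allI ballI impI)
  fix Z f g assume f: "f \<in> hom V (X \<otimes> Y) Z" and g: "g \<in> hom V (X \<otimes> Y) Z" and e: "\<forall>i\<in>J. f \<cdot> (\<one> X \<boxtimes> c i) = g \<cdot> (\<one> X \<boxtimes> c i)"
  note [simp] = homD[OF f] homD[OF g]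
  have "f \<cdot> \<sigma> Y X = g \<cdot> \<sigma> Y X"
  proof (rule jointly_epiD[OF jointly_epi_tensor_right[OF c assms(3,4)]])
    fix i assume i: "i \<in> J"
    note [simp] = homD[OF c(2)[OF i]]
    have [simp]: "F i \<in> Ob V" using dom_ob[of "c i"] by simp
    have "\<sigma> Y X \<cdot> (c i \<boxtimes> \<one> X) = (\<one> X \<boxtimes> c i) \<cdot> \<sigma> (F i) X" by (rule symm_nat) simp_all
    then show "f \<cdot> \<sigma> Y X \<cdot> (c i \<boxtimes> \<one> X) = g \<cdot> \<sigma> Y X \<cdot> (c i \<boxtimes> \<one> X)"
      using e i by (simp add: comp_assoc) (simp flip: comp_assoc)
  qed (auto simp: hom_def)
  then show "f = g" by (rule iso_cancel_right[OF symm_iso[OF assms(4,3)] f g])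
qed

lemma jointly_epi_tensor:
  assumes c: "jointly_epi V J Y c" "\<And>i. i \<in> J \<Longrightarrow> c i \<in> hom V (F i) Y" 
    and d: "jointly_epi V J' Y' d" "\<And>i. i \<in> J' \<Longrightarrow> d i \<in> hom V (F' i) Y'" and [simp]: "Y \<in> Ob V" "Y' \<in> Ob V"
  shows "jointly_epi V (J \<times> J') (Y \<otimes> Y') (\<lambda>(i, j). c i \<boxtimes> d j)"
  unfolding jointly_epi_def
proof (intro allI ballI impI)
  fix Z f g assume f: "f \<in> hom V (Y \<otimes> Y') Z" and g: "g \<in> hom V (Y \<otimes> Y') Z" 
    and e: "\<forall>i\<in>J \<times> J'. f \<cdot> (case i of (i, j) \<Rightarrow> c i \<boxtimes> d j) = g \<cdot> (case i of (i, j) \<Rightarrow> c i \<boxtimes> d j)"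
  note [simp] = homD[OF f] homD[OF g]
  show "f = g"
  proof (rule jointly_epiD[OF jointly_epi_tensor_right[OF c assms(6,5)] f g])
    fix i assume i: "i \<in> J"
    note [simp] = homD[OF c(2)[OF i]]
    have [simp]: "F i \<in> Ob V" using dom_ob[of "c i"] by simp
    show "f \<cdot> (c i \<boxtimes> \<one> Y') = g \<cdot> (c i \<boxtimes> \<one> Y')"
    proof (rule jointly_epiD[OF jointly_epi_tensor_left[OF d, of "F i"]])
      fix j assume j: "j \<in> J'"
      note [simp] = homD[OF d(2)[OF j]]
      show "f \<cdot> (c i \<boxtimes> \<one> Y') \<cdot> (\<one> (F i) \<boxtimes> d j) = g \<cdot> (c i \<boxtimes> \<one> Y') \<cdot> (\<one> (F i) \<boxtimes> d j)"
        using bspec[OF e, of "(i, j)"] i j by (simp add: merge)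
    qed (auto simp: hom_def)
  qed
qed

text \<open>The existence half of the fact that the left adjoint \<open>- \<otimes> X\<close>
  preserves colimits: the arrows \<open>d i\<close> are transposed to a cocone on the original
  graph. Uniqueness is covered by joint epimorphy.\<close>

lemma colimit_tensor_right_desc:
  assumes c: "graph_colimit V J F E Y c" and G: "graph V J F E" and [simp]: "X \<in> Ob V" "Z \<in> Ob V"
    and d: "\<And>i. i \<in> J \<Longrightarrow> d i \<in> hom V (F i \<otimes> X) Z" "\<And>i u j. (i, u, j) \<in> E \<Longrightarrow> d j \<cdot> (u \<boxtimes> \<one> X) = d i"
  obtains h where "h \<in> hom V (Y \<otimes> X) Z" "\<And>i. i \<in> J \<Longrightarrow> h \<cdot> (c i \<boxtimes> \<one> X) = d i"
proof -
  have F: "i \<in> J \<Longrightarrow> F i \<in> Ob V" for i using G by (auto simp: graph_def)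
  have E: "(i, u, j) \<in> E \<Longrightarrow> i \<in> J \<and> j \<in> J \<and> u \<in> hom V (F i) (F j)" for i u j using G by (auto simp: graph_def)
  define t where "t i = transpose V (F i) X Z (d i)" for i
  have t: "t i \<in> hom V (F i) (IHom V X Z)" "Eval V X Z \<cdot> (t i \<boxtimes> \<one> X) = d i" if "i \<in> J" for i
    unfolding t_def using transpose[OF assms(3,4) F[OF that] d(1)[OF that]] by auto
  have "graph_cocone V J F E (IHom V X Z) t"
    unfolding graph_cocone_def
  proof (intro conjI ballI, simp_all add: t)
    show "case x of (i, u, j) \<Rightarrow> t j \<cdot> u = t i" if "x \<in> E" for x
    proof -
      obtain i u j where x: "x = (i, u, j)" by (cases x)
      then have e: "i \<in> J" "j \<in> J" "u \<in> hom V (F i) (F j)" using E that by auto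
      note [simp] = homD[OF e(3)] homD[OF t(1)[OF e(2)]] homD[OF t(1)[OF e(1)]]
      have "t j \<cdot> u = t i"
      proof (rule eval_cancel[OF assms(3,4)])
        show "Eval V X Z \<cdot> ((t j \<cdot> u) \<boxtimes> \<one> X) = Eval V X Z \<cdot> (t i \<boxtimes> \<one> X)"
          using d(2)[of i u j] that x e by (simp add: whisker comp_reduce[OF t(2)[OF e(2)]] t(2)[OF e(1)])
      qed (auto simp: hom_def)
      then show ?thesis by (simp add: x)
    qed
  qed
  then obtain k where k: "k \<in> hom V Y (IHom V X Z)" "\<And>i. i \<in> J \<Longrightarrow> k \<cdot> c i = t i" using graph_colimit_desc[OF c] by metis
  note [simp] = homD[OF k(1)]
  have "Eval V X Z \<cdot> (k \<boxtimes> \<one> X) \<cdot> (c i \<boxtimes> \<one> X) = d i" if i: "i \<in> J" for i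
  proof -
    have "c i \<in> hom V (F i) Y" using graph_colimit_cocone[OF c] i by (auto simp: graph_cocone_def)
    then show ?thesis using k(2)[OF i] t(2)[OF i] by (simp add: merge hom_def)
  qed
  then show ?thesis by (intro that[of "Eval V X Z \<cdot> (k \<boxtimes> \<one> X)"]) (auto simp: hom_def)
qed

lemma colimit_tensor_left_desc:
  assumes c: "graph_colimit V J F E Y c" and G: "graph V J F E" and [simp]: "X \<in> Ob V" "Z \<in> Ob V"
    and d: "\<And>i. i \<in> J \<Longrightarrow> d i \<in> hom V (X \<otimes> F i) Z" "\<And>i u j. (i, u, j) \<in> E \<Longrightarrow> d j \<cdot> (\<one> X \<boxtimes> u) = d i"
  obtains h where "h \<in> hom V (X \<otimes> Y) Z" "\<And>i. i \<in> J \<Longrightarrow> h \<cdot> (\<one> X \<boxtimes> c i) = d i"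
proof -
  have F: "i \<in> J \<Longrightarrow> F i \<in> Ob V" for i using G by (auto simp: graph_def)
  have E: "(i, u, j) \<in> E \<Longrightarrow> i \<in> J \<and> j \<in> J \<and> u \<in> hom V (F i) (F j)" for i u j using G by (auto simp: graph_def)
  have Y [simp]: "Y \<in> Ob V" using graph_colimit_cocone[OF c] by (auto simp: graph_cocone_def)
  have d1: "d i \<cdot> \<sigma> (F i) X \<in> hom V (F i \<otimes> X) Z" if "i \<in> J" for i
    using d(1)[OF that] F[OF that] by (simp add: hom_def)
  have d2: "d j \<cdot> \<sigma> (F j) X \<cdot> (u \<boxtimes> \<one> X) = d i \<cdot> \<sigma> (F i) X" if "(i, u, j) \<in> E" for i u j
  proof -
    have e: "i \<in> J" "j \<in> J" "u \<in> hom V (F i) (F j)" using E[OF that] by auto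
    note [simp] = homD[OF e(3)] F[OF e(1)] F[OF e(2)] homD[OF d(1)[OF e(1)]] homD[OF d(1)[OF e(2)]]
    have "\<sigma> (F j) X \<cdot> (u \<boxtimes> \<one> X) = (\<one> X \<boxtimes> u) \<cdot> \<sigma> (F i) X" by (rule symm_nat) simp_all
    then show ?thesis by (simp add: comp_assoc comp_reduce[OF d(2)[OF that]])
  qed
  obtain h where h: "h \<in> hom V (Y \<otimes> X) Z" "\<And>i. i \<in> J \<Longrightarrow> h \<cdot> (c i \<boxtimes> \<one> X) = d i \<cdot> \<sigma> (F i) X"
    using colimit_tensor_right_desc[OF c G assms(3,4), of "\<lambda>i. d i \<cdot> \<sigma> (F i) X"] d1 d2 by metis
  have "h \<cdot> \<sigma> X Y \<cdot> (\<one> X \<boxtimes> c i) = d i" if i: "i \<in> J" for i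
  proof -
    have "c i \<in> hom V (F i) Y" using graph_colimit_cocone[OF c] i by (auto simp: graph_cocone_def)
    note [simp] = homD[OF this] homD[OF h(1)] F[OF i] homD[OF d(1)[OF i]]
    have "\<sigma> X Y \<cdot> (\<one> X \<boxtimes> c i) = (c i \<boxtimes> \<one> X) \<cdot> \<sigma> X (F i)" by (rule symm_nat) simp_all
    then show ?thesis by (simp add: comp_assoc comp_reduce[OF h(2)[OF i]])
  qed
  then show ?thesis using h(1) by (intro that[of "h \<cdot> \<sigma> X Y"]) (auto simp: hom_def)
qed

section \<open>Monoids, comonoids and measurings\<close>

lemma monoidD:
  assumes "is_monoid V (A, m, \<eta>)"
  shows "A \<in> Ob V" "m \<in> Ar V \<and> Dom V m = A \<otimes> A \<and> Cod V m = A" "\<eta> \<in> Ar V \<and> Dom V \<eta> = I \<and> Cod V \<eta> = A"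
    "m \<cdot> (m \<boxtimes> \<one> A) = m \<cdot> ((\<one> A \<boxtimes> m) \<cdot> \<alpha> A A A)" "m \<cdot> (\<eta> \<boxtimes> \<one> A) = \<lambda>\<^sub>I A" "m \<cdot> (\<one> A \<boxtimes> \<eta>) = \<rho>\<^sub>I A"
  using assms by (auto simp: is_monoid_def hom_def comp_assoc)

lemma comonoidD:
  assumes "is_comonoid V (C, \<Delta>, \<epsilon>)"
  shows "C \<in> Ob V" "\<Delta> \<in> Ar V \<and> Dom V \<Delta> = C \<and> Cod V \<Delta> = C \<otimes> C" "\<epsilon> \<in> Ar V \<and> Dom V \<epsilon> = C \<and> Cod V \<epsilon> = I"
    "\<alpha> C C C \<cdot> ((\<Delta> \<boxtimes> \<one> C) \<cdot> \<Delta>) = (\<one> C \<boxtimes> \<Delta>) \<cdot> \<Delta>" "\<lambda>\<^sub>I C \<cdot> ((\<epsilon> \<boxtimes> \<one> C) \<cdot> \<Delta>) = \<one> C" "\<rho>\<^sub>I C \<cdot> ((\<one> C \<boxtimes> \<epsilon>) \<cdot> \<Delta>) = \<one> C"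
  using assms by (auto simp: is_comonoid_def hom_def comp_assoc)

lemma monoid_hom_id: "is_monoid V M \<Longrightarrow> is_monoid_hom V M (\<one> (fst M)) M"
  by (cases M) (auto simp: is_monoid_hom_def is_monoid_def hom_def)

lemma monoid_hom_comp:
  "is_monoid V M \<Longrightarrow> is_monoid V N \<Longrightarrow> is_monoid V P \<Longrightarrow> is_monoid_hom V M f N \<Longrightarrow> is_monoid_hom V N g P \<Longrightarrow> is_monoid_hom V M (g \<cdot> f) P"
proof -
  assume M: "is_monoid V M" "is_monoid V N" "is_monoid V P" and f: "is_monoid_hom V M f N" and g: "is_monoid_hom V N g P"
  obtain A m e A' m' e' A'' m'' e'' where t: "M = (A, m, e)" "N = (A', m', e')" "P = (A'', m'', e'')" by (cases M, cases N, cases P)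
  note [simp] = monoidD(1-3)[OF M(1)[unfolded t]] monoidD(1-3)[OF M(2)[unfolded t]] monoidD(1-3)[OF M(3)[unfolded t]]
  have F: "f \<in> Ar V \<and> Dom V f = A \<and> Cod V f = A'" "f \<cdot> m = m' \<cdot> (f \<boxtimes> f)" "f \<cdot> e = e'" using f by (auto simp: is_monoid_hom_def t hom_def)
  have G: "g \<in> Ar V \<and> Dom V g = A' \<and> Cod V g = A''" "g \<cdot> m' = m'' \<cdot> (g \<boxtimes> g)" "g \<cdot> e' = e''" using g by (auto simp: is_monoid_hom_def t hom_def)
  note [simp] = F(1) G(1)
  show ?thesis by (auto simp: t is_monoid_hom_def hom_def comp_assoc F G comp_reduce[OF G(2)] tens_comp)
qed

lemma category_Mon: "category (Mon V)"
  unfolding category_def hom_def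
proof (intro conjI ballI impI)
  fix f g assume "f \<in> Ar (Mon V)" "g \<in> Ar (Mon V)" "Dom (Mon V) g = Cod (Mon V) f"
  then show "g \<cdot>\<^bsub>Mon V\<^esub> f \<in> {h \<in> Ar (Mon V). Dom (Mon V) h = Dom (Mon V) f \<and> Cod (Mon V) h = Cod (Mon V) g}"
    using monoid_hom_comp by (cases f; cases g) (auto simp: Mon_def)
next
  fix f g h assume "f \<in> Ar (Mon V)" "g \<in> Ar (Mon V)" "h \<in> Ar (Mon V)" "Dom (Mon V) g = Cod (Mon V) f" "Dom (Mon V) h = Cod (Mon V) g"
  then show "h \<cdot>\<^bsub>Mon V\<^esub> (g \<cdot>\<^bsub>Mon V\<^esub> f) = h \<cdot>\<^bsub>Mon V\<^esub> g \<cdot>\<^bsub>Mon V\<^esub> f"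
    by (cases f; cases g; cases h) (auto simp: Mon_def is_monoid_hom_def hom_def comp_assoc)
qed (auto simp: Mon_def monoid_hom_id, auto simp: is_monoid_hom_def hom_def)

lemma comonoid_hom_id: "is_comonoid V M \<Longrightarrow> is_comonoid_hom V M (\<one> (fst M)) M"
  by (cases M) (auto simp: is_comonoid_hom_def is_comonoid_def hom_def)

lemma comonoid_hom_comp:
  "is_comonoid V M \<Longrightarrow> is_comonoid V N \<Longrightarrow> is_comonoid V P \<Longrightarrow> is_comonoid_hom V M f N \<Longrightarrow> is_comonoid_hom V N g P \<Longrightarrow> is_comonoid_hom V M (g \<cdot> f) P"
proof -
  assume M: "is_comonoid V M" "is_comonoid V N" "is_comonoid V P" and f: "is_comonoid_hom V M f N" and g: "is_comonoid_hom V N g P"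
  obtain A m e A' m' e' A'' m'' e'' where t: "M = (A, m, e)" "N = (A', m', e')" "P = (A'', m'', e'')" by (cases M, cases N, cases P)
  note [simp] = comonoidD(1-3)[OF M(1)[unfolded t]] comonoidD(1-3)[OF M(2)[unfolded t]] comonoidD(1-3)[OF M(3)[unfolded t]]
  have F: "f \<in> Ar V \<and> Dom V f = A \<and> Cod V f = A'" "m' \<cdot> f = (f \<boxtimes> f) \<cdot> m" "e' \<cdot> f = e" using f by (auto simp: is_comonoid_hom_def t hom_def)
  have G: "g \<in> Ar V \<and> Dom V g = A' \<and> Cod V g = A''" "m'' \<cdot> g = (g \<boxtimes> g) \<cdot> m'" "e'' \<cdot> g = e'" using g by (auto simp: is_comonoid_hom_def t hom_def)
  note [simp] = F(1) G(1)
  show ?thesis by (auto simp: t is_comonoid_hom_def hom_def merge F comp_reduce[OF G(2)] comp_reduce[OF G(3)])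
qed

lemma category_Comon: "category (Comon V)"
  unfolding category_def hom_def
proof (intro conjI ballI impI)
  fix f g assume "f \<in> Ar (Comon V)" "g \<in> Ar (Comon V)" "Dom (Comon V) g = Cod (Comon V) f"
  then show "g \<cdot>\<^bsub>Comon V\<^esub> f \<in> {h \<in> Ar (Comon V). Dom (Comon V) h = Dom (Comon V) f \<and> Cod (Comon V) h = Cod (Comon V) g}"
    using comonoid_hom_comp by (cases f; cases g) (auto simp: Comon_def)
next
  fix f g h assume "f \<in> Ar (Comon V)" "g \<in> Ar (Comon V)" "h \<in> Ar (Comon V)" "Dom (Comon V) g = Cod (Comon V) f" "Dom (Comon V) h = Cod (Comon V) g"
  then show "h \<cdot>\<^bsub>Comon V\<^esub> (g \<cdot>\<^bsub>Comon V\<^esub> f) = h \<cdot>\<^bsub>Comon V\<^esub> g \<cdot>\<^bsub>Comon V\<^esub> f"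
    by (cases f; cases g; cases h) (auto simp: Comon_def is_comonoid_hom_def hom_def comp_assoc)
qed (auto simp: Comon_def comonoid_hom_id, auto simp: is_comonoid_hom_def hom_def)

text \<open>The convolution product of \<open>f : X \<otimes> C \<rightarrow> B\<close> and
  \<open>g : Y \<otimes> C \<rightarrow> B\<close>, in transposed form. The objects \<open>X\<close>
  and \<open>Y\<close> are allowed to differ so that iterated products make sense and associativity
  can be stated.\<close>

definition convolve :: "'a \<Rightarrow> 'o \<Rightarrow> 'a \<Rightarrow> 'o \<Rightarrow> 'o \<Rightarrow> 'a \<Rightarrow> 'a \<Rightarrow> 'a" where
  "convolve m C \<Delta> X Y f g = m \<cdot> ((f \<boxtimes> g) \<cdot> (\<tau> X Y C C \<cdot> (\<one> (X \<otimes> Y) \<boxtimes> \<Delta>)))"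

text \<open>A measuring \<open>t : A \<otimes> C \<rightarrow> B\<close> is the transpose of a monoid morphism \<open>A \<rightarrow> [C, B]\<close>.\<close>

definition measuring :: "('o, 'a) struct \<Rightarrow> ('o, 'a) struct \<Rightarrow> ('o, 'a) struct \<Rightarrow> 'a \<Rightarrow> bool" where
  "measuring = (\<lambda>(A, m, \<eta>) (B, n, \<theta>) (C, \<Delta>, \<epsilon>) t.
     t \<in> hom V (A \<otimes> C) B \<and> t \<cdot> (m \<boxtimes> \<one> C) = convolve n C \<Delta> A A t t \<and>
     t \<cdot> (\<eta> \<boxtimes> \<one> C) = \<theta> \<cdot> (\<epsilon> \<cdot> \<lambda>\<^sub>I C))"

section \<open>Convolution and the monoid structure of the internal hom\<close>

context
  fixes B n \<theta> C \<Delta> \<epsilon>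
  assumes B: "is_monoid V (B, n, \<theta>)" and C: "is_comonoid V (C, \<Delta>, \<epsilon>)"
begin

lemmas [simp] = monoidD(1-3)[OF B] comonoidD(1-3)[OF C]

lemma convolve_hom:
  "X \<in> Ob V \<Longrightarrow> Y \<in> Ob V \<Longrightarrow> f \<in> hom V (X \<otimes> C) B \<Longrightarrow> g \<in> hom V (Y \<otimes> C) B \<Longrightarrow> convolve n C \<Delta> X Y f g \<in> hom V (X \<otimes> Y \<otimes> C) B"
  by (auto simp: convolve_def hom_def)

lemma convolve_nat:
  assumes "f \<in> hom V (X \<otimes> C) B" "g \<in> hom V (Y \<otimes> C) B" "k \<in> hom V X' X" "l \<in> hom V Y' Y"
  shows "convolve n C \<Delta> X' Y' (f \<cdot> (k \<boxtimes> \<one> C)) (g \<cdot> (l \<boxtimes> \<one> C)) = convolve n C \<Delta> X Y f g \<cdot> (k \<boxtimes> l \<boxtimes> \<one> C)"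
proof -
  note [simp] = homD[OF assms(1)] homD[OF assms(2)] homD[OF assms(3)] homD[OF assms(4)]
  have [simp]: "X \<in> Ob V" "X' \<in> Ob V" "Y \<in> Ob V" "Y' \<in> Ob V" using dom_ob[of k] cod_ob[of k] dom_ob[of l] cod_ob[of l] by simp_all
  have "\<tau> X Y C C \<cdot> (k \<boxtimes> l \<boxtimes> (\<one> C \<boxtimes> \<one> C)) = (k \<boxtimes> \<one> C \<boxtimes> (l \<boxtimes> \<one> C)) \<cdot> \<tau> X' Y' C C"
    by (rule interchange_nat) simp_all
  then have t: "\<tau> X Y C C \<cdot> (k \<boxtimes> l \<boxtimes> \<one> (C \<otimes> C)) = (k \<boxtimes> \<one> C \<boxtimes> (l \<boxtimes> \<one> C)) \<cdot> \<tau> X' Y' C C" by simp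
  have "convolve n C \<Delta> X' Y' (f \<cdot> (k \<boxtimes> \<one> C)) (g \<cdot> (l \<boxtimes> \<one> C)) = 
    n \<cdot> ((f \<boxtimes> g) \<cdot> (((k \<boxtimes> \<one> C \<boxtimes> (l \<boxtimes> \<one> C)) \<cdot> \<tau> X' Y' C C) \<cdot> (\<one> (X' \<otimes> Y') \<boxtimes> \<Delta>)))"
    by (simp add: convolve_def merge)
  also have "\<dots> = convolve n C \<Delta> X Y f g \<cdot> (k \<boxtimes> l \<boxtimes> \<one> C)"
    by (simp add: t[symmetric] convolve_def merge)
  finally show ?thesis .
qed

lemma convolve_comonoid_hom:
  assumes s: "s \<in> hom V (X \<otimes> C) B" and t: "t \<in> hom V (Y \<otimes> C) B" and [simp]: "X \<in> Ob V" "Y \<in> Ob V"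
    and C': "is_comonoid V (C', \<Delta>', \<epsilon>')" and f: "f \<in> hom V C' C" "\<Delta> \<cdot> f = (f \<boxtimes> f) \<cdot> \<Delta>'"
  shows "convolve n C \<Delta> X Y s t \<cdot> (\<one> (X \<otimes> Y) \<boxtimes> f) = convolve n C' \<Delta>' X Y (s \<cdot> (\<one> X \<boxtimes> f)) (t \<cdot> (\<one> Y \<boxtimes> f))"
proof -
  note [simp] = comonoidD(1-3)[OF C'] homD[OF f(1)] homD[OF s] homD[OF t]
  have nat: "(\<one> X \<boxtimes> f \<boxtimes> (\<one> Y \<boxtimes> f)) \<cdot> \<tau> X Y C' C' = \<tau> X Y C C \<cdot> (\<one> (X \<otimes> Y) \<boxtimes> (f \<boxtimes> f))"
    using interchange_nat[of "\<one> X" "\<one> Y" f f X Y C' C' X Y C C] by simp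
  have "convolve n C \<Delta> X Y s t \<cdot> (\<one> (X \<otimes> Y) \<boxtimes> f) = 
     n \<cdot> ((s \<boxtimes> t) \<cdot> ((\<tau> X Y C C \<cdot> (\<one> (X \<otimes> Y) \<boxtimes> (f \<boxtimes> f))) \<cdot> (\<one> (X \<otimes> Y) \<boxtimes> \<Delta>')))"
    by (simp add: convolve_def comp_assoc tens_comp f(2))
  also have "\<dots> = convolve n C' \<Delta>' X Y (s \<cdot> (\<one> X \<boxtimes> f)) (t \<cdot> (\<one> Y \<boxtimes> f))"
    unfolding nat[symmetric] by (simp add: convolve_def merge)
  finally show ?thesis .
qed

text \<open>Associativity of \<open>n\<close> on the target and coassociativity of
  \<open>\<Delta>\<close> on the source, with \<open>interchange_assoc\<close> matching the two ways
  of distributing three copies of \<open>C\<close> over \<open>X\<close>, \<open>Y\<close>,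
  \<open>Z\<close>. Both sides are brought to the form \<open>?w\<close>.\<close>

lemma convolve_assoc:
  assumes f: "f \<in> hom V (X \<otimes> C) B" and g: "g \<in> hom V (Y \<otimes> C) B" and h: "h \<in> hom V (Z \<otimes> C) B"
    and [simp]: "X \<in> Ob V" "Y \<in> Ob V" "Z \<in> Ob V"
  shows "convolve n C \<Delta> (X \<otimes> Y) Z (convolve n C \<Delta> X Y f g) h =
     convolve n C \<Delta> X (Y \<otimes> Z) f (convolve n C \<Delta> Y Z g h) \<cdot> (\<alpha> X Y Z \<boxtimes> \<one> C)"
proof -
  note [simp] = homD[OF f] homD[OF g] homD[OF h]
  have t1: "(\<one> (X \<otimes> Y) \<boxtimes> \<Delta> \<boxtimes> \<one> (Z \<otimes> C)) \<cdot> \<tau> (X \<otimes> Y) Z C C = \<tau> (X \<otimes> Y) Z (C \<otimes> C) C \<cdot> (\<one> (X \<otimes> Y \<otimes> Z) \<boxtimes> (\<Delta> \<boxtimes> \<one> C))"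
    using interchange_nat[of "\<one> (X \<otimes> Y)" "\<one> Z" \<Delta> "\<one> C" "X \<otimes> Y" Z C C "X \<otimes> Y" Z "C \<otimes> C" C] by simp
  have t2: "(\<one> (X \<otimes> C) \<boxtimes> (\<one> (Y \<otimes> Z) \<boxtimes> \<Delta>)) \<cdot> \<tau> X (Y \<otimes> Z) C C = \<tau> X (Y \<otimes> Z) C (C \<otimes> C) \<cdot> (\<one> (X \<otimes> (Y \<otimes> Z)) \<boxtimes> (\<one> C \<boxtimes> \<Delta>))"
    using interchange_nat[of "\<one> X" "\<one> (Y \<otimes> Z)" "\<one> C" \<Delta> X "Y \<otimes> Z" C C X "Y \<otimes> Z" C "C \<otimes> C"] by simp
  let ?w = "n \<cdot> ((\<one> B \<boxtimes> n) \<cdot> ((f \<boxtimes> (g \<boxtimes> h)) \<cdot> ((\<one> (X \<otimes> C) \<boxtimes> \<tau> Y Z C C) \<cdot> (\<tau> X (Y \<otimes> Z) C (C \<otimes> C) \<cdot> (\<alpha> X Y Z \<boxtimes> ((\<one> C \<boxtimes> \<Delta>) \<cdot> \<Delta>))))))"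
  have "convolve n C \<Delta> (X \<otimes> Y) Z (convolve n C \<Delta> X Y f g) h =
     n \<cdot> ((n \<boxtimes> \<one> B) \<cdot> ((f \<boxtimes> g \<boxtimes> h) \<cdot> ((\<tau> X Y C C \<boxtimes> \<one> (Z \<otimes> C)) \<cdot> (((\<one> (X \<otimes> Y) \<boxtimes> \<Delta> \<boxtimes> \<one> (Z \<otimes> C)) \<cdot> \<tau> (X \<otimes> Y) Z C C) \<cdot> (\<one> (X \<otimes> Y \<otimes> Z) \<boxtimes> \<Delta>)))))"
    by (simp add: convolve_def merge)
  also have "\<dots> = (n \<cdot> (n \<boxtimes> \<one> B)) \<cdot> ((f \<boxtimes> g \<boxtimes> h) \<cdot> ((\<tau> X Y C C \<boxtimes> \<one> (Z \<otimes> C)) \<cdot> (\<tau> (X \<otimes> Y) Z (C \<otimes> C) C \<cdot> (\<one> (X \<otimes> Y \<otimes> Z) \<boxtimes> ((\<Delta> \<boxtimes> \<one> C) \<cdot> \<Delta>)))))"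
    unfolding t1 by (simp add: whisker)
  also have "\<dots> = n \<cdot> ((\<one> B \<boxtimes> n) \<cdot> ((\<alpha> B B B \<cdot> (f \<boxtimes> g \<boxtimes> h)) \<cdot> ((\<tau> X Y C C \<boxtimes> \<one> (Z \<otimes> C)) \<cdot> (\<tau> (X \<otimes> Y) Z (C \<otimes> C) C \<cdot> (\<one> (X \<otimes> Y \<otimes> Z) \<boxtimes> ((\<Delta> \<boxtimes> \<one> C) \<cdot> \<Delta>))))))"
    unfolding monoidD(4)[OF B] by (simp add: comp_assoc)
  also have "\<alpha> B B B \<cdot> (f \<boxtimes> g \<boxtimes> h) = (f \<boxtimes> (g \<boxtimes> h)) \<cdot> \<alpha> (X \<otimes> C) (Y \<otimes> C) (Z \<otimes> C)"
    by (rule assoc_nat) simp_all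
  also have "n \<cdot> ((\<one> B \<boxtimes> n) \<cdot> ((f \<boxtimes> (g \<boxtimes> h)) \<cdot> \<alpha> (X \<otimes> C) (Y \<otimes> C) (Z \<otimes> C) \<cdot> ((\<tau> X Y C C \<boxtimes> \<one> (Z \<otimes> C)) \<cdot> (\<tau> (X \<otimes> Y) Z (C \<otimes> C) C \<cdot> (\<one> (X \<otimes> Y \<otimes> Z) \<boxtimes> ((\<Delta> \<boxtimes> \<one> C) \<cdot> \<Delta>)))))) =
     n \<cdot> ((\<one> B \<boxtimes> n) \<cdot> ((f \<boxtimes> (g \<boxtimes> h)) \<cdot> ((\<alpha> (X \<otimes> C) (Y \<otimes> C) (Z \<otimes> C) \<cdot> ((\<tau> X Y C C \<boxtimes> \<one> (Z \<otimes> C)) \<cdot> \<tau> (X \<otimes> Y) Z (C \<otimes> C) C)) \<cdot> (\<one> (X \<otimes> Y \<otimes> Z) \<boxtimes> ((\<Delta> \<boxtimes> \<one> C) \<cdot> \<Delta>)))))"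
    by (simp add: comp_assoc)
  also have "\<alpha> (X \<otimes> C) (Y \<otimes> C) (Z \<otimes> C) \<cdot> ((\<tau> X Y C C \<boxtimes> \<one> (Z \<otimes> C)) \<cdot> \<tau> (X \<otimes> Y) Z (C \<otimes> C) C) = 
     (\<one> (X \<otimes> C) \<boxtimes> \<tau> Y Z C C) \<cdot> (\<tau> X (Y \<otimes> Z) C (C \<otimes> C) \<cdot> (\<alpha> X Y Z \<boxtimes> \<alpha> C C C))"
    by (rule interchange_assoc) simp_all
  also have "n \<cdot> ((\<one> B \<boxtimes> n) \<cdot> ((f \<boxtimes> (g \<boxtimes> h)) \<cdot> ((\<one> (X \<otimes> C) \<boxtimes> \<tau> Y Z C C) \<cdot> (\<tau> X (Y \<otimes> Z) C (C \<otimes> C) \<cdot> (\<alpha> X Y Z \<boxtimes> \<alpha> C C C)) \<cdot> (\<one> (X \<otimes> Y \<otimes> Z) \<boxtimes> ((\<Delta> \<boxtimes> \<one> C) \<cdot> \<Delta>))))) = ?w"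
    by (simp add: comp_assoc tens_comp comonoidD(4)[OF C])
  finally have L: "convolve n C \<Delta> (X \<otimes> Y) Z (convolve n C \<Delta> X Y f g) h = ?w" .
  have "convolve n C \<Delta> X (Y \<otimes> Z) f (convolve n C \<Delta> Y Z g h) \<cdot> (\<alpha> X Y Z \<boxtimes> \<one> C) =
     n \<cdot> ((\<one> B \<boxtimes> n) \<cdot> ((f \<boxtimes> (g \<boxtimes> h)) \<cdot> ((\<one> (X \<otimes> C) \<boxtimes> \<tau> Y Z C C) \<cdot> (((\<one> (X \<otimes> C) \<boxtimes> (\<one> (Y \<otimes> Z) \<boxtimes> \<Delta>)) \<cdot> \<tau> X (Y \<otimes> Z) C C) \<cdot> (\<alpha> X Y Z \<boxtimes> \<Delta>)))))"
    by (simp add: convolve_def merge)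
  also have "\<dots> = ?w" unfolding t2 by (simp add: comp_assoc tens_comp)
  finally show ?thesis using L by simp
qed

lemma convolve_unit_left:
  assumes g: "g \<in> hom V (Z \<otimes> C) B" and [simp]: "Z \<in> Ob V"
  shows "convolve n C \<Delta> I Z (\<theta> \<cdot> (\<epsilon> \<cdot> \<lambda>\<^sub>I C)) g = g \<cdot> (\<lambda>\<^sub>I Z \<boxtimes> \<one> C)"
proof -
  note [simp] = homD[OF g]
  have e: "\<epsilon> \<cdot> \<lambda>\<^sub>I C = \<lambda>\<^sub>I I \<cdot> (\<one> I \<boxtimes> \<epsilon>)" by (rule lunit_nat[symmetric]) simp_all
  have t: "(\<one> I \<boxtimes> \<epsilon> \<boxtimes> \<one> (Z \<otimes> C)) \<cdot> \<tau> I Z C C = \<tau> I Z I C \<cdot> (\<one> (I \<otimes> Z) \<boxtimes> (\<epsilon> \<boxtimes> \<one> C))"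
    using interchange_nat[of "\<one> I" "\<one> Z" \<epsilon> "\<one> C" I Z C C I Z I C] by simp
  have "convolve n C \<Delta> I Z (\<theta> \<cdot> (\<epsilon> \<cdot> \<lambda>\<^sub>I C)) g = 
    (n \<cdot> (\<theta> \<boxtimes> \<one> B)) \<cdot> ((\<one> I \<boxtimes> g) \<cdot> ((\<lambda>\<^sub>I I \<boxtimes> \<one> (Z \<otimes> C)) \<cdot> (((\<one> I \<boxtimes> \<epsilon> \<boxtimes> \<one> (Z \<otimes> C)) \<cdot> \<tau> I Z C C) \<cdot> (\<one> (I \<otimes> Z) \<boxtimes> \<Delta>))))"
    unfolding e by (simp add: convolve_def merge)
  also have "\<dots> = (\<lambda>\<^sub>I B \<cdot> (\<one> I \<boxtimes> g)) \<cdot> ((\<lambda>\<^sub>I I \<boxtimes> \<one> (Z \<otimes> C)) \<cdot> (\<tau> I Z I C \<cdot> (\<one> (I \<otimes> Z) \<boxtimes> ((\<epsilon> \<boxtimes> \<one> C) \<cdot> \<Delta>))))"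
    unfolding t monoidD(5)[OF B] by (simp add: comp_assoc tens_comp)
  also have "\<lambda>\<^sub>I B \<cdot> (\<one> I \<boxtimes> g) = g \<cdot> \<lambda>\<^sub>I (Z \<otimes> C)" by (rule lunit_nat) simp_all
  also have "g \<cdot> \<lambda>\<^sub>I (Z \<otimes> C) \<cdot> ((\<lambda>\<^sub>I I \<boxtimes> \<one> (Z \<otimes> C)) \<cdot> (\<tau> I Z I C \<cdot> (\<one> (I \<otimes> Z) \<boxtimes> ((\<epsilon> \<boxtimes> \<one> C) \<cdot> \<Delta>)))) =
      g \<cdot> ((\<lambda>\<^sub>I (Z \<otimes> C) \<cdot> ((\<lambda>\<^sub>I I \<boxtimes> \<one> (Z \<otimes> C)) \<cdot> \<tau> I Z I C)) \<cdot> (\<one> (I \<otimes> Z) \<boxtimes> ((\<epsilon> \<boxtimes> \<one> C) \<cdot> \<Delta>)))"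
    by (simp add: comp_assoc)
  also have "\<dots> = g \<cdot> (\<lambda>\<^sub>I Z \<boxtimes> \<one> C)"
    by (simp only: interchange_unit_left \<open>Z \<in> Ob V\<close> comonoidD(1)[OF C]) (simp add: tens_comp comonoidD(5)[OF C])
  finally show ?thesis .
qed

lemma convolve_unit_right:
  assumes g: "g \<in> hom V (Z \<otimes> C) B" and [simp]: "Z \<in> Ob V"
  shows "convolve n C \<Delta> Z I g (\<theta> \<cdot> (\<epsilon> \<cdot> \<lambda>\<^sub>I C)) = g \<cdot> (\<rho>\<^sub>I Z \<boxtimes> \<one> C)"
proof -
  note [simp] = homD[OF g]
  have e: "\<epsilon> \<cdot> \<lambda>\<^sub>I C = \<lambda>\<^sub>I I \<cdot> (\<one> I \<boxtimes> \<epsilon>)" by (rule lunit_nat[symmetric]) simp_all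
  have t: "(\<one> (Z \<otimes> C) \<boxtimes> (\<one> I \<boxtimes> \<epsilon>)) \<cdot> \<tau> Z I C C = \<tau> Z I C I \<cdot> (\<one> (Z \<otimes> I) \<boxtimes> (\<one> C \<boxtimes> \<epsilon>))"
    using interchange_nat[of "\<one> Z" "\<one> I" "\<one> C" \<epsilon> Z I C C Z I C I] by simp
  have "convolve n C \<Delta> Z I g (\<theta> \<cdot> (\<epsilon> \<cdot> \<lambda>\<^sub>I C)) = 
    (n \<cdot> (\<one> B \<boxtimes> \<theta>)) \<cdot> ((g \<boxtimes> \<one> I) \<cdot> ((\<one> (Z \<otimes> C) \<boxtimes> \<lambda>\<^sub>I I) \<cdot> (((\<one> (Z \<otimes> C) \<boxtimes> (\<one> I \<boxtimes> \<epsilon>)) \<cdot> \<tau> Z I C C) \<cdot> (\<one> (Z \<otimes> I) \<boxtimes> \<Delta>))))"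
    unfolding e by (simp add: convolve_def merge)
  also have "\<dots> = (\<rho>\<^sub>I B \<cdot> (g \<boxtimes> \<one> I)) \<cdot> ((\<one> (Z \<otimes> C) \<boxtimes> \<lambda>\<^sub>I I) \<cdot> (\<tau> Z I C I \<cdot> (\<one> (Z \<otimes> I) \<boxtimes> ((\<one> C \<boxtimes> \<epsilon>) \<cdot> \<Delta>))))"
    unfolding t monoidD(6)[OF B] by (simp add: comp_assoc tens_comp)
  also have "\<rho>\<^sub>I B \<cdot> (g \<boxtimes> \<one> I) = g \<cdot> \<rho>\<^sub>I (Z \<otimes> C)" by (rule runit_nat) simp_all
  also have "g \<cdot> \<rho>\<^sub>I (Z \<otimes> C) \<cdot> ((\<one> (Z \<otimes> C) \<boxtimes> \<lambda>\<^sub>I I) \<cdot> (\<tau> Z I C I \<cdot> (\<one> (Z \<otimes> I) \<boxtimes> ((\<one> C \<boxtimes> \<epsilon>) \<cdot> \<Delta>)))) =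
      g \<cdot> ((\<rho>\<^sub>I (Z \<otimes> C) \<cdot> ((\<one> (Z \<otimes> C) \<boxtimes> \<lambda>\<^sub>I I) \<cdot> \<tau> Z I C I)) \<cdot> (\<one> (Z \<otimes> I) \<boxtimes> ((\<one> C \<boxtimes> \<epsilon>) \<cdot> \<Delta>)))"
    by (simp add: comp_assoc)
  also have "\<dots> = g \<cdot> (\<rho>\<^sub>I Z \<boxtimes> \<one> C)"
    by (simp only: interchange_unit_right \<open>Z \<in> Ob V\<close> comonoidD(1)[OF C]) (simp add: tens_comp comonoidD(6)[OF C])
  finally show ?thesis .
qed

private abbreviation (input) "E \<equiv> IHom V C B"
private abbreviation (input) "ev \<equiv> Eval V C B"
private abbreviation (input) "cm \<equiv> convolution_mult V (C, \<Delta>, \<epsilon>) (B, n, \<theta>)"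
private abbreviation (input) "cu \<equiv> convolution_unit V (C, \<Delta>, \<epsilon>) (B, n, \<theta>)"

lemma ev_hom: "ev \<in> hom V (E \<otimes> C) B" by (simp add: hom_def)

lemma convolution_mult: "cm \<in> hom V (E \<otimes> E) E" "ev \<cdot> (cm \<boxtimes> \<one> C) = convolve n C \<Delta> E E ev ev"
proof -
  have "cm = transpose V (E \<otimes> E) C B (convolve n C \<Delta> E E ev ev)"
    by (simp add: convolution_mult_def convolve_def Let_def comp_assoc)
  then show "cm \<in> hom V (E \<otimes> E) E" "ev \<cdot> (cm \<boxtimes> \<one> C) = convolve n C \<Delta> E E ev ev"
    using transpose[of C B "E \<otimes> E" "convolve n C \<Delta> E E ev ev"] convolve_hom[OF _ _ ev_hom ev_hom] by simp_all
qed

lemma convolution_unit: "cu \<in> hom V I E" "ev \<cdot> (cu \<boxtimes> \<one> C) = \<theta> \<cdot> (\<epsilon> \<cdot> \<lambda>\<^sub>I C)"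
proof -
  have "cu = transpose V I C B (\<theta> \<cdot> (\<epsilon> \<cdot> \<lambda>\<^sub>I C))"
    by (simp add: convolution_unit_def comp_assoc)
  then show "cu \<in> hom V I E" "ev \<cdot> (cu \<boxtimes> \<one> C) = \<theta> \<cdot> (\<epsilon> \<cdot> \<lambda>\<^sub>I C)"
    using transpose[of C B I "\<theta> \<cdot> (\<epsilon> \<cdot> \<lambda>\<^sub>I C)"] by (simp_all add: hom_def)
qed

text \<open>Evaluation turns multiplication in the internal hom into \<open>convolve\<close>, so
  that equations in the internal hom become equations between arrows into \<open>B\<close>.\<close>

lemma ev_convolution_mult:
  assumes "f \<in> hom V X E" "g \<in> hom V Y E"
  shows "ev \<cdot> ((cm \<cdot> (f \<boxtimes> g)) \<boxtimes> \<one> C) = convolve n C \<Delta> X Y (ev \<cdot> (f \<boxtimes> \<one> C)) (ev \<cdot> (g \<boxtimes> \<one> C))"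
proof -
  note [simp] = homD[OF assms(1)] homD[OF assms(2)] homD[OF convolution_mult(1)]
  show ?thesis unfolding convolve_nat[OF ev_hom ev_hom assms]
    by (simp add: whisker comp_reduce[OF convolution_mult(2)])
qed

text \<open>Evaluation can be cancelled, and after evaluation the three monoid axioms are the
  associativity and unit laws of \<open>convolve\<close>.\<close>

lemma monoid_convolution: "is_monoid V (convolution V (C, \<Delta>, \<epsilon>) (B, n, \<theta>))"
proof -
  note [simp] = homD[OF convolution_mult(1)] homD[OF convolution_unit(1)]
  note id = id_hom[of E]
  have "cm \<cdot> (cm \<boxtimes> \<one> E) = cm \<cdot> (\<one> E \<boxtimes> cm) \<cdot> \<alpha> E E E"
  proof (rule eval_cancel[of C B])
    have "ev \<cdot> ((cm \<cdot> (cm \<boxtimes> \<one> E)) \<boxtimes> \<one> C) = convolve n C \<Delta> (E \<otimes> E) E (convolve n C \<Delta> E E ev ev) ev"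
      using ev_convolution_mult[OF convolution_mult(1) id] by (simp add: convolution_mult(2))
    also have "\<dots> = convolve n C \<Delta> E (E \<otimes> E) ev (convolve n C \<Delta> E E ev ev) \<cdot> (\<alpha> E E E \<boxtimes> \<one> C)"
      by (rule convolve_assoc[OF ev_hom ev_hom ev_hom]) simp_all
    also have "\<dots> = (ev \<cdot> ((cm \<cdot> (\<one> E \<boxtimes> cm)) \<boxtimes> \<one> C)) \<cdot> (\<alpha> E E E \<boxtimes> \<one> C)"
      using ev_convolution_mult[OF id convolution_mult(1)] by (simp add: convolution_mult(2))
    also have "\<dots> = ev \<cdot> ((cm \<cdot> (\<one> E \<boxtimes> cm) \<cdot> \<alpha> E E E) \<boxtimes> \<one> C)"
      by (simp add: whisker)
    finally show "ev \<cdot> ((cm \<cdot> (cm \<boxtimes> \<one> E)) \<boxtimes> \<one> C) = ev \<cdot> ((cm \<cdot> (\<one> E \<boxtimes> cm) \<cdot> \<alpha> E E E) \<boxtimes> \<one> C)" .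
  qed (auto simp: hom_def)
  moreover have "cm \<cdot> (cu \<boxtimes> \<one> E) = \<lambda>\<^sub>I E"
  proof (rule eval_cancel[of C B])
    show "ev \<cdot> ((cm \<cdot> (cu \<boxtimes> \<one> E)) \<boxtimes> \<one> C) = ev \<cdot> (\<lambda>\<^sub>I E \<boxtimes> \<one> C)"
      using ev_convolution_mult[OF convolution_unit(1) id] convolve_unit_left[OF ev_hom] by (simp add: convolution_unit(2))
  qed (auto simp: hom_def)
  moreover have "cm \<cdot> (\<one> E \<boxtimes> cu) = \<rho>\<^sub>I E"
  proof (rule eval_cancel[of C B])
    show "ev \<cdot> ((cm \<cdot> (\<one> E \<boxtimes> cu)) \<boxtimes> \<one> C) = ev \<cdot> (\<rho>\<^sub>I E \<boxtimes> \<one> C)"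
      using ev_convolution_mult[OF id convolution_unit(1)] convolve_unit_right[OF ev_hom] by (simp add: convolution_unit(2))
  qed (auto simp: hom_def)
  ultimately show ?thesis unfolding convolution_def is_monoid_def by (simp add: convolution_mult(1) convolution_unit(1))
qed

text \<open>Each equation for \<open>g\<close> is equivalent to its evaluated form because
  evaluation can be cancelled. Both directions matter, since the adjunction asks for a
  bijection.\<close>

lemma measuring_iff_monoid_hom:
  assumes A: "is_monoid V (A, m, \<eta>)" and g: "g \<in> hom V A E"
  shows "measuring (A, m, \<eta>) (B, n, \<theta>) (C, \<Delta>, \<epsilon>) (ev \<cdot> (g \<boxtimes> \<one> C)) \<longleftrightarrow>
    is_monoid_hom V (A, m, \<eta>) g (convolution V (C, \<Delta>, \<epsilon>) (B, n, \<theta>))"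
proof -
  note [simp] = homD[OF convolution_mult(1)] homD[OF convolution_unit(1)] monoidD(1-3)[OF A] homD[OF g]
  have "g \<cdot> m = cm \<cdot> (g \<boxtimes> g) \<longleftrightarrow> ev \<cdot> ((g \<cdot> m) \<boxtimes> \<one> C) = ev \<cdot> ((cm \<cdot> (g \<boxtimes> g)) \<boxtimes> \<one> C)"
    using eval_cancel[of C B "g \<cdot> m" "A \<otimes> A" "cm \<cdot> (g \<boxtimes> g)"] by (auto simp: hom_def)
  also have "\<dots> \<longleftrightarrow> (ev \<cdot> (g \<boxtimes> \<one> C)) \<cdot> (m \<boxtimes> \<one> C) = convolve n C \<Delta> A A (ev \<cdot> (g \<boxtimes> \<one> C)) (ev \<cdot> (g \<boxtimes> \<one> C))"
    unfolding ev_convolution_mult[OF g g] by (simp add: whisker)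
  finally have 1: "g \<cdot> m = cm \<cdot> (g \<boxtimes> g) \<longleftrightarrow> (ev \<cdot> (g \<boxtimes> \<one> C)) \<cdot> (m \<boxtimes> \<one> C) = convolve n C \<Delta> A A (ev \<cdot> (g \<boxtimes> \<one> C)) (ev \<cdot> (g \<boxtimes> \<one> C))" .
  have "g \<cdot> \<eta> = cu \<longleftrightarrow> ev \<cdot> ((g \<cdot> \<eta>) \<boxtimes> \<one> C) = ev \<cdot> (cu \<boxtimes> \<one> C)"
    using eval_cancel[of C B "g \<cdot> \<eta>" I cu] by (auto simp: hom_def)
  also have "\<dots> \<longleftrightarrow> (ev \<cdot> (g \<boxtimes> \<one> C)) \<cdot> (\<eta> \<boxtimes> \<one> C) = \<theta> \<cdot> (\<epsilon> \<cdot> \<lambda>\<^sub>I C)"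
    unfolding convolution_unit(2) by (simp add: whisker)
  finally show ?thesis using 1 g by (auto simp: measuring_def is_monoid_hom_def convolution_def hom_def)
qed

text \<open>Compatibility of \<open>f\<close> with the comultiplications moves it through the
  convolution, and compatibility with the counits moves it through the unit condition.\<close>

lemma measuring_comonoid_hom:
  assumes A: "is_monoid V (A, m, \<eta>)" and C': "is_comonoid V (C', \<Delta>', \<epsilon>')" 
    and f: "is_comonoid_hom V (C', \<Delta>', \<epsilon>') f (C, \<Delta>, \<epsilon>)"
    and t: "measuring (A, m, \<eta>) (B, n, \<theta>) (C, \<Delta>, \<epsilon>) t"
  shows "measuring (A, m, \<eta>) (B, n, \<theta>) (C', \<Delta>', \<epsilon>') (t \<cdot> (\<one> A \<boxtimes> f))"
proof -
  have f': "f \<in> Ar V \<and> Dom V f = C' \<and> Cod V f = C" "\<Delta> \<cdot> f = (f \<boxtimes> f) \<cdot> \<Delta>'" "\<epsilon> \<cdot> f = \<epsilon>'"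
    using f by (auto simp: is_comonoid_hom_def hom_def)
  have t': "t \<in> Ar V \<and> Dom V t = A \<otimes> C \<and> Cod V t = B" "t \<cdot> (m \<boxtimes> \<one> C) = convolve n C \<Delta> A A t t" "t \<cdot> (\<eta> \<boxtimes> \<one> C) = \<theta> \<cdot> (\<epsilon> \<cdot> \<lambda>\<^sub>I C)"
    using t by (auto simp: measuring_def hom_def)
  note [simp] = monoidD(1-3)[OF A] comonoidD(1-3)[OF C'] f'(1) t'(1)
  have "t \<cdot> (\<one> A \<boxtimes> f) \<cdot> (m \<boxtimes> \<one> C') = (t \<cdot> (m \<boxtimes> \<one> C)) \<cdot> (\<one> (A \<otimes> A) \<boxtimes> f)" by (simp add: merge)
  also have "\<dots> = convolve n C' \<Delta>' A A (t \<cdot> (\<one> A \<boxtimes> f)) (t \<cdot> (\<one> A \<boxtimes> f))"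
    unfolding t'(2) by (rule convolve_comonoid_hom[OF _ _ _ _ C' _ f'(2)]) (simp_all add: hom_def)
  finally have 1: "t \<cdot> (\<one> A \<boxtimes> f) \<cdot> (m \<boxtimes> \<one> C') = convolve n C' \<Delta>' A A (t \<cdot> (\<one> A \<boxtimes> f)) (t \<cdot> (\<one> A \<boxtimes> f))" .
  have "t \<cdot> (\<one> A \<boxtimes> f) \<cdot> (\<eta> \<boxtimes> \<one> C') = (t \<cdot> (\<eta> \<boxtimes> \<one> C)) \<cdot> (\<one> I \<boxtimes> f)" by (simp add: merge)
  also have "\<dots> = \<theta> \<cdot> (\<epsilon> \<cdot> (\<lambda>\<^sub>I C \<cdot> (\<one> I \<boxtimes> f)))" unfolding t'(3) by (simp add: comp_assoc)
  also have "\<lambda>\<^sub>I C \<cdot> (\<one> I \<boxtimes> f) = f \<cdot> \<lambda>\<^sub>I C'" by (rule lunit_nat) simp_all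
  also have "\<theta> \<cdot> (\<epsilon> \<cdot> (f \<cdot> \<lambda>\<^sub>I C')) = \<theta> \<cdot> (\<epsilon>' \<cdot> \<lambda>\<^sub>I C')" by (simp add: comp_reduce[OF f'(3)])
  finally show ?thesis using 1 by (auto simp: measuring_def hom_def)
qed

end

end

context smc_cat
begin

section \<open>Functoriality of the convolution monoid in the comonoid\<close>

lemma category_op_Mon: "category (op_cat (Mon V))"
  using category_Mon unfolding category_def by (simp add: op_cat_def hom_def)

lemma ihom_arr:
  assumes f: "f \<in> hom V C' C" and g: "g \<in> hom V B B'"
  shows "ihom_arr V f g \<in> hom V (IHom V C B) (IHom V C' B')" 
    "Eval V C' B' \<cdot> (ihom_arr V f g \<boxtimes> \<one> C') = g \<cdot> (Eval V C B \<cdot> (\<one> (IHom V C B) \<boxtimes> f))"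
proof -
  note [simp] = homD[OF f] homD[OF g]
  have [simp]: "C \<in> Ob V" "C' \<in> Ob V" "B \<in> Ob V" "B' \<in> Ob V" using dom_ob[of f] cod_ob[of f] dom_ob[of g] cod_ob[of g] by simp_all
  have "g \<cdot> (Eval V C B \<cdot> (\<one> (IHom V C B) \<boxtimes> f)) \<in> hom V (IHom V C B \<otimes> C') B'" by (simp add: hom_def)
  from transpose[OF _ _ _ this] show "ihom_arr V f g \<in> hom V (IHom V C B) (IHom V C' B')" 
    "Eval V C' B' \<cdot> (ihom_arr V f g \<boxtimes> \<one> C') = g \<cdot> (Eval V C B \<cdot> (\<one> (IHom V C B) \<boxtimes> f))"
    by (simp_all add: ihom_arr_def Let_def comp_assoc)
qed

text \<open>Evaluation is the transpose of the identity of \<open>[C, B]\<close>, which is a monoid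
  morphism.\<close>

lemma measuring_eval:
  assumes "is_monoid V (B, n, \<theta>)" "is_comonoid V (C, \<Delta>, \<epsilon>)"
  shows "measuring (convolution V (C, \<Delta>, \<epsilon>) (B, n, \<theta>)) (B, n, \<theta>) (C, \<Delta>, \<epsilon>) (Eval V C B)"
proof -
  let ?M = "convolution V (C, \<Delta>, \<epsilon>) (B, n, \<theta>)"
  have M: "is_monoid V ?M" by (rule monoid_convolution[OF assms])
  obtain m e where t: "?M = (IHom V C B, m, e)" by (auto simp: convolution_def)
  note [simp] = monoidD(1)[OF assms(1)] comonoidD(1)[OF assms(2)]
  have "measuring ?M (B, n, \<theta>) (C, \<Delta>, \<epsilon>) (Eval V C B \<cdot> (\<one> (IHom V C B) \<boxtimes> \<one> C))"
    unfolding t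
  proof (subst measuring_iff_monoid_hom[OF assms])
    show "is_monoid V (IHom V C B, m, e)" using M t by simp
    show "\<one> (IHom V C B) \<in> hom V (IHom V C B) (IHom V C B)" by (simp add: hom_def)
    show "is_monoid_hom V (IHom V C B, m, e) (\<one> (IHom V C B)) (convolution V (C, \<Delta>, \<epsilon>) (B, n, \<theta>))"
      using monoid_hom_id[OF M] by (simp add: t)
  qed
  then show ?thesis by simp
qed

text \<open>The transpose of \<open>ihom_arr V f (\<one> B)\<close> is evaluation precomposed with
  \<open>f\<close>. Evaluation is a measuring and precomposition with a comonoid morphism keeps it
  one, so no computation with the convolution product is repeated.\<close>

lemma monoid_hom_ihom:
  assumes B: "is_monoid V (B, n, \<theta>)" and C: "is_comonoid V (C, \<Delta>, \<epsilon>)" and C': "is_comonoid V (C', \<Delta>', \<epsilon>')"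
    and f: "is_comonoid_hom V (C', \<Delta>', \<epsilon>') f (C, \<Delta>, \<epsilon>)"
  shows "is_monoid_hom V (convolution V (C, \<Delta>, \<epsilon>) (B, n, \<theta>)) (ihom_arr V f (\<one> B)) (convolution V (C', \<Delta>', \<epsilon>') (B, n, \<theta>))"
proof -
  let ?M = "convolution V (C, \<Delta>, \<epsilon>) (B, n, \<theta>)"
  have M: "is_monoid V ?M" by (rule monoid_convolution[OF B C])
  obtain m e where t: "?M = (IHom V C B, m, e)" by (auto simp: convolution_def)
  note [simp] = monoidD(1)[OF B] comonoidD(1)[OF C]
  have f': "f \<in> hom V C' C" using f by (simp add: is_comonoid_hom_def)
  note i = ihom_arr[OF f' id_hom[OF monoidD(1)[OF B]]]
  have "measuring (IHom V C B, m, e) (B, n, \<theta>) (C', \<Delta>', \<epsilon>') (Eval V C B \<cdot> (\<one> (IHom V C B) \<boxtimes> f))"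
    using measuring_comonoid_hom[OF B C _ C' f, of "IHom V C B" m e] measuring_eval[OF B C] M by (simp add: t)
  then have "measuring (IHom V C B, m, e) (B, n, \<theta>) (C', \<Delta>', \<epsilon>') (Eval V C' B \<cdot> (ihom_arr V f (\<one> B) \<boxtimes> \<one> C'))"
    unfolding i(2) using homD[OF f'] by simp
  then show ?thesis
    using measuring_iff_monoid_hom[OF B C' M[unfolded t] i(1)] by (simp add: t)
qed

lemma ihom_arr_id:
  assumes [simp]: "C \<in> Ob V" "B \<in> Ob V" shows "ihom_arr V (\<one> C) (\<one> B) = \<one> (IHom V C B)"
  by (rule eval_cancel[OF assms]) (use ihom_arr[OF id_hom id_hom, of C B] id_hom[of "IHom V C B"] in simp_all)

lemma ihom_arr_comp:
  assumes f: "f \<in> hom V C' C" and g: "g \<in> hom V C'' C'" and [simp]: "B \<in> Ob V"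
  shows "ihom_arr V (f \<cdot> g) (\<one> B) = ihom_arr V g (\<one> B) \<cdot> ihom_arr V f (\<one> B)"
proof -
  note [simp] = homD[OF f] homD[OF g]
  have [simp]: "C \<in> Ob V" "C' \<in> Ob V" "C'' \<in> Ob V" using dom_ob[of f] cod_ob[of f] dom_ob[of g] by simp_all
  have fg: "f \<cdot> g \<in> hom V C'' C" by (simp add: hom_def)
  note F = ihom_arr[OF f id_hom[OF assms(3)]] and G = ihom_arr[OF g id_hom[OF assms(3)]] and H = ihom_arr[OF fg id_hom[OF assms(3)]]
  note [simp] = homD[OF F(1)] homD[OF G(1)] homD[OF H(1)]
  show ?thesis
  proof (rule eval_cancel[of C'' B])
    have "Eval V C'' B \<cdot> ((ihom_arr V g (\<one> B) \<cdot> ihom_arr V f (\<one> B)) \<boxtimes> \<one> C'') = Eval V C' B \<cdot> ((\<one> (IHom V C' B) \<boxtimes> g) \<cdot> (ihom_arr V f (\<one> B) \<boxtimes> \<one> C''))"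
      by (simp add: whisker comp_reduce[OF G(2)])
    also have "\<dots> = (Eval V C' B \<cdot> (ihom_arr V f (\<one> B) \<boxtimes> \<one> C')) \<cdot> (\<one> (IHom V C B) \<boxtimes> g)" by (simp add: merge)
    also have "\<dots> = Eval V C B \<cdot> (\<one> (IHom V C B) \<boxtimes> (f \<cdot> g))" by (simp add: F(2) merge)
    finally show "Eval V C'' B \<cdot> (ihom_arr V (f \<cdot> g) (\<one> B) \<boxtimes> \<one> C'') = Eval V C'' B \<cdot> ((ihom_arr V g (\<one> B) \<cdot> ihom_arr V f (\<one> B)) \<boxtimes> \<one> C'')"
      by (simp add: H(2))
  qed (auto simp: hom_def)
qed

lemma H_fix_simps:
  "ObMap (H_fix V B) C = convolution V C B"
  "ArMap (H_fix V B) (C', f, C) = (convolution V C B, ihom_arr V f (\<one> (fst B)), convolution V C' B)"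
  by (simp_all add: H_fix_def H_func_def Mon_def)

lemma functor_H_fix:
  assumes B: "is_monoid V B"
  shows "is_functor (Comon V) (op_cat (Mon V)) (op_func (H_fix V B))"
proof -
  obtain b n \<theta> where b: "B = (b, n, \<theta>)" by (cases B)
  have [simp]: "b \<in> Ob V" using B b monoidD(1) by simp
  have M: "is_monoid V (convolution V C B)" if "is_comonoid V C" for C
    using monoid_convolution[of b n \<theta> "fst C" "fst (snd C)" "snd (snd C)"] that B by (simp add: b)
  have H: "is_monoid_hom V (convolution V C B) (ihom_arr V f (\<one> b)) (convolution V C' B)" 
    if "is_comonoid V C" "is_comonoid V C'" "is_comonoid_hom V C' f C" for C C' f
    using monoid_hom_ihom[of b n \<theta> "fst C" "fst (snd C)" "snd (snd C)" "fst C'" "fst (snd C')" "snd (snd C')" f] that B by (simp add: b)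
  have I: "ihom_arr V (\<one> (fst C)) (\<one> b) = \<one> (IHom V (fst C) b)" if "is_comonoid V C" for C
    using that by (cases C) (auto simp: ihom_arr_id is_comonoid_def)
  have K: "ihom_arr V (f \<cdot> g) (\<one> b) = ihom_arr V g (\<one> b) \<cdot> ihom_arr V f (\<one> b)" 
    if "is_comonoid_hom V C' f C" "is_comonoid_hom V C'' g C'" for f g C C' C''
    using that by (cases C; cases C'; cases C'') (auto simp: is_comonoid_hom_def intro!: ihom_arr_comp)
  show ?thesis unfolding is_functor_def op_func_def
  proof (intro conjI ballI impI category_Comon category_op_Mon)
    fix C assume "C \<in> Ob (Comon V)"
    then have C: "is_comonoid V C" by (simp add: Comon_def)
    show "ObMap (H_fix V B) C \<in> Ob (op_cat (Mon V))" using M[OF C] by (simp add: H_fix_simps op_cat_def Mon_def)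
    show "ArMap (H_fix V B) (Ident (Comon V) C) = Ident (op_cat (Mon V)) (ObMap (H_fix V B) C)"
      using I[OF C] by (simp add: Comon_def H_fix_simps op_cat_def Mon_def b) (simp add: convolution_def)
  next
    fix f assume "f \<in> Ar (Comon V)"
    then obtain C' g C where f: "f = (C', g, C)" "is_comonoid V C'" "is_comonoid V C" "is_comonoid_hom V C' g C"
      by (auto simp: Comon_def)
    show "ArMap (H_fix V B) f \<in> hom (op_cat (Mon V)) (ObMap (H_fix V B) (Dom (Comon V) f)) (ObMap (H_fix V B) (Cod (Comon V) f))"
      using M H f by (simp add: Comon_def H_fix_simps op_cat_def Mon_def hom_def b)
  next
    fix f g assume "f \<in> Ar (Comon V)" "g \<in> Ar (Comon V)" and d: "Dom (Comon V) g = Cod (Comon V) f"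
    then obtain C1 u C2 v C3 where fg: "f = (C1, u, C2)" "g = (C2, v, C3)" 
      "is_comonoid_hom V C1 u C2" "is_comonoid_hom V C2 v C3"
      by (auto simp: Comon_def)
    show "ArMap (H_fix V B) (g \<cdot>\<^bsub>Comon V\<^esub> f) = ArMap (H_fix V B) g \<cdot>\<^bsub>op_cat (Mon V)\<^esub> ArMap (H_fix V B) f"
      using K[OF fg(4,3)] by (simp add: fg Comon_def H_fix_simps op_cat_def Mon_def b)
  qed
qed

section \<open>Filtered colimits and tensor products\<close>

definition tensor_diagram :: "('i, 'b, 'o, 'a) func \<Rightarrow> ('i, 'b, 'o, 'a) func \<Rightarrow> ('i, 'b, 'o, 'a) func" where
  "tensor_diagram F G = \<lparr>ObMap = (\<lambda>j. ObMap F j \<otimes> ObMap G j), ArMap = (\<lambda>u. ArMap F u \<boxtimes> ArMap G u)\<rparr>"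

lemma tensor_diagram_simps [simp]:
  "ObMap (tensor_diagram F G) j = ObMap F j \<otimes> ObMap G j"
  "ArMap (tensor_diagram F G) u = ArMap F u \<boxtimes> ArMap G u"
  by (simp_all add: tensor_diagram_def)

lemma functor_tensor_diagram:
  "is_functor J V F \<Longrightarrow> is_functor J V G \<Longrightarrow> is_functor J V (tensor_diagram F G)"
  unfolding is_functor_def by (auto simp: hom_def tens_comp category_def)

text \<open>Tensoring in both variables gives a colimit over pairs of indices, and for a filtered
  \<open>J\<close> the diagonal is cofinal among the pairs. The cofinality argument is carried out
  by hand: a cocone on the diagonal is extended to all pairs and then descended in one variable
  after the other.\<close>

lemma filtered_tensor_colimit:
  assumes J: "filtered_category J \<mu>" and F: "is_functor J V F" and G: "is_functor J V G"
    and X: "is_colimit V J F X c" and Y: "is_colimit V J G Y d"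
  shows "is_colimit V J (tensor_diagram F G) (X \<otimes> Y) (\<lambda>j. c j \<boxtimes> d j)"
proof -
  interpret J: filtered_category J \<mu> by (rule J)
  have FG: "is_functor J V (tensor_diagram F G)" by (rule functor_tensor_diagram[OF F G])
  have XY [simp]: "X \<in> Ob V" "Y \<in> Ob V" using X Y by (auto simp: is_colimit_def is_cocone_def)
  note gX = X[unfolded colimit_iff_graph_colimit[OF category F]]
  note gY = Y[unfolded colimit_iff_graph_colimit[OF category G]]
  have Fob: "ObMap F i \<in> Ob V" and Gob: "ObMap G i \<in> Ob V" if "i \<in> Ob J" for i
    using F G that by (auto simp: is_functor_def)
  have Far: "ArMap F u \<in> hom V (ObMap F i) (ObMap F k)" and Gar: "ArMap G u \<in> hom V (ObMap G i) (ObMap G k)"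
    if "u \<in> hom J i k" for u i k
    using F G that by (auto simp: is_functor_def hom_def)
  have Fcomp: "ArMap F (v \<cdot>\<^bsub>J\<^esub> u) = ArMap F v \<cdot> ArMap F u" and Gcomp: "ArMap G (v \<cdot>\<^bsub>J\<^esub> u) = ArMap G v \<cdot> ArMap G u"
    if "u \<in> hom J i k" "v \<in> hom J k l" for u v i k l
    using F G that by (auto simp: is_functor_def hom_def)
  have c: "c i \<in> hom V (ObMap F i) X" and d: "d i \<in> hom V (ObMap G i) Y" if "i \<in> Ob J" for i
    using X Y that by (auto simp: is_colimit_def is_cocone_def)
  have cu: "c k \<cdot> ArMap F u = c i" and du: "d k \<cdot> ArMap G u = d i" if "u \<in> hom J i k" for u i k
    using X Y that by (auto simp: is_colimit_def is_cocone_def hom_def)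
  have ob: "i \<in> Ob J" "k \<in> Ob J" if "u \<in> hom J i k" for u i k
    using that by (auto simp: hom_def)
  have split: "(c k \<boxtimes> d k) \<cdot> (ArMap F u \<boxtimes> ArMap G v) = c i \<boxtimes> d i'" if "u \<in> hom J i k" "v \<in> hom J i' k" for u v i i' k
    using cu[OF that(1)] du[OF that(2)] homD[OF Far[OF that(1)]] homD[OF Gar[OF that(2)]] homD[OF c[OF ob(2)[OF that(1)]]] homD[OF d[OF ob(2)[OF that(1)]]]
    by (simp add: tens_comp)
  have cocone: "graph_cocone V (Ob J) (ObMap (tensor_diagram F G)) (functor_edges J (tensor_diagram F G)) (X \<otimes> Y) (\<lambda>j. c j \<boxtimes> d j)"
    unfolding graph_cocone_def
  proof (intro conjI ballI)
    fix x assume "x \<in> functor_edges J (tensor_diagram F G)"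
    then obtain u where u: "u \<in> Ar J" "x = (Dom J u, ArMap F u \<boxtimes> ArMap G u, Cod J u)" by (auto simp: functor_edges_def)
    have "u \<in> hom J (Dom J u) (Cod J u)" using u by (simp add: hom_def)
    then show "case x of (i, u, j) \<Rightarrow> (c j \<boxtimes> d j) \<cdot> u = c i \<boxtimes> d i"
      using split by (simp add: u)
  qed (use c d in \<open>auto intro!: tens_hom\<close>)
  have epi: "jointly_epi V (Ob J) (X \<otimes> Y) (\<lambda>j. c j \<boxtimes> d j)"
    unfolding jointly_epi_def
  proof (intro allI ballI impI)
    fix Z f g assume f: "f \<in> hom V (X \<otimes> Y) Z" and g: "g \<in> hom V (X \<otimes> Y) Z" and e: "\<forall>j\<in>Ob J. f \<cdot> (c j \<boxtimes> d j) = g \<cdot> (c j \<boxtimes> d j)"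
    show "f = g"
    proof (rule jointly_epiD[OF jointly_epi_tensor[OF graph_colimit_epi[OF gX] c graph_colimit_epi[OF gY] d] f g])
      fix x assume "x \<in> Ob J \<times> Ob J"
      then obtain i k where x: "x = (i, k)" "i \<in> Ob J" "k \<in> Ob J" by blast
      obtain l u v where uv: "u \<in> hom J i l" "v \<in> hom J k l" using J.filtered_upper[OF x(2,3)] .
      have "l \<in> Ob J" using ob(2)[OF uv(1)] .
      note [simp] = homD[OF f] homD[OF g] homD[OF c[OF this]] homD[OF d[OF this]] homD[OF Far[OF uv(1)]] homD[OF Gar[OF uv(2)]]
      show "f \<cdot> (case x of (i, j) \<Rightarrow> c i \<boxtimes> d j) = g \<cdot> (case x of (i, j) \<Rightarrow> c i \<boxtimes> d j)"
        using bspec[OF e \<open>l \<in> Ob J\<close>] by (simp add: x split[OF uv, symmetric] flip: comp_assoc)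
    qed simp_all
  qed
  have desc: "\<exists>h\<in>hom V (X \<otimes> Y) Z. \<forall>j\<in>Ob J. h \<cdot> (c j \<boxtimes> d j) = e j" 
    if cc: "graph_cocone V (Ob J) (ObMap (tensor_diagram F G)) (functor_edges J (tensor_diagram F G)) Z e" for Z e
  proof -
    have Z [simp]: "Z \<in> Ob V" using cc by (simp add: graph_cocone_def)
    have e: "e j \<in> hom V (ObMap F j \<otimes> ObMap G j) Z" if "j \<in> Ob J" for j 
      using cc that by (simp add: graph_cocone_def)
    have eu: "e k \<cdot> (ArMap F u \<boxtimes> ArMap G u) = e i" if "u \<in> hom J i k" for u i k
    proof -
      have "(i, ArMap F u \<boxtimes> ArMap G u, k) \<in> functor_edges J (tensor_diagram F G)"
        using that by (force simp: functor_edges_def hom_def)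
      then show ?thesis using cc by (auto simp: graph_cocone_def)
    qed
    have push: "e l \<cdot> (ArMap F u \<boxtimes> ArMap G v) = e q \<cdot> (ArMap F (w \<cdot>\<^bsub>J\<^esub> u) \<boxtimes> ArMap G (w \<cdot>\<^bsub>J\<^esub> v))"
      if "u \<in> hom J i l" "v \<in> hom J k l" "w \<in> hom J l q" for i k l q u v w
    proof -
      note [simp] = homD[OF Far[OF that(1)]] homD[OF Gar[OF that(2)]] homD[OF Far[OF that(3)]] homD[OF Gar[OF that(3)]] 
        homD[OF e[OF ob(2)[OF that(3)]]]
      show ?thesis unfolding eu[OF that(3), symmetric] Fcomp[OF that(1,3)] Gcomp[OF that(2,3)]
        by (simp add: merge)
    qed
    \<comment> \<open>Two ways of bringing a pair \<open>(i, k)\<close> to the diagonal are compared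
      in two stages: a span makes the arrows from \<open>i\<close> agree, and a coequalizing arrow
      then makes the arrows from \<open>k\<close> agree without disturbing the first.\<close>
    have wd: "e l \<cdot> (ArMap F u \<boxtimes> ArMap G v) = e l' \<cdot> (ArMap F u' \<boxtimes> ArMap G v')"
      if uv: "u \<in> hom J i l" "v \<in> hom J k l" "u' \<in> hom J i l'" "v' \<in> hom J k l'" for i k l l' u v u' v'
    proof -
      obtain q p p' where p: "p \<in> hom J l q" "p' \<in> hom J l' q" "p \<cdot>\<^bsub>J\<^esub> u = p' \<cdot>\<^bsub>J\<^esub> u'"
        using J.filtered_span[OF uv(1,3)] .
      note pv = J.comp_hom[OF uv(2) p(1)] J.comp_hom[OF uv(4) p(2)]
      obtain r w where w: "w \<in> hom J q r" "w \<cdot>\<^bsub>J\<^esub> (p \<cdot>\<^bsub>J\<^esub> v) = w \<cdot>\<^bsub>J\<^esub> (p' \<cdot>\<^bsub>J\<^esub> v')"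
        using J.filtered_coequalize[OF pv] .
      have "e l \<cdot> (ArMap F u \<boxtimes> ArMap G v) = e q \<cdot> (ArMap F (p \<cdot>\<^bsub>J\<^esub> u) \<boxtimes> ArMap G (p \<cdot>\<^bsub>J\<^esub> v))"
        by (rule push[OF uv(1,2) p(1)])
      also have "\<dots> = e r \<cdot> (ArMap F (w \<cdot>\<^bsub>J\<^esub> (p \<cdot>\<^bsub>J\<^esub> u)) \<boxtimes> ArMap G (w \<cdot>\<^bsub>J\<^esub> (p \<cdot>\<^bsub>J\<^esub> v)))"
        by (rule push[OF J.comp_hom[OF uv(1) p(1)] pv(1) w(1)])
      also have "\<dots> = e q \<cdot> (ArMap F (p' \<cdot>\<^bsub>J\<^esub> u') \<boxtimes> ArMap G (p' \<cdot>\<^bsub>J\<^esub> v'))"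
        unfolding w(2) p(3) by (rule push[OF J.comp_hom[OF uv(3) p(2)] pv(2) w(1), symmetric])
      also have "\<dots> = e l' \<cdot> (ArMap F u' \<boxtimes> ArMap G v')"
        by (rule push[OF uv(3,4) p(2), symmetric])
      finally show ?thesis .
    qed
    have "\<exists>b. \<forall>l u v. u \<in> hom J i l \<longrightarrow> v \<in> hom J k l \<longrightarrow> e l \<cdot> (ArMap F u \<boxtimes> ArMap G v) = b" if ik: "i \<in> Ob J" "k \<in> Ob J" for i k
    proof -
      obtain l u v where uv: "u \<in> hom J i l" "v \<in> hom J k l" using J.filtered_upper[OF ik] .
      show ?thesis using wd[OF _ _ uv] by blast
    qed
    \<comment> \<open>The family \<open>b\<close> extends the cocone from the diagonal to all pairs
      of indices. It does not depend on the chosen upper bound, and \<open>b2\<close> shows that it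
      is natural in both indices.\<close>
    then obtain b where b: "e l \<cdot> (ArMap F u \<boxtimes> ArMap G v) = b i k" 
      if "i \<in> Ob J" "k \<in> Ob J" "u \<in> hom J i l" "v \<in> hom J k l" for i k l u v by metis
    have bh: "b i k \<in> hom V (ObMap F i \<otimes> ObMap G k) Z" if ik: "i \<in> Ob J" "k \<in> Ob J" for i k
    proof -
      obtain l u v where uv: "u \<in> hom J i l" "v \<in> hom J k l" using J.filtered_upper[OF ik] .
      note [simp] = homD[OF Far[OF uv(1)]] homD[OF Gar[OF uv(2)]] homD[OF e[OF ob(2)[OF uv(1)]]]
      show ?thesis unfolding b[OF that uv, symmetric] by (simp add: hom_def)
    qed
    have b2: "b i k \<cdot> (ArMap F u \<boxtimes> ArMap G v) = b i' k'" if "u \<in> hom J i' i" "v \<in> hom J k' k" for i i' k k' u v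
    proof -
      note o = ob[OF that(1)] ob[OF that(2)]
      obtain l x y where xy: "x \<in> hom J i l" "y \<in> hom J k l" using J.filtered_upper[OF o(2,4)] .
      note [simp] = homD[OF Far[OF xy(1)]] homD[OF Gar[OF xy(2)]] homD[OF e[OF ob(2)[OF xy(1)]]] homD[OF Far[OF that(1)]] homD[OF Gar[OF that(2)]]
      have "b i' k' = e l \<cdot> (ArMap F (x \<cdot>\<^bsub>J\<^esub> u) \<boxtimes> ArMap G (y \<cdot>\<^bsub>J\<^esub> v))"
        by (rule b[OF o(1,3) J.comp_hom[OF that(1) xy(1)] J.comp_hom[OF that(2) xy(2)], symmetric])
      also have "\<dots> = b i k \<cdot> (ArMap F u \<boxtimes> ArMap G v)"
        unfolding Fcomp[OF that(1) xy(1)] Gcomp[OF that(2) xy(2)] b[OF o(2,4) xy, symmetric] by (simp add: merge)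
      finally show ?thesis ..
    qed
    have Fid: "ArMap F (Ident J i) = \<one> (ObMap F i)" and Gid: "ArMap G (Ident J i) = \<one> (ObMap G i)" if "i \<in> Ob J" for i
      using F G that by (auto simp: is_functor_def)
    \<comment> \<open>For fixed \<open>i\<close> the second variable is descended to
      \<open>Y\<close>. By uniqueness the resulting arrows are natural in \<open>i\<close>, which
      permits descending the first variable to \<open>X\<close>.\<close>
    have "\<exists>h. h \<in> hom V (ObMap F i \<otimes> Y) Z \<and> (\<forall>k\<in>Ob J. h \<cdot> (\<one> (ObMap F i) \<boxtimes> d k) = b i k)" if i: "i \<in> Ob J" for i
    proof (rule colimit_tensor_left_desc[OF gY functor_graph[OF G] Fob[OF i] Z, of "b i"])
      fix j u k assume "(j, u, k) \<in> functor_edges J G"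
      then obtain v where "v \<in> hom J j k" "u = ArMap G v" by (auto simp: functor_edges_def hom_def)
      then show "b i k \<cdot> (\<one> (ObMap F i) \<boxtimes> u) = b i j"
        using b2[OF J.id_hom[OF i], of v j k] by (simp add: Fid[OF i])
    qed (use bh i in blast)+
    then have "\<forall>i\<in>Ob J. \<exists>h. h \<in> hom V (ObMap F i \<otimes> Y) Z \<and> (\<forall>k\<in>Ob J. h \<cdot> (\<one> (ObMap F i) \<boxtimes> d k) = b i k)" by blast
    from bchoice[OF this] obtain h where 
      h0: "\<forall>i\<in>Ob J. h i \<in> hom V (ObMap F i \<otimes> Y) Z \<and> (\<forall>k\<in>Ob J. h i \<cdot> (\<one> (ObMap F i) \<boxtimes> d k) = b i k)" by blast
    then have h: "h i \<in> hom V (ObMap F i \<otimes> Y) Z" "\<And>k. k \<in> Ob J \<Longrightarrow> h i \<cdot> (\<one> (ObMap F i) \<boxtimes> d k) = b i k" 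
      if "i \<in> Ob J" for i using that by auto
    have hu: "h k \<cdot> (ArMap F v \<boxtimes> \<one> Y) = h i" if v: "v \<in> hom J i k" for v i k
    proof -
      note o = ob[OF v]
      note [simp] = homD[OF h(1)[OF o(1)]] homD[OF h(1)[OF o(2)]] homD[OF Far[OF v]] Fob[OF o(1)] Fob[OF o(2)]
      show ?thesis
      proof (rule jointly_epiD[OF jointly_epi_tensor_left[OF graph_colimit_epi[OF gY] d, of "ObMap F i"]])
        fix j assume j: "j \<in> Ob J"
        note [simp] = homD[OF d[OF j]] Gob[OF j]
        have "h k \<cdot> (ArMap F v \<boxtimes> \<one> Y) \<cdot> (\<one> (ObMap F i) \<boxtimes> d j) = (h k \<cdot> (\<one> (ObMap F k) \<boxtimes> d j)) \<cdot> (ArMap F v \<boxtimes> \<one> (ObMap G j))"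
          by (simp add: merge)
        also have "\<dots> = b i j" using h(2)[OF o(2) j] b2[OF v J.id_hom[OF j]] by (simp add: Gid[OF j])
        finally show "h k \<cdot> (ArMap F v \<boxtimes> \<one> Y) \<cdot> (\<one> (ObMap F i) \<boxtimes> d j) = h i \<cdot> (\<one> (ObMap F i) \<boxtimes> d j)"
          using h(2)[OF o(1) j] by simp
      qed (auto simp: hom_def)
    qed
    have "\<exists>k. k \<in> hom V (X \<otimes> Y) Z \<and> (\<forall>i\<in>Ob J. k \<cdot> (c i \<boxtimes> \<one> Y) = h i)"
    proof (rule colimit_tensor_right_desc[OF gX functor_graph[OF F] XY(2) Z, of h])
      fix j u k assume "(j, u, k) \<in> functor_edges J F"
      then obtain v where "v \<in> hom J j k" "u = ArMap F v" by (auto simp: functor_edges_def hom_def)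
      then show "h k \<cdot> (u \<boxtimes> \<one> Y) = h j" using hu by simp
    qed (use h(1) in blast)+
    then obtain k where k: "k \<in> hom V (X \<otimes> Y) Z" "\<And>i. i \<in> Ob J \<Longrightarrow> k \<cdot> (c i \<boxtimes> \<one> Y) = h i" by blast
    have "k \<cdot> (c j \<boxtimes> d j) = e j" if j: "j \<in> Ob J" for j
    proof -
      note [simp] = homD[OF k(1)] homD[OF c[OF j]] homD[OF d[OF j]] Fob[OF j] Gob[OF j] homD[OF e[OF j]]
      have "k \<cdot> (c j \<boxtimes> d j) = (k \<cdot> (c j \<boxtimes> \<one> Y)) \<cdot> (\<one> (ObMap F j) \<boxtimes> d j)" by (simp add: merge)
      also have "\<dots> = b j j" using k(2)[OF j] h(2)[OF j j] by simp
      also have "\<dots> = e j" using b[OF j j J.id_hom[OF j] J.id_hom[OF j]] by (simp add: Fid[OF j] Gid[OF j])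
      finally show ?thesis .
    qed
    then show ?thesis using k(1) by blast
  qed
  show ?thesis unfolding colimit_iff_graph_colimit[OF category FG] graph_colimit_def
    by (intro conjI allI impI cocone epi desc)
qed

end

section \<open>The category of measurings\<close>

locale measurings = smc_cat V for V :: "('o, 'a, 'z) smc_category_scheme" (structure) +
  fixes A :: 'o and m \<eta> :: 'a and B :: 'o and n \<theta> :: 'a
  assumes monoid_A: "is_monoid V (A, m, \<eta>)" and monoid_B: "is_monoid V (B, n, \<theta>)"
begin

definition meas :: "'o \<times> 'a \<times> 'a \<times> 'a \<Rightarrow> bool" where
  "meas = (\<lambda>(C, \<Delta>, \<epsilon>, t). is_comonoid V (C, \<Delta>, \<epsilon>) \<and> measuring (A, m, \<eta>) (B, n, \<theta>) (C, \<Delta>, \<epsilon>) t)"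

definition mhom :: "'o \<times> 'a \<times> 'a \<times> 'a \<Rightarrow> 'a \<Rightarrow> 'o \<times> 'a \<times> 'a \<times> 'a \<Rightarrow> bool" where
  "mhom = (\<lambda>(C, \<Delta>, \<epsilon>, t) f (C', \<Delta>', \<epsilon>', t').
     is_comonoid_hom V (C, \<Delta>, \<epsilon>) f (C', \<Delta>', \<epsilon>') \<and> t' \<cdot> (\<one> A \<boxtimes> f) = t)"

lemmas [simp] = monoidD(1-3)[OF monoid_A] monoidD(1-3)[OF monoid_B]

lemma measD:
  assumes "meas (C, \<Delta>, \<epsilon>, t)"
  shows "is_comonoid V (C, \<Delta>, \<epsilon>)" "t \<in> Ar V \<and> Dom V t = A \<otimes> C \<and> Cod V t = B"
    "t \<cdot> (m \<boxtimes> \<one> C) = convolve n C \<Delta> A A t t" "t \<cdot> (\<eta> \<boxtimes> \<one> C) = \<theta> \<cdot> (\<epsilon> \<cdot> \<lambda>\<^sub>I C)"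
    "measuring (A, m, \<eta>) (B, n, \<theta>) (C, \<Delta>, \<epsilon>) t"
  using assms by (auto simp: meas_def measuring_def hom_def)

lemma mhomD:
  assumes "mhom (C, \<Delta>, \<epsilon>, t) f (C', \<Delta>', \<epsilon>', t')"
  shows "f \<in> Ar V \<and> Dom V f = C \<and> Cod V f = C'" "\<Delta>' \<cdot> f = (f \<boxtimes> f) \<cdot> \<Delta>" "\<epsilon>' \<cdot> f = \<epsilon>" "t' \<cdot> (\<one> A \<boxtimes> f) = t"
  using assms by (auto simp: mhom_def is_comonoid_hom_def hom_def)

lemma mhomI:
  assumes "f \<in> Ar V" "Dom V f = C" "Cod V f = C'" "\<Delta>' \<cdot> f = (f \<boxtimes> f) \<cdot> \<Delta>" "\<epsilon>' \<cdot> f = \<epsilon>" "t' \<cdot> (\<one> A \<boxtimes> f) = t"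
  shows "mhom (C, \<Delta>, \<epsilon>, t) f (C', \<Delta>', \<epsilon>', t')"
  using assms by (auto simp: mhom_def is_comonoid_hom_def hom_def)

lemma meas_ob: "meas X \<Longrightarrow> fst X \<in> Ob V"
  by (cases X) (auto dest: measD(1) comonoidD(1))

lemma mhom_hom: "mhom X f Y \<Longrightarrow> f \<in> hom V (fst X) (fst Y)"
  by (cases X; cases Y) (auto simp: hom_def dest: mhomD(1))

lemma mhom_comp:
  assumes X: "meas X" and Y: "meas Y" and Z: "meas Z" and f: "mhom X f Y" and g: "mhom Y g Z" shows "mhom X (g \<cdot> f) Z"
proof -
  obtain C \<Delta> \<epsilon> t C' \<Delta>' \<epsilon>' t' C'' \<Delta>'' \<epsilon>'' t'' where
    XYZ: "X = (C, \<Delta>, \<epsilon>, t)" "Y = (C', \<Delta>', \<epsilon>', t')" "Z = (C'', \<Delta>'', \<epsilon>'', t'')" by (cases X; cases Y; cases Z)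
  note f' = mhomD[OF f[unfolded XYZ]] and g' = mhomD[OF g[unfolded XYZ]]
  note cs = comonoidD(1-3)[OF measD(1)[OF X[unfolded XYZ]]] comonoidD(1-3)[OF measD(1)[OF Y[unfolded XYZ]]] comonoidD(1-3)[OF measD(1)[OF Z[unfolded XYZ]]]
  note [simp] = f'(1) g'(1) cs measD(2)[OF Z[unfolded XYZ]]
  have "is_comonoid_hom V (C, \<Delta>, \<epsilon>) (g \<cdot> f) (C'', \<Delta>'', \<epsilon>'')"
    by (rule comonoid_hom_comp[OF measD(1)[OF X[unfolded XYZ]] measD(1)[OF Y[unfolded XYZ]] measD(1)[OF Z[unfolded XYZ]]]) 
      (use f g in \<open>auto simp: mhom_def XYZ\<close>)
  moreover have "t'' \<cdot> (\<one> A \<boxtimes> (g \<cdot> f)) = t" by (simp add: whisker comp_reduce[OF g'(4)] f'(4))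
  ultimately show ?thesis by (simp add: mhom_def XYZ)
qed

text \<open>The three conditions on \<open>k\<close> are equations between arrows out of
  \<open>fst Y\<close> or out of \<open>A \<otimes> fst Y\<close>. They may be tested on the legs,
  since joint epimorphy survives tensoring with \<open>A\<close>.\<close>

lemma mhom_of_jointly_epi:
  assumes c: "jointly_epi V J (fst Y) c" and X: "\<And>i. i \<in> J \<Longrightarrow> meas (X i)" and Y: "meas Y" and Z: "meas Z"
    and f: "\<And>i. i \<in> J \<Longrightarrow> mhom (X i) (c i) Y" and k: "k \<in> hom V (fst Y) (fst Z)" and kf: "\<And>i. i \<in> J \<Longrightarrow> mhom (X i) (k \<cdot> c i) Z"
  shows "mhom Y k Z"
proof -
  obtain C' \<Delta>' \<epsilon>' t' C'' \<Delta>'' \<epsilon>'' t'' where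
    YZ: "Y = (C', \<Delta>', \<epsilon>', t')" "Z = (C'', \<Delta>'', \<epsilon>'', t'')" by (cases Y; cases Z)
  note cs = comonoidD(1-3)[OF measD(1)[OF Y[unfolded YZ]]] comonoidD(1-3)[OF measD(1)[OF Z[unfolded YZ]]]
  note [simp] = cs measD(2)[OF Y[unfolded YZ]] measD(2)[OF Z[unfolded YZ]] homD[OF k[unfolded YZ fst_conv]]
  have c': "jointly_epi V J C' c" using c by (simp add: YZ)
  have ci: "c i \<in> hom V (fst (X i)) C'" if "i \<in> J" for i using mhom_hom[OF f[OF that]] by (simp add: YZ)
  show ?thesis unfolding YZ
  proof (rule mhomI)
    show "\<Delta>'' \<cdot> k = (k \<boxtimes> k) \<cdot> \<Delta>'"
    proof (rule jointly_epiD[OF c'])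
      fix i assume i: "i \<in> J"
      obtain C \<Delta> \<epsilon> t where Xi: "X i = (C, \<Delta>, \<epsilon>, t)" by (cases "X i")
      note f' = mhomD[OF f[OF i, unfolded Xi YZ]] and kf' = mhomD[OF kf[OF i, unfolded Xi YZ]]
      note [simp] = f'(1) comonoidD(1-3)[OF measD(1)[OF X[OF i, unfolded Xi]]]
      show "\<Delta>'' \<cdot> k \<cdot> c i = (k \<boxtimes> k) \<cdot> \<Delta>' \<cdot> c i" using kf'(2) by (simp add: merge f'(2))
    qed (auto simp: hom_def)
    show "\<epsilon>'' \<cdot> k = \<epsilon>'"
    proof (rule jointly_epiD[OF c'])
      fix i assume i: "i \<in> J"
      obtain C \<Delta> \<epsilon> t where Xi: "X i = (C, \<Delta>, \<epsilon>, t)" by (cases "X i")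
      note f' = mhomD[OF f[OF i, unfolded Xi YZ]] and kf' = mhomD[OF kf[OF i, unfolded Xi YZ]]
      note [simp] = f'(1) comonoidD(1-3)[OF measD(1)[OF X[OF i, unfolded Xi]]]
      show "\<epsilon>'' \<cdot> k \<cdot> c i = \<epsilon>' \<cdot> c i" using kf'(3) by (simp add: comp_assoc f'(3))
    qed (auto simp: hom_def)
    show "t'' \<cdot> (\<one> A \<boxtimes> k) = t'"
    proof (rule jointly_epiD[OF jointly_epi_tensor_left[OF c' ci, of A]])
      fix i assume i: "i \<in> J"
      obtain C \<Delta> \<epsilon> t where Xi: "X i = (C, \<Delta>, \<epsilon>, t)" by (cases "X i")
      note f' = mhomD[OF f[OF i, unfolded Xi YZ]] and kf' = mhomD[OF kf[OF i, unfolded Xi YZ]]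
      note [simp] = f'(1) comonoidD(1-3)[OF measD(1)[OF X[OF i, unfolded Xi]]]
      show "t'' \<cdot> (\<one> A \<boxtimes> k) \<cdot> (\<one> A \<boxtimes> c i) = t' \<cdot> (\<one> A \<boxtimes> c i)" using kf'(4) by (simp add: merge f'(4))
    qed (auto simp: hom_def)
  qed simp_all
qed

text \<open>The comultiplication, the counit and the measuring are arrows out of the underlying
  object or out of \<open>A\<close> tensored with it. All three are therefore induced on a colimit
  in \<open>V\<close>, and their axioms are equations that can be checked on the legs, where they
  hold by assumption.\<close>

lemma meas_colimit:
  assumes G: "\<And>i. i \<in> J \<Longrightarrow> meas (G i)" 
    and E: "\<And>i u j. (i, u, j) \<in> E \<Longrightarrow> i \<in> J \<and> j \<in> J \<and> mhom (G i) u (G j)"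
    and X: "graph_colimit V J (\<lambda>i. fst (G i)) E X c"
  obtains \<Delta> \<epsilon> t where "meas (X, \<Delta>, \<epsilon>, t)" "\<forall>i\<in>J. mhom (G i) (c i) (X, \<Delta>, \<epsilon>, t)"
proof -
  define F D e s where FD: "F i = fst (G i)" "D i = fst (snd (G i))" "e i = fst (snd (snd (G i)))" "s i = snd (snd (snd (G i)))" for i
  have Gi: "G i = (F i, D i, e i, s i)" for i by (simp add: FD)
  have X': "graph_colimit V J F E X c" using X by (simp add: FD(1)[abs_def])
  note G' = G[unfolded Gi]
  have E': "i \<in> J" "j \<in> J" "mhom (F i, D i, e i, s i) u (F j, D j, e j, s j)" if "(i, u, j) \<in> E" for i u j
    using E[OF that] by (auto simp: Gi)
  note co = comonoidD[OF measD(1)[OF G']]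
  have gr: "graph V J F E"
    unfolding graph_def using co(1) E'(1,2) mhomD(1)[OF E'(3)] by (auto simp: hom_def)
  have cc: "graph_cocone V J F E X c" and epi: "jointly_epi V J X c" using X' by (auto simp: graph_colimit_def)
  have [simp]: "X \<in> Ob V" using cc by (simp add: graph_cocone_def)
  have c: "c i \<in> hom V (F i) X" if "i \<in> J" for i using cc that by (auto simp: graph_cocone_def)
  have cE: "c j \<cdot> u = c i" if "(i, u, j) \<in> E" for i u j using cc that by (auto simp: graph_cocone_def)
  have dc: "graph_cocone V J F E (X \<otimes> X) (\<lambda>i. (c i \<boxtimes> c i) \<cdot> D i)"
    unfolding graph_cocone_def
  proof (intro conjI ballI)
    fix i assume "i \<in> J" then show "(c i \<boxtimes> c i) \<cdot> D i \<in> hom V (F i) (X \<otimes> X)"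
      using c[of i] co(2)[of i] by (auto simp: hom_def)
  next
    fix x assume x: "x \<in> E"
    obtain i u j where xx: "x = (i, u, j)" by (cases x)
    note e = E'[OF x[unfolded xx]]
    note [simp] = homD[OF c[OF e(1)]] homD[OF c[OF e(2)]] mhomD(1)[OF e(3)] co(2)[OF e(1)] co(2)[OF e(2)]
    show "case x of (i, u, j) \<Rightarrow> (c j \<boxtimes> c j) \<cdot> D j \<cdot> u = (c i \<boxtimes> c i) \<cdot> D i"
      using cE[OF x[unfolded xx]] by (simp add: xx merge mhomD(2)[OF e(3)])
  qed simp
  obtain \<Delta> where \<Delta>: "\<Delta> \<in> hom V X (X \<otimes> X)" "\<And>i. i \<in> J \<Longrightarrow> \<Delta> \<cdot> c i = (c i \<boxtimes> c i) \<cdot> D i"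
    by (rule graph_colimit_desc[OF X' dc]) (rule that, simp_all)
  have ec: "graph_cocone V J F E I e"
    unfolding graph_cocone_def using E'(1,2) mhomD(3)[OF E'(3)] co(3) by (auto simp: hom_def)
  obtain \<epsilon> where \<epsilon>: "\<epsilon> \<in> hom V X I" "\<And>i. i \<in> J \<Longrightarrow> \<epsilon> \<cdot> c i = e i"
    by (rule graph_colimit_desc[OF X' ec]) (rule that, simp_all)
  obtain t where t: "t \<in> hom V (A \<otimes> X) B" "\<And>i. i \<in> J \<Longrightarrow> t \<cdot> (\<one> A \<boxtimes> c i) = s i"
  proof (rule colimit_tensor_left_desc[OF X' gr, of A B s])
    show "s i \<in> hom V (A \<otimes> F i) B" if "i \<in> J" for i using measD(2)[OF G'[OF that]] by (simp add: hom_def)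
    show "s j \<cdot> (\<one> A \<boxtimes> u) = s i" if "(i, u, j) \<in> E" for i u j using mhomD(4)[OF E'(3)[OF that]] .
  qed simp_all
  note [simp] = homD[OF \<Delta>(1)] homD[OF \<epsilon>(1)] homD[OF t(1)]
  have com: "is_comonoid V (X, \<Delta>, \<epsilon>)"
  proof -
    have "\<alpha> X X X \<cdot> ((\<Delta> \<boxtimes> \<one> X) \<cdot> \<Delta>) = (\<one> X \<boxtimes> \<Delta>) \<cdot> \<Delta>"
    proof (rule jointly_epiD[OF epi])
      fix i assume i: "i \<in> J"
      note [simp] = homD[OF c[OF i]] co(1)[OF i] co(2)[OF i] co(3)[OF i]
      have "\<alpha> X X X \<cdot> ((\<Delta> \<boxtimes> \<one> X) \<cdot> \<Delta>) \<cdot> c i = \<alpha> X X X \<cdot> ((((c i \<boxtimes> c i) \<cdot> D i) \<boxtimes> c i) \<cdot> D i)"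
        by (simp add: merge \<Delta>(2)[OF i])
      also have "\<dots> = (\<alpha> X X X \<cdot> (c i \<boxtimes> c i \<boxtimes> c i)) \<cdot> ((D i \<boxtimes> \<one> (F i)) \<cdot> D i)"
        by (simp add: merge)
      also have "\<alpha> X X X \<cdot> (c i \<boxtimes> c i \<boxtimes> c i) = (c i \<boxtimes> (c i \<boxtimes> c i)) \<cdot> \<alpha> (F i) (F i) (F i)"
        by (rule assoc_nat) simp_all
      also have "(c i \<boxtimes> (c i \<boxtimes> c i)) \<cdot> \<alpha> (F i) (F i) (F i) \<cdot> ((D i \<boxtimes> \<one> (F i)) \<cdot> D i) = (c i \<boxtimes> (c i \<boxtimes> c i)) \<cdot> ((\<one> (F i) \<boxtimes> D i) \<cdot> D i)"
        by (simp add: comp_assoc co(4)[OF i])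
      also have "\<dots> = (\<one> X \<boxtimes> \<Delta>) \<cdot> \<Delta> \<cdot> c i" by (simp add: merge \<Delta>(2)[OF i])
      finally show "\<alpha> X X X \<cdot> ((\<Delta> \<boxtimes> \<one> X) \<cdot> \<Delta>) \<cdot> c i = (\<one> X \<boxtimes> \<Delta>) \<cdot> \<Delta> \<cdot> c i" .
    qed (auto simp: hom_def)
    moreover have "\<lambda>\<^sub>I X \<cdot> ((\<epsilon> \<boxtimes> \<one> X) \<cdot> \<Delta>) = \<one> X"
    proof (rule jointly_epiD[OF epi])
      fix i assume i: "i \<in> J"
      note [simp] = homD[OF c[OF i]] co(1)[OF i] co(2)[OF i] co(3)[OF i]
      have "\<lambda>\<^sub>I X \<cdot> ((\<epsilon> \<boxtimes> \<one> X) \<cdot> \<Delta>) \<cdot> c i = (\<lambda>\<^sub>I X \<cdot> (\<one> I \<boxtimes> c i)) \<cdot> ((e i \<boxtimes> \<one> (F i)) \<cdot> D i)"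
        by (simp add: merge \<Delta>(2)[OF i] \<epsilon>(2)[OF i])
      also have "\<lambda>\<^sub>I X \<cdot> (\<one> I \<boxtimes> c i) = c i \<cdot> \<lambda>\<^sub>I (F i)" by (rule lunit_nat) simp_all
      finally show "\<lambda>\<^sub>I X \<cdot> ((\<epsilon> \<boxtimes> \<one> X) \<cdot> \<Delta>) \<cdot> c i = \<one> X \<cdot> c i" by (simp add: comp_assoc co(5)[OF i])
    qed (auto simp: hom_def)
    moreover have "\<rho>\<^sub>I X \<cdot> ((\<one> X \<boxtimes> \<epsilon>) \<cdot> \<Delta>) = \<one> X"
    proof (rule jointly_epiD[OF epi])
      fix i assume i: "i \<in> J"
      note [simp] = homD[OF c[OF i]] co(1)[OF i] co(2)[OF i] co(3)[OF i]
      have "\<rho>\<^sub>I X \<cdot> ((\<one> X \<boxtimes> \<epsilon>) \<cdot> \<Delta>) \<cdot> c i = (\<rho>\<^sub>I X \<cdot> (c i \<boxtimes> \<one> I)) \<cdot> ((\<one> (F i) \<boxtimes> e i) \<cdot> D i)"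
        by (simp add: merge \<Delta>(2)[OF i] \<epsilon>(2)[OF i])
      also have "\<rho>\<^sub>I X \<cdot> (c i \<boxtimes> \<one> I) = c i \<cdot> \<rho>\<^sub>I (F i)" by (rule runit_nat) simp_all
      finally show "\<rho>\<^sub>I X \<cdot> ((\<one> X \<boxtimes> \<epsilon>) \<cdot> \<Delta>) \<cdot> c i = \<one> X \<cdot> c i" by (simp add: comp_assoc co(6)[OF i])
    qed (auto simp: hom_def)
    ultimately show ?thesis unfolding is_comonoid_def by (simp add: hom_def comp_assoc)
  qed
  have "t \<cdot> (m \<boxtimes> \<one> X) = convolve n X \<Delta> A A t t"
  proof (rule jointly_epiD[OF jointly_epi_tensor_left[OF epi c, of "A \<otimes> A"]])
    show "convolve n X \<Delta> A A t t \<in> hom V (A \<otimes> A \<otimes> X) B"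
      by (rule convolve_hom[OF monoid_B com]) (simp_all add: hom_def)
    fix i assume i: "i \<in> J"
    note [simp] = homD[OF c[OF i]] co(1)[OF i] co(2)[OF i] co(3)[OF i]
    have "t \<cdot> (m \<boxtimes> \<one> X) \<cdot> (\<one> (A \<otimes> A) \<boxtimes> c i) = (t \<cdot> (\<one> A \<boxtimes> c i)) \<cdot> (m \<boxtimes> \<one> (F i))" by (simp add: merge)
    also have "\<dots> = convolve n (F i) (D i) A A (s i) (s i)" by (simp add: t(2)[OF i] measD(3)[OF G'[OF i]])
    also have "\<dots> = convolve n X \<Delta> A A t t \<cdot> (\<one> (A \<otimes> A) \<boxtimes> c i)"
      using convolve_comonoid_hom[OF monoid_B com t(1) t(1) _ _ measD(1)[OF G'[OF i]] c[OF i] \<Delta>(2)[OF i]] by (simp add: t(2)[OF i])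
    finally show "t \<cdot> (m \<boxtimes> \<one> X) \<cdot> (\<one> (A \<otimes> A) \<boxtimes> c i) = convolve n X \<Delta> A A t t \<cdot> (\<one> (A \<otimes> A) \<boxtimes> c i)" .
  qed (auto simp: hom_def)
  moreover have "t \<cdot> (\<eta> \<boxtimes> \<one> X) = \<theta> \<cdot> (\<epsilon> \<cdot> \<lambda>\<^sub>I X)"
  proof (rule jointly_epiD[OF jointly_epi_tensor_left[OF epi c, of I]])
    fix i assume i: "i \<in> J"
    note [simp] = homD[OF c[OF i]] co(1)[OF i] co(2)[OF i] co(3)[OF i]
    have "t \<cdot> (\<eta> \<boxtimes> \<one> X) \<cdot> (\<one> I \<boxtimes> c i) = (t \<cdot> (\<one> A \<boxtimes> c i)) \<cdot> (\<eta> \<boxtimes> \<one> (F i))" by (simp add: merge)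
    also have "\<dots> = \<theta> \<cdot> ((\<epsilon> \<cdot> c i) \<cdot> \<lambda>\<^sub>I (F i))" by (simp add: t(2)[OF i] measD(4)[OF G'[OF i]] \<epsilon>(2)[OF i])
    also have "\<dots> = \<theta> \<cdot> (\<epsilon> \<cdot> (c i \<cdot> \<lambda>\<^sub>I (F i)))" by (simp add: comp_assoc)
    also have "c i \<cdot> \<lambda>\<^sub>I (F i) = \<lambda>\<^sub>I X \<cdot> (\<one> I \<boxtimes> c i)" by (rule lunit_nat[symmetric]) simp_all
    finally show "t \<cdot> (\<eta> \<boxtimes> \<one> X) \<cdot> (\<one> I \<boxtimes> c i) = \<theta> \<cdot> (\<epsilon> \<cdot> \<lambda>\<^sub>I X) \<cdot> (\<one> I \<boxtimes> c i)" by (simp add: comp_assoc)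
  qed (auto simp: hom_def)
  ultimately have "meas (X, \<Delta>, \<epsilon>, t)" using com t(1) by (simp add: meas_def measuring_def)
  moreover have "mhom (G i) (c i) (X, \<Delta>, \<epsilon>, t)" if i: "i \<in> J" for i
    unfolding Gi by (rule mhomI) (use homD[OF c[OF i]] \<Delta>(2)[OF i] \<epsilon>(2)[OF i] t(2)[OF i] in auto)
  ultimately show ?thesis using that by blast
qed

end

section \<open>Small subcomonoids\<close>

definition chain_edges :: "(nat \<Rightarrow> 'a) \<Rightarrow> (nat \<times> 'a \<times> nat) set" where
  "chain_edges w = range (\<lambda>k. (k, w k, Suc k))"

text \<open>The objects of the diagram carry no structure. The comultiplication of \<open>C\<close>
  reaches them only through lifts along the legs of the colimit.\<close>

locale comonoid_presentation = smc_cat V + inaccessible_cardinal \<kappa> + J: filtered_category J \<mu>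
  for V :: "('o, 'a, 'z) smc_category_scheme" (structure) and \<kappa> \<mu> :: "'u rel" and J :: "('u, 'u) category" +
  fixes F :: "('u, 'u, 'o, 'a) func" and C :: 'o and x :: "'u \<Rightarrow> 'a" and \<Delta> \<epsilon> :: 'a
  assumes small_J: "small_category \<kappa> J" and functor_F: "is_functor J V F"
    and presentable_F: "\<And>j. j \<in> Ob J \<Longrightarrow> presentable \<kappa> \<mu> V (ObMap F j)"
    and colimit_F: "is_colimit V J F C x" and comonoid: "is_comonoid V (C, \<Delta>, \<epsilon>)"
begin

lemmas [simp] = comonoidD(1-3)[OF comonoid]

lemma Fob [simp]: "j \<in> Ob J \<Longrightarrow> ObMap F j \<in> Ob V"
  using functor_F by (auto simp: is_functor_def)

lemma Far: "u \<in> hom J i j \<Longrightarrow> ArMap F u \<in> hom V (ObMap F i) (ObMap F j)"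
  using functor_F by (auto simp: is_functor_def hom_def)

lemma Fcomp: "u \<in> hom J i j \<Longrightarrow> v \<in> hom J j k \<Longrightarrow> ArMap F (v \<cdot>\<^bsub>J\<^esub> u) = ArMap F v \<cdot> ArMap F u"
  using functor_F by (auto simp: is_functor_def hom_def)

lemma leg: "j \<in> Ob J \<Longrightarrow> x j \<in> hom V (ObMap F j) C"
  using colimit_F by (auto simp: is_colimit_def is_cocone_def)

lemma leg_nat: "u \<in> hom J i j \<Longrightarrow> x j \<cdot> ArMap F u = x i"
  using colimit_F by (auto simp: is_colimit_def is_cocone_def hom_def)

lemma Job: "u \<in> hom J i j \<Longrightarrow> i \<in> Ob J \<and> j \<in> Ob J"
  by (auto simp: hom_def)

lemma distinct_elements: obtains a b :: 'u where "a \<noteq> b"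
  using J.infinite_univ by (metis finite.emptyI finite.insertI finite_subset insertI1 subsetI UNIV_I)

lemma stage_factor:
  assumes "is_functor J V G" "is_colimit V J G Y y" "i \<in> Ob J" "f \<in> hom V (ObMap F i) Y"
  obtains j g where "j \<in> Ob J" "g \<in> hom V (ObMap F i) (ObMap G j)" "f = y j \<cdot> g"
proof -
  obtain a b :: 'u where ab: "a \<noteq> b" by (rule distinct_elements)
  show ?thesis
    by (rule presentable_factor[OF inaccessible ab category presentable_F[OF assms(3)] small_J J.filtered assms(1,2,4)])
      (rule that)
qed

lemma stage_eq:
  assumes "is_functor J V G" "is_colimit V J G Y y" "i \<in> Ob J" "j \<in> Ob J"
    "f \<in> hom V (ObMap F i) (ObMap G j)" "g \<in> hom V (ObMap F i) (ObMap G j)" "y j \<cdot> f = y j \<cdot> g"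
  obtains k w where "w \<in> hom J j k" "ArMap G w \<cdot> f = ArMap G w \<cdot> g"
proof -
  obtain a b :: 'u where ab: "a \<noteq> b" by (rule distinct_elements)
  show ?thesis
    by (rule presentable_eq[OF inaccessible ab category presentable_F[OF assms(3)] small_J J.filtered assms(1,2,4,5,6,7) J.aleph0_le])
      (rule that)
qed

abbreviation "F2 \<equiv> tensor_diagram F F"
abbreviation "F3 \<equiv> tensor_diagram F F2"

lemma functor_F2: "is_functor J V F2" and functor_F3: "is_functor J V F3"
  using functor_tensor_diagram functor_F by blast+

text \<open>An equation between arrows into a tensor power of \<open>C\<close> can be pulled back to
  a later stage only if that power is again a filtered colimit over the same index category. The
  square is used for lifts of the comultiplication, the cube for coassociativity.\<close>

lemma colimit_F2: "is_colimit V J F2 (C \<otimes> C) (\<lambda>j. x j \<boxtimes> x j)"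
  by (rule filtered_tensor_colimit[OF J.filtered_category_axioms functor_F functor_F colimit_F colimit_F])

lemma colimit_F3: "is_colimit V J F3 (C \<otimes> (C \<otimes> C)) (\<lambda>j. x j \<boxtimes> (x j \<boxtimes> x j))"
  by (rule filtered_tensor_colimit[OF J.filtered_category_axioms functor_F functor_F2 colimit_F colimit_F2])

definition lift :: "'u \<Rightarrow> 'u \<Rightarrow> 'a \<Rightarrow> bool" where
  "lift j k \<delta> \<longleftrightarrow> j \<in> Ob J \<and> k \<in> Ob J \<and> \<delta> \<in> hom V (ObMap F j) (ObMap F k \<otimes> ObMap F k) \<and> (x k \<boxtimes> x k) \<cdot> \<delta> = \<Delta> \<cdot> x j"

text \<open>The counit laws at a finite stage: source and target of \<open>\<delta>\<close> lie at
  different indices, so the transition arrow \<open>ArMap F u\<close> stands in for the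
  identity.\<close>

definition counital :: "'u \<Rightarrow> 'u \<Rightarrow> 'u \<Rightarrow> 'a \<Rightarrow> bool" where
  "counital j k u \<delta> \<longleftrightarrow> u \<in> hom J j k \<and> lift j k \<delta> \<and>
     \<lambda>\<^sub>I (ObMap F k) \<cdot> (((\<epsilon> \<cdot> x k) \<boxtimes> \<one> (ObMap F k)) \<cdot> \<delta>) = ArMap F u \<and>
     \<rho>\<^sub>I (ObMap F k) \<cdot> ((\<one> (ObMap F k) \<boxtimes> (\<epsilon> \<cdot> x k)) \<cdot> \<delta>) = ArMap F u"

abbreviation push :: "'u \<Rightarrow> 'a \<Rightarrow> 'a" where
  "push w \<delta> \<equiv> (ArMap F w \<boxtimes> ArMap F w) \<cdot> \<delta>"

lemma liftD: 
  assumes "lift j k \<delta>"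
  shows "j \<in> Ob J" "k \<in> Ob J" "\<delta> \<in> Ar V \<and> Dom V \<delta> = ObMap F j \<and> Cod V \<delta> = ObMap F k \<otimes> ObMap F k" "(x k \<boxtimes> x k) \<cdot> \<delta> = \<Delta> \<cdot> x j"
  using assms by (auto simp: lift_def hom_def)

lemma lift_push:
  assumes l: "lift j k \<delta>" and w: "w \<in> hom J k l" shows "lift j l (push w \<delta>)"
proof -
  have o: "l \<in> Ob J" using w Job by blast
  note [simp] = liftD(1-3)[OF l] homD[OF Far[OF w]] homD[OF leg[OF liftD(2)[OF l]]] homD[OF leg[OF o]] homD[OF leg[OF liftD(1)[OF l]]]
  have "(x l \<boxtimes> x l) \<cdot> push w \<delta> = \<Delta> \<cdot> x j"
    using liftD(4)[OF l] leg_nat[OF w] by (simp add: tens_comp_assoc)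
  then show ?thesis using o by (simp add: lift_def hom_def)
qed

text \<open>Since \<open>\<epsilon>\<close> is evaluated through the legs, pushing a lift forward
  changes the counit composite only by the transition arrow. A counit law reached at one stage thus
  persists at all later ones.\<close>

lemma left_push:
  assumes l: "lift j k \<delta>" and w: "w \<in> hom J k l"
  shows "\<lambda>\<^sub>I (ObMap F l) \<cdot> (((\<epsilon> \<cdot> x l) \<boxtimes> \<one> (ObMap F l)) \<cdot> push w \<delta>) = 
    ArMap F w \<cdot> (\<lambda>\<^sub>I (ObMap F k) \<cdot> (((\<epsilon> \<cdot> x k) \<boxtimes> \<one> (ObMap F k)) \<cdot> \<delta>))"
proof -
  have o: "l \<in> Ob J" using w Job by blast
  note [simp] = liftD(1-3)[OF l] homD[OF Far[OF w]] homD[OF leg[OF liftD(2)[OF l]]] homD[OF leg[OF o]] o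
  have "\<lambda>\<^sub>I (ObMap F l) \<cdot> (((\<epsilon> \<cdot> x l) \<boxtimes> \<one> (ObMap F l)) \<cdot> push w \<delta>) = 
      (\<lambda>\<^sub>I (ObMap F l) \<cdot> (\<one> I \<boxtimes> ArMap F w)) \<cdot> (((\<epsilon> \<cdot> x k) \<boxtimes> \<one> (ObMap F k)) \<cdot> \<delta>)"
    using leg_nat[OF w] by (simp add: merge)
  also have "\<lambda>\<^sub>I (ObMap F l) \<cdot> (\<one> I \<boxtimes> ArMap F w) = ArMap F w \<cdot> \<lambda>\<^sub>I (ObMap F k)" by (rule lunit_nat) simp_all
  finally show ?thesis by (simp add: comp_assoc)
qed

lemma right_push:
  assumes l: "lift j k \<delta>" and w: "w \<in> hom J k l"
  shows "\<rho>\<^sub>I (ObMap F l) \<cdot> ((\<one> (ObMap F l) \<boxtimes> (\<epsilon> \<cdot> x l)) \<cdot> push w \<delta>) = 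
    ArMap F w \<cdot> (\<rho>\<^sub>I (ObMap F k) \<cdot> ((\<one> (ObMap F k) \<boxtimes> (\<epsilon> \<cdot> x k)) \<cdot> \<delta>))"
proof -
  have o: "l \<in> Ob J" using w Job by blast
  note [simp] = liftD(1-3)[OF l] homD[OF Far[OF w]] homD[OF leg[OF liftD(2)[OF l]]] homD[OF leg[OF o]] o
  have "\<rho>\<^sub>I (ObMap F l) \<cdot> ((\<one> (ObMap F l) \<boxtimes> (\<epsilon> \<cdot> x l)) \<cdot> push w \<delta>) = 
      (\<rho>\<^sub>I (ObMap F l) \<cdot> (ArMap F w \<boxtimes> \<one> I)) \<cdot> ((\<one> (ObMap F k) \<boxtimes> (\<epsilon> \<cdot> x k)) \<cdot> \<delta>)"
    using leg_nat[OF w] by (simp add: merge)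
  also have "\<rho>\<^sub>I (ObMap F l) \<cdot> (ArMap F w \<boxtimes> \<one> I) = ArMap F w \<cdot> \<rho>\<^sub>I (ObMap F k)" by (rule runit_nat) simp_all
  finally show ?thesis by (simp add: comp_assoc)
qed

lemma counital_push:
  assumes c: "counital j k u \<delta>" and w: "w \<in> hom J k l" shows "counital j l (w \<cdot>\<^bsub>J\<^esub> u) (push w \<delta>)"
proof -
  have u: "u \<in> hom J j k" and l: "lift j k \<delta>" using c by (auto simp: counital_def)
  show ?thesis unfolding counital_def left_push[OF l w] right_push[OF l w] Fcomp[OF u w]
    using c lift_push[OF l w] J.comp_hom[OF u w] by (simp add: counital_def)
qed

text \<open>The counit laws hold after composition with the legs of the colimit, hence at a later stage.\<close>

lemma counital_exists:
  assumes j: "j \<in> Ob J"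
  obtains k u \<delta> where "counital j k u \<delta>"
proof -
  note [simp] = j homD[OF leg[OF j]]
  have "\<Delta> \<cdot> x j \<in> hom V (ObMap F j) (C \<otimes> C)" by (simp add: hom_def)
  then obtain k \<delta> where k: "k \<in> Ob J" "\<delta> \<in> hom V (ObMap F j) (ObMap F2 k)" "\<Delta> \<cdot> x j = (x k \<boxtimes> x k) \<cdot> \<delta>"
    by (rule stage_factor[OF functor_F2 colimit_F2 j])
  then have l0: "lift j k \<delta>" using j by (simp add: lift_def)
  \<comment> \<open>Factoring the comultiplication produces some index \<open>k\<close> that need
    not be reachable from \<open>j\<close>. An upper bound supplies the transition arrow out of
    \<open>j\<close> with which the counit laws are to be compared.\<close>
  obtain l u w where uw: "u \<in> hom J j l" "w \<in> hom J k l" using J.filtered_upper[OF j k(1)] .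
  let ?\<delta> = "push w \<delta>"
  have l1: "lift j l ?\<delta>" by (rule lift_push[OF l0 uw(2)])
  have lo: "l \<in> Ob J" using uw(1) Job by blast
  note [simp] = lo homD[OF leg[OF lo]] homD[OF Far[OF uw(1)]] liftD(3)[OF l1]
  let ?f = "\<lambda>\<^sub>I (ObMap F l) \<cdot> (((\<epsilon> \<cdot> x l) \<boxtimes> \<one> (ObMap F l)) \<cdot> ?\<delta>)"
  let ?g = "\<rho>\<^sub>I (ObMap F l) \<cdot> ((\<one> (ObMap F l) \<boxtimes> (\<epsilon> \<cdot> x l)) \<cdot> ?\<delta>)"
  have "x l \<cdot> ?f = x l \<cdot> ArMap F u"
  proof -
    have "x l \<cdot> ?f = (x l \<cdot> \<lambda>\<^sub>I (ObMap F l)) \<cdot> (((\<epsilon> \<cdot> x l) \<boxtimes> \<one> (ObMap F l)) \<cdot> ?\<delta>)" by (simp add: comp_assoc)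
    also have "x l \<cdot> \<lambda>\<^sub>I (ObMap F l) = \<lambda>\<^sub>I C \<cdot> (\<one> I \<boxtimes> x l)" by (rule lunit_nat[symmetric]) simp_all
    also have "\<lambda>\<^sub>I C \<cdot> (\<one> I \<boxtimes> x l) \<cdot> (((\<epsilon> \<cdot> x l) \<boxtimes> \<one> (ObMap F l)) \<cdot> ?\<delta>) = \<lambda>\<^sub>I C \<cdot> ((\<epsilon> \<boxtimes> \<one> C) \<cdot> ((x l \<boxtimes> x l) \<cdot> ?\<delta>))"
      using liftD(3)[OF l1] by (simp add: tens_comp_assoc comp_assoc del: liftD(3)[OF l1])
    also have "\<dots> = (\<lambda>\<^sub>I C \<cdot> ((\<epsilon> \<boxtimes> \<one> C) \<cdot> \<Delta>)) \<cdot> x j" unfolding liftD(4)[OF l1] by (simp add: comp_assoc)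
    also have "\<dots> = x l \<cdot> ArMap F u" unfolding comonoidD(5)[OF comonoid] leg_nat[OF uw(1)] by simp
    finally show ?thesis .
  qed
  then obtain l2 w2 where w2: "w2 \<in> hom J l l2" "ArMap F w2 \<cdot> ?f = ArMap F w2 \<cdot> ArMap F u"
    by (rule stage_eq[OF functor_F colimit_F j lo, rotated 2]) (simp_all add: hom_def)
  have l2: "lift j l2 (push w2 ?\<delta>)" by (rule lift_push[OF l1 w2(1)])
  have l2o: "l2 \<in> Ob J" using w2(1) Job by blast
  note u2 = J.comp_hom[OF uw(1) w2(1)]
  note [simp] = l2o homD[OF leg[OF l2o]] homD[OF Far[OF u2]] liftD(3)[OF l2]
  let ?\<delta>2 = "push w2 ?\<delta>" and ?u2 = "w2 \<cdot>\<^bsub>J\<^esub> u"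
  have L2: "\<lambda>\<^sub>I (ObMap F l2) \<cdot> (((\<epsilon> \<cdot> x l2) \<boxtimes> \<one> (ObMap F l2)) \<cdot> ?\<delta>2) = ArMap F ?u2"
    unfolding left_push[OF l1 w2(1)] w2(2) Fcomp[OF uw(1) w2(1)] ..
  let ?g2 = "\<rho>\<^sub>I (ObMap F l2) \<cdot> ((\<one> (ObMap F l2) \<boxtimes> (\<epsilon> \<cdot> x l2)) \<cdot> ?\<delta>2)"
  have "x l2 \<cdot> ?g2 = x l2 \<cdot> ArMap F ?u2"
  proof -
    have "x l2 \<cdot> ?g2 = (x l2 \<cdot> \<rho>\<^sub>I (ObMap F l2)) \<cdot> ((\<one> (ObMap F l2) \<boxtimes> (\<epsilon> \<cdot> x l2)) \<cdot> ?\<delta>2)" by (simp add: comp_assoc)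
    also have "x l2 \<cdot> \<rho>\<^sub>I (ObMap F l2) = \<rho>\<^sub>I C \<cdot> (x l2 \<boxtimes> \<one> I)" by (rule runit_nat[symmetric]) simp_all
    also have "\<rho>\<^sub>I C \<cdot> (x l2 \<boxtimes> \<one> I) \<cdot> ((\<one> (ObMap F l2) \<boxtimes> (\<epsilon> \<cdot> x l2)) \<cdot> ?\<delta>2) = \<rho>\<^sub>I C \<cdot> ((\<one> C \<boxtimes> \<epsilon>) \<cdot> ((x l2 \<boxtimes> x l2) \<cdot> ?\<delta>2))"
      by (simp add: tens_comp_assoc comp_assoc)
    also have "\<dots> = (\<rho>\<^sub>I C \<cdot> ((\<one> C \<boxtimes> \<epsilon>) \<cdot> \<Delta>)) \<cdot> x j" unfolding liftD(4)[OF l2] by (simp add: comp_assoc)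
    also have "\<dots> = x l2 \<cdot> ArMap F ?u2" unfolding comonoidD(6)[OF comonoid] leg_nat[OF u2] by simp
    finally show ?thesis .
  qed
  \<comment> \<open>One more stage is needed for the right counit law. The left one, established at
    \<open>l2\<close>, is carried along by \<open>left_push\<close>.\<close>
  then obtain l3 w3 where w3: "w3 \<in> hom J l2 l3" "ArMap F w3 \<cdot> ?g2 = ArMap F w3 \<cdot> ArMap F ?u2"
    by (rule stage_eq[OF functor_F colimit_F j l2o, rotated 2]) (simp_all add: hom_def)
  have l3: "lift j l3 (push w3 ?\<delta>2)" by (rule lift_push[OF l2 w3(1)])
  have "counital j l3 (w3 \<cdot>\<^bsub>J\<^esub> ?u2) (push w3 ?\<delta>2)"
    unfolding counital_def left_push[OF l2 w3(1)] right_push[OF l2 w3(1)] L2 w3(2) Fcomp[OF u2 w3(1)]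
    using l3 J.comp_hom[OF u2 w3(1)] by simp
  then show ?thesis by (rule that)
qed

text \<open>Coassociativity composes a lift with a lift of the next stage, so it is a statement
  about two consecutive steps. A counital lift at \<open>k\<close> is chosen first and then pushed
  forward twice: until it is compatible with the previous lift, and until it is coassociative with
  it. Pushing destroys neither the counit laws nor what was gained before.\<close>

lemma chain_step:
  assumes c: "counital j k u \<delta>"
  obtains l v \<delta>' where "counital k l v \<delta>'" "\<delta>' \<cdot> ArMap F u = push v \<delta>"
    "\<alpha> (ObMap F l) (ObMap F l) (ObMap F l) \<cdot> ((\<delta>' \<boxtimes> ArMap F v) \<cdot> \<delta>) = (ArMap F v \<boxtimes> \<delta>') \<cdot> \<delta>"
proof -
  have u: "u \<in> hom J j k" and l: "lift j k \<delta>" using c by (auto simp: counital_def)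
  have o: "j \<in> Ob J" "k \<in> Ob J" using Job[OF u] by auto
  obtain l v \<delta>' where c': "counital k l v \<delta>'" by (rule counital_exists[OF o(2)])
  have v: "v \<in> hom J k l" and l': "lift k l \<delta>'" using c' by (auto simp: counital_def)
  have lo: "l \<in> Ob J" using Job[OF v] by auto
  note [simp] = o lo liftD(3)[OF l] liftD(3)[OF l'] homD[OF leg[OF o(1)]] homD[OF leg[OF o(2)]] homD[OF leg[OF lo]] 
    homD[OF Far[OF u]] homD[OF Far[OF v]]
  have "(x l \<boxtimes> x l) \<cdot> (\<delta>' \<cdot> ArMap F u) = (x l \<boxtimes> x l) \<cdot> push v \<delta>"
  proof -
    have "(x l \<boxtimes> x l) \<cdot> (\<delta>' \<cdot> ArMap F u) = \<Delta> \<cdot> (x k \<cdot> ArMap F u)"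
      by (simp add: comp_reduce[OF liftD(4)[OF l']] comp_assoc)
    also have "\<dots> = (x k \<boxtimes> x k) \<cdot> \<delta>" unfolding leg_nat[OF u] by (rule liftD(4)[OF l, symmetric])
    also have "\<dots> = (x l \<boxtimes> x l) \<cdot> push v \<delta>" by (simp add: tens_comp_assoc leg_nat[OF v])
    finally show ?thesis .
  qed
  \<comment> \<open>Both arrows agree in \<open>C \<otimes> C\<close>, being lifts of
    \<open>\<Delta> \<cdot> x j\<close>. As their source is presentable, they agree at a later
    stage.\<close>
  then obtain q w where w: "w \<in> hom J l q" "ArMap F2 w \<cdot> (\<delta>' \<cdot> ArMap F u) = ArMap F2 w \<cdot> push v \<delta>"
    by (rule stage_eq[OF functor_F2 colimit_F2 o(1) lo, rotated 2]) (simp_all add: hom_def)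
  let ?v = "w \<cdot>\<^bsub>J\<^esub> v" and ?\<delta> = "push w \<delta>'"
  have c2: "counital k q ?v ?\<delta>" by (rule counital_push[OF c' w(1)])
  have v2: "?v \<in> hom J k q" and l2: "lift k q ?\<delta>" using c2 by (auto simp: counital_def)
  have qo: "q \<in> Ob J" using Job[OF w(1)] by auto
  note [simp] = qo homD[OF leg[OF qo]] homD[OF Far[OF w(1)]]
  have F2v: "push ?v \<delta> = push w (push v \<delta>)" unfolding Fcomp[OF v w(1)] by (simp add: merge)
  have e2: "?\<delta> \<cdot> ArMap F u = push ?v \<delta>"
    using w(2) unfolding F2v by (simp add: comp_assoc)
  let ?\<alpha> = "\<alpha> (ObMap F q) (ObMap F q) (ObMap F q)"
  note [simp] = liftD(3)[OF l2] homD[OF Far[OF v2]]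
  have "(x q \<boxtimes> (x q \<boxtimes> x q)) \<cdot> (?\<alpha> \<cdot> ((?\<delta> \<boxtimes> ArMap F ?v) \<cdot> \<delta>)) = (x q \<boxtimes> (x q \<boxtimes> x q)) \<cdot> ((ArMap F ?v \<boxtimes> ?\<delta>) \<cdot> \<delta>)"
  proof -
    \<comment> \<open>An opaque name keeps the pushed lift from being fused into the surrounding
      tensor product, so that its defining property \<open>d(2)\<close> can still be
      applied.\<close>
    define d where "d = ?\<delta>"
    have d: "d \<in> Ar V \<and> Dom V d = ObMap F k \<and> Cod V d = ObMap F q \<otimes> ObMap F q" "(x q \<boxtimes> x q) \<cdot> d = \<Delta> \<cdot> x k"
      unfolding d_def using liftD[OF l2] by auto
    note [simp] = d(1)
    have "(x q \<boxtimes> (x q \<boxtimes> x q)) \<cdot> (?\<alpha> \<cdot> ((d \<boxtimes> ArMap F ?v) \<cdot> \<delta>)) = ((x q \<boxtimes> (x q \<boxtimes> x q)) \<cdot> ?\<alpha>) \<cdot> ((d \<boxtimes> ArMap F ?v) \<cdot> \<delta>)"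
      by (simp add: comp_assoc)
    also have "(x q \<boxtimes> (x q \<boxtimes> x q)) \<cdot> ?\<alpha> = \<alpha> C C C \<cdot> (x q \<boxtimes> x q \<boxtimes> x q)" by (rule assoc_nat[symmetric]) simp_all
    also have "\<alpha> C C C \<cdot> (x q \<boxtimes> x q \<boxtimes> x q) \<cdot> ((d \<boxtimes> ArMap F ?v) \<cdot> \<delta>) = \<alpha> C C C \<cdot> ((\<Delta> \<boxtimes> \<one> C) \<cdot> ((x k \<boxtimes> x k) \<cdot> \<delta>))"
      by (simp add: merge d(2) leg_nat[OF v2])
    also have "\<dots> = (\<alpha> C C C \<cdot> ((\<Delta> \<boxtimes> \<one> C) \<cdot> \<Delta>)) \<cdot> x j" unfolding liftD(4)[OF l] by (simp add: comp_assoc)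
    also have "\<dots> = (\<one> C \<boxtimes> \<Delta>) \<cdot> (\<Delta> \<cdot> x j)" unfolding comonoidD(4)[OF comonoid] by (simp add: comp_assoc)
    also have "\<dots> = (x q \<boxtimes> (x q \<boxtimes> x q)) \<cdot> ((ArMap F ?v \<boxtimes> d) \<cdot> \<delta>)"
      unfolding liftD(4)[OF l, symmetric] by (simp add: merge d(2) leg_nat[OF v2])
    finally show ?thesis by (simp only: d_def)
  qed
  \<comment> \<open>Coassociativity of \<open>C\<close> has made the two arrows equal in the triple
    tensor product; at the index \<open>r\<close> they are equal in the diagram.\<close>
  then obtain r z where z: "z \<in> hom J q r" 
      "ArMap F3 z \<cdot> (?\<alpha> \<cdot> ((?\<delta> \<boxtimes> ArMap F ?v) \<cdot> \<delta>)) = ArMap F3 z \<cdot> ((ArMap F ?v \<boxtimes> ?\<delta>) \<cdot> \<delta>)"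
    by (rule stage_eq[OF functor_F3 colimit_F3 o(1) qo, rotated 2]) (simp_all add: hom_def)
  have ro: "r \<in> Ob J" using Job[OF z(1)] by auto
  note [simp] = ro homD[OF Far[OF z(1)]]
  let ?v3 = "z \<cdot>\<^bsub>J\<^esub> ?v" and ?\<delta>3 = "push z ?\<delta>"
  show ?thesis
  proof (rule that)
    show "counital k r ?v3 ?\<delta>3" by (rule counital_push[OF c2 z(1)])
    have "push ?v3 \<delta> = push z (push ?v \<delta>)" unfolding Fcomp[OF v2 z(1)] by (simp add: tens_comp_assoc)
    also have "\<dots> = push z (?\<delta> \<cdot> ArMap F u)" unfolding e2 ..
    finally show "?\<delta>3 \<cdot> ArMap F u = push ?v3 \<delta>" by (simp add: comp_assoc)
    define d where "d = ?\<delta>"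
    have d: "d \<in> Ar V \<and> Dom V d = ObMap F k \<and> Cod V d = ObMap F q \<otimes> ObMap F q" 
      unfolding d_def using liftD[OF l2] by auto
    note [simp] = d(1)
    let ?F = "ArMap F z"
    have n: "\<alpha> (ObMap F r) (ObMap F r) (ObMap F r) \<cdot> (?F \<boxtimes> ?F \<boxtimes> ?F) = (?F \<boxtimes> (?F \<boxtimes> ?F)) \<cdot> ?\<alpha>"
      by (rule assoc_nat) simp_all
    have "\<alpha> (ObMap F r) (ObMap F r) (ObMap F r) \<cdot> ((push z d \<boxtimes> ArMap F ?v3) \<cdot> \<delta>) = 
       (\<alpha> (ObMap F r) (ObMap F r) (ObMap F r) \<cdot> (?F \<boxtimes> ?F \<boxtimes> ?F)) \<cdot> ((d \<boxtimes> ArMap F ?v) \<cdot> \<delta>)"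
      unfolding Fcomp[OF v2 z(1)] by (simp add: merge)
    also have "\<dots> = (?F \<boxtimes> (?F \<boxtimes> ?F)) \<cdot> (?\<alpha> \<cdot> ((d \<boxtimes> ArMap F ?v) \<cdot> \<delta>))" unfolding n by (simp add: comp_assoc)
    also have "\<dots> = (?F \<boxtimes> (?F \<boxtimes> ?F)) \<cdot> ((ArMap F ?v \<boxtimes> d) \<cdot> \<delta>)" using z(2) by (simp only: d_def tensor_diagram_simps)
    also have "\<dots> = (ArMap F ?v3 \<boxtimes> push z d) \<cdot> \<delta>" unfolding Fcomp[OF v2 z(1)] by (simp add: merge)
    finally show "\<alpha> (ObMap F r) (ObMap F r) (ObMap F r) \<cdot> ((?\<delta>3 \<boxtimes> ArMap F ?v3) \<cdot> \<delta>) = (ArMap F ?v3 \<boxtimes> ?\<delta>3) \<cdot> \<delta>"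
      by (simp only: d_def)
  qed
qed

lemma chain:
  assumes j: "j \<in> Ob J"
  obtains i u \<delta> where "i 0 = j" "\<forall>k. counital (i k) (i (Suc k)) (u k) (\<delta> k)"
    "\<forall>k. \<delta> (Suc k) \<cdot> ArMap F (u k) = push (u (Suc k)) (\<delta> k)"
    "\<forall>k. \<alpha> (ObMap F (i (Suc (Suc k)))) (ObMap F (i (Suc (Suc k)))) (ObMap F (i (Suc (Suc k)))) \<cdot> ((\<delta> (Suc k) \<boxtimes> ArMap F (u (Suc k))) \<cdot> \<delta> k)
       = (ArMap F (u (Suc k)) \<boxtimes> \<delta> (Suc k)) \<cdot> \<delta> k"
proof -
  \<comment> \<open>A state records source index, target index, transition arrow and lift. The
    clause for \<open>n = 0\<close> pins the start to \<open>j\<close>, and \<open>k' = k\<close> in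
    \<open>?Q\<close> glues each step to the target of the one before.\<close>
  let ?P = "\<lambda>(n::nat) (j', k, u, \<delta>). counital j' k u \<delta> \<and> (n = 0 \<longrightarrow> j' = j)"
  let ?Q = "\<lambda>(n::nat) (j, k, u, \<delta>) (k', l, v, \<delta>'). k' = k \<and> \<delta>' \<cdot> ArMap F u = push v \<delta> \<and>
    \<alpha> (ObMap F l) (ObMap F l) (ObMap F l) \<cdot> ((\<delta>' \<boxtimes> ArMap F v) \<cdot> \<delta>) = (ArMap F v \<boxtimes> \<delta>') \<cdot> \<delta>"
  have "\<exists>f. \<forall>n. ?P n (f n) \<and> ?Q n (f n) (f (Suc n))"
  proof (rule dependent_nat_choice)
    obtain k u \<delta> where "counital j k u \<delta>" by (rule counital_exists[OF j])
    then show "\<exists>s. ?P 0 s" by (intro exI[of _ "(j, k, u, \<delta>)"]) simp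
    fix s n assume s: "?P n s"
    obtain j' k u \<delta> where ss: "s = (j', k, u, \<delta>)" by (cases s)
    obtain l v \<delta>' where "counital k l v \<delta>'" "\<delta>' \<cdot> ArMap F u = push v \<delta>"
      "\<alpha> (ObMap F l) (ObMap F l) (ObMap F l) \<cdot> ((\<delta>' \<boxtimes> ArMap F v) \<cdot> \<delta>) = (ArMap F v \<boxtimes> \<delta>') \<cdot> \<delta>"
      by (rule chain_step[of j' k u \<delta>]) (use s in \<open>simp_all add: ss\<close>)
    then show "\<exists>s'. ?P (Suc n) s' \<and> ?Q n s s'" by (intro exI[of _ "(k, l, v, \<delta>')"]) (simp add: ss)
  qed
  then obtain f where f: "\<forall>n. ?P n (f n) \<and> ?Q n (f n) (f (Suc n))" ..
  define i k u \<delta> where "i n = fst (f n)" "k n = fst (snd (f n))" "u n = fst (snd (snd (f n)))" "\<delta> n = snd (snd (snd (f n)))" for n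
  then have fn: "f n = (i n, k n, u n, \<delta> n)" for n by simp
  have k: "k n = i (Suc n)" for n using f[rule_format, of n] by (simp add: fn)
  show ?thesis
    by (rule that[of i u \<delta>]) (use f in \<open>simp_all add: fn k\<close>)
qed

end

context comonoid_presentation
begin

text \<open>The lifts along a chain form a cocone and induce a comultiplication on its colimit; the
  legs into \<open>C\<close> induce the morphism to \<open>C\<close>. The conclusion holds for every
  colimit of the chain, so that a colimit fixed in advance for each chain can be used later.\<close>

lemma subcomonoid:
  assumes j: "j \<in> Ob J"
  obtains i u where "i 0 = j" "\<forall>k. i k \<in> Ob J" "\<forall>k. u k \<in> hom J (i k) (i (Suc k))"
    "\<forall>D d. graph_colimit V UNIV (\<lambda>k. ObMap F (i k)) (chain_edges (\<lambda>k. ArMap F (u k))) D d \<longrightarrow>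
       (\<exists>\<Delta>' \<epsilon>' h. is_comonoid V (D, \<Delta>', \<epsilon>') \<and> is_comonoid_hom V (D, \<Delta>', \<epsilon>') h (C, \<Delta>, \<epsilon>) \<and> h \<cdot> d 0 = x j)"
proof -
  obtain i u \<delta> where i0: "i 0 = j" and c: "\<forall>k. counital (i k) (i (Suc k)) (u k) (\<delta> k)"
    and compat: "\<forall>k. \<delta> (Suc k) \<cdot> ArMap F (u k) = push (u (Suc k)) (\<delta> k)"
    and coassoc: "\<forall>k. \<alpha> (ObMap F (i (Suc (Suc k)))) (ObMap F (i (Suc (Suc k)))) (ObMap F (i (Suc (Suc k)))) \<cdot> ((\<delta> (Suc k) \<boxtimes> ArMap F (u (Suc k))) \<cdot> \<delta> k)
       = (ArMap F (u (Suc k)) \<boxtimes> \<delta> (Suc k)) \<cdot> \<delta> k"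
    by (rule chain[OF j])
  note c = c[rule_format] and compat = compat[rule_format] and coassoc = coassoc[rule_format]
  have u: "u k \<in> hom J (i k) (i (Suc k))" and l: "lift (i k) (i (Suc k)) (\<delta> k)" for k
    using c[of k] by (auto simp: counital_def)
  have io: "i k \<in> Ob J" for k using Job[OF u[of k]] by simp
  have cl: "\<lambda>\<^sub>I (ObMap F (i (Suc k))) \<cdot> (((\<epsilon> \<cdot> x (i (Suc k))) \<boxtimes> \<one> (ObMap F (i (Suc k)))) \<cdot> \<delta> k) = ArMap F (u k)"
    and cr: "\<rho>\<^sub>I (ObMap F (i (Suc k))) \<cdot> ((\<one> (ObMap F (i (Suc k))) \<boxtimes> (\<epsilon> \<cdot> x (i (Suc k)))) \<cdot> \<delta> k) = ArMap F (u k)" for k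
    using c[of k] by (auto simp: counital_def)
  define X w y where "X k = ObMap F (i k)" and "w k = ArMap F (u k)" and "y k = x (i k)" for k
  have [simp]: "X k \<in> Ob V" for k using io by (simp add: X_def)
  have w: "w k \<in> hom V (X k) (X (Suc k))" for k using Far[OF u] by (simp add: X_def w_def)
  have y: "y k \<in> hom V (X k) C" for k using leg[OF io] by (simp add: X_def y_def)
  have \<delta>: "\<delta> k \<in> Ar V \<and> Dom V (\<delta> k) = X k \<and> Cod V (\<delta> k) = X (Suc k) \<otimes> X (Suc k)" for k
    using liftD(3)[OF l] by (simp add: X_def)
  note [simp] = homD[OF w] homD[OF y] \<delta>
  have lift: "(y (Suc k) \<boxtimes> y (Suc k)) \<cdot> \<delta> k = \<Delta> \<cdot> y k" for k using liftD(4)[OF l[of k]] by (simp add: y_def)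
  have yw: "y (Suc k) \<cdot> w k = y k" for k using leg_nat[OF u] by (simp add: y_def w_def)
  note cl = cl[folded X_def w_def y_def] and cr = cr[folded X_def w_def y_def] 
    and compat = compat[folded w_def] and coassoc = coassoc[folded X_def w_def]
  show ?thesis
  proof (rule that[of i u, OF i0], fold X_def w_def, intro allI io, intro allI u, intro allI impI)
    fix D d assume "graph_colimit V UNIV X (chain_edges w) D d"
    then have D: "graph_colimit V UNIV X (chain_edges w) D d" .
    have epi: "jointly_epi V UNIV D d" and cc: "graph_cocone V UNIV X (chain_edges w) D d"
      using D by (simp_all add: graph_colimit_def)
    have [simp]: "D \<in> Ob V" using cc by (simp add: graph_cocone_def)
    have d: "d k \<in> hom V (X k) D" for k using cc by (simp add: graph_cocone_def)
    have dw: "d (Suc k) \<cdot> w k = d k" for k using cc by (simp add: graph_cocone_def chain_edges_def)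
    note [simp] = homD[OF d]
    have "graph_cocone V UNIV X (chain_edges w) C y"
      unfolding graph_cocone_def chain_edges_def using y yw by (auto simp: hom_def)
    then obtain h where h: "h \<in> hom V D C" "\<And>k. h \<cdot> d k = y k" 
      by (rule graph_colimit_desc[OF D]) simp
    \<comment> \<open>The lift at stage \<open>k\<close> lands at stage \<open>Suc k\<close>, hence
      the shifted legs. Compatibility of consecutive lifts is exactly the cocone equation.\<close>
    have "graph_cocone V UNIV X (chain_edges w) (D \<otimes> D) (\<lambda>k. (d (Suc k) \<boxtimes> d (Suc k)) \<cdot> \<delta> k)"
      unfolding graph_cocone_def chain_edges_def
      by (auto simp: hom_def comp_assoc compat tens_comp_assoc dw)
    then obtain \<Delta>' where \<Delta>': "\<Delta>' \<in> hom V D (D \<otimes> D)" "\<And>k. \<Delta>' \<cdot> d k = (d (Suc k) \<boxtimes> d (Suc k)) \<cdot> \<delta> k"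
      by (rule graph_colimit_desc[OF D]) simp
    note [simp] = homD[OF h(1)] homD[OF \<Delta>'(1)]
    \<comment> \<open>With this choice \<open>h\<close> preserves counits by definition, and the
      counit laws of \<open>D\<close> become those recorded in \<open>counital\<close>.\<close>
    let ?\<epsilon> = "\<epsilon> \<cdot> h"
    have "\<alpha> D D D \<cdot> ((\<Delta>' \<boxtimes> \<one> D) \<cdot> \<Delta>') = (\<one> D \<boxtimes> \<Delta>') \<cdot> \<Delta>'"
    proof (rule jointly_epiD[OF epi])
      fix k :: nat
      let ?k = "Suc k" and ?l = "Suc (Suc k)"
      \<comment> \<open>Comultiplying one factor a second time moves it to stage
        \<open>Suc (Suc k)\<close>. The other factor is brought there by \<open>dw\<close>, after
        which the coassociativity of two consecutive lifts applies.\<close>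
      have "\<alpha> D D D \<cdot> ((\<Delta>' \<boxtimes> \<one> D) \<cdot> \<Delta>') \<cdot> d k = \<alpha> D D D \<cdot> ((((d ?l \<boxtimes> d ?l) \<cdot> \<delta> ?k) \<boxtimes> (d ?l \<cdot> w ?k)) \<cdot> \<delta> k)"
        by (simp add: merge \<Delta>'(2) dw)
      also have "\<dots> = (\<alpha> D D D \<cdot> (d ?l \<boxtimes> d ?l \<boxtimes> d ?l)) \<cdot> ((\<delta> ?k \<boxtimes> w ?k) \<cdot> \<delta> k)"
        by (simp add: merge)
      also have "\<alpha> D D D \<cdot> (d ?l \<boxtimes> d ?l \<boxtimes> d ?l) = (d ?l \<boxtimes> (d ?l \<boxtimes> d ?l)) \<cdot> \<alpha> (X ?l) (X ?l) (X ?l)"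
        by (rule assoc_nat) simp_all
      also have "(d ?l \<boxtimes> (d ?l \<boxtimes> d ?l)) \<cdot> \<alpha> (X ?l) (X ?l) (X ?l) \<cdot> ((\<delta> ?k \<boxtimes> w ?k) \<cdot> \<delta> k) = 
         (d ?l \<boxtimes> (d ?l \<boxtimes> d ?l)) \<cdot> ((w ?k \<boxtimes> \<delta> ?k) \<cdot> \<delta> k)"
        by (simp add: comp_assoc coassoc)
      also have "\<dots> = ((d ?l \<cdot> w ?k) \<boxtimes> ((d ?l \<boxtimes> d ?l) \<cdot> \<delta> ?k)) \<cdot> \<delta> k" by (simp add: tens_comp_assoc)
      also have "\<dots> = (\<one> D \<boxtimes> \<Delta>') \<cdot> \<Delta>' \<cdot> d k" 
        by (simp add: merge \<Delta>'(2) dw)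
      finally show "\<alpha> D D D \<cdot> ((\<Delta>' \<boxtimes> \<one> D) \<cdot> \<Delta>') \<cdot> d k = (\<one> D \<boxtimes> \<Delta>') \<cdot> \<Delta>' \<cdot> d k" .
    qed (auto simp: hom_def)
    moreover have "\<lambda>\<^sub>I D \<cdot> ((?\<epsilon> \<boxtimes> \<one> D) \<cdot> \<Delta>') = \<one> D"
    proof (rule jointly_epiD[OF epi])
      fix k :: nat
      let ?k = "Suc k"
      have "\<lambda>\<^sub>I D \<cdot> ((?\<epsilon> \<boxtimes> \<one> D) \<cdot> \<Delta>') \<cdot> d k = (\<lambda>\<^sub>I D \<cdot> (\<one> I \<boxtimes> d ?k)) \<cdot> (((\<epsilon> \<cdot> y ?k) \<boxtimes> \<one> (X ?k)) \<cdot> \<delta> k)"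
        by (simp add: merge \<Delta>'(2) h(2))
      also have "\<lambda>\<^sub>I D \<cdot> (\<one> I \<boxtimes> d ?k) = d ?k \<cdot> \<lambda>\<^sub>I (X ?k)" by (rule lunit_nat) simp_all
      finally show "\<lambda>\<^sub>I D \<cdot> ((?\<epsilon> \<boxtimes> \<one> D) \<cdot> \<Delta>') \<cdot> d k = \<one> D \<cdot> d k" by (simp add: comp_assoc cl dw)
    qed (auto simp: hom_def)
    moreover have "\<rho>\<^sub>I D \<cdot> ((\<one> D \<boxtimes> ?\<epsilon>) \<cdot> \<Delta>') = \<one> D"
    proof (rule jointly_epiD[OF epi])
      fix k :: nat
      let ?k = "Suc k"
      have "\<rho>\<^sub>I D \<cdot> ((\<one> D \<boxtimes> ?\<epsilon>) \<cdot> \<Delta>') \<cdot> d k = (\<rho>\<^sub>I D \<cdot> (d ?k \<boxtimes> \<one> I)) \<cdot> ((\<one> (X ?k) \<boxtimes> (\<epsilon> \<cdot> y ?k)) \<cdot> \<delta> k)"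
        by (simp add: merge \<Delta>'(2) h(2))
      also have "\<rho>\<^sub>I D \<cdot> (d ?k \<boxtimes> \<one> I) = d ?k \<cdot> \<rho>\<^sub>I (X ?k)" by (rule runit_nat) simp_all
      finally show "\<rho>\<^sub>I D \<cdot> ((\<one> D \<boxtimes> ?\<epsilon>) \<cdot> \<Delta>') \<cdot> d k = \<one> D \<cdot> d k" by (simp add: comp_assoc cr dw)
    qed (auto simp: hom_def)
    ultimately have "is_comonoid V (D, \<Delta>', ?\<epsilon>)" unfolding is_comonoid_def by (simp add: hom_def comp_assoc)
    moreover have "\<Delta> \<cdot> h = (h \<boxtimes> h) \<cdot> \<Delta>'"
    proof (rule jointly_epiD[OF epi])
      show "\<Delta> \<cdot> h \<cdot> d k = (h \<boxtimes> h) \<cdot> \<Delta>' \<cdot> d k" for k by (simp add: merge \<Delta>'(2) h(2) lift)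
    qed (auto simp: hom_def)
    then have "is_comonoid_hom V (D, \<Delta>', ?\<epsilon>) h (C, \<Delta>, \<epsilon>)" by (simp add: is_comonoid_hom_def h(1))
    moreover have "h \<cdot> d 0 = x j" by (simp add: h(2) y_def i0)
    ultimately show "\<exists>\<Delta>' \<epsilon>' h. is_comonoid V (D, \<Delta>', \<epsilon>') \<and> is_comonoid_hom V (D, \<Delta>', \<epsilon>') h (C, \<Delta>, \<epsilon>) \<and> h \<cdot> d 0 = x j"
      by blast
  qed
qed

end

section \<open>The terminal measuring\<close>

lemma (in measurings) meas_graph:
  assumes G: "\<And>i. i \<in> J \<Longrightarrow> meas (G i)" and E: "\<And>i u j. (i, u, j) \<in> E \<Longrightarrow> i \<in> J \<and> j \<in> J \<and> mhom (G i) u (G j)"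
  shows "graph V J (\<lambda>i. fst (G i)) E"
  unfolding graph_def
proof (intro conjI ballI)
  show "fst (G i) \<in> Ob V" if "i \<in> J" for i by (rule meas_ob[OF G[OF that]])
  show "case e of (i, u, j) \<Rightarrow> i \<in> J \<and> j \<in> J \<and> u \<in> hom V (fst (G i)) (fst (G j))" if "e \<in> E" for e
    using that E mhom_hom by (cases e) blast
qed

locale presentable_measurings = measurings V A m \<eta> B n \<theta> + inaccessible_cardinal \<kappa> 
  for V :: "('o, 'a, 'z) smc_category_scheme" (structure) and A m \<eta> B n \<theta> and \<kappa> :: "'u rel" +
  fixes \<mu> :: "'u rel" and P :: "'o set"
  assumes cocomplete: "cocomplete \<kappa> V" and locally_small: "locally_small \<kappa> V" and aleph0: "natLeq \<le>o \<mu>"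
    and small_P: "small P" and presentable_P: "\<And>K. K \<in> P \<Longrightarrow> presentable \<kappa> \<mu> V K"
    and presentation: "\<And>X. X \<in> Ob V \<Longrightarrow> \<exists>(J::('u, 'u) category) F c. small_category \<kappa> J \<and> filtered \<mu> J \<and> is_functor J V F \<and>
            (\<forall>j\<in>Ob J. ObMap F j \<in> P) \<and> is_colimit V J F X c"
begin

lemmas small_colimit = small_graph_colimit[OF category cocomplete]

lemma small_hom: "X \<in> Ob V \<Longrightarrow> Y \<in> Ob V \<Longrightarrow> small (hom V X Y)"
  using locally_small by (simp add: locally_small_def)

lemma P_ob: "K \<in> P \<Longrightarrow> K \<in> Ob V"
  using presentable_P by (auto simp: presentable_def)

definition chains :: "((nat \<Rightarrow> 'o) \<times> (nat \<Rightarrow> 'a)) set" where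
  "chains = {(X, w). \<forall>k. X k \<in> P \<and> w k \<in> hom V (X k) (X (Suc k))}"

lemma small_chains: "small chains"
proof (rule small_subset)
  let ?H = "\<Union>K\<in>P. \<Union>L\<in>P. hom V K L"
  have "small ?H" by (intro small_UN small_P small_hom P_ob)
  then show "small ({X :: nat \<Rightarrow> 'o. range X \<subseteq> P} \<times> {w :: nat \<Rightarrow> 'a. range w \<subseteq> ?H})"
    by (intro small_Times small_sequences small_P)
  show "chains \<subseteq> {X :: nat \<Rightarrow> 'o. range X \<subseteq> P} \<times> {w :: nat \<Rightarrow> 'a. range w \<subseteq> ?H}"
    unfolding chains_def by fastforce
qed

text \<open>One colimit is fixed for each chain. Without this choice the isomorphic copies of a
  colimit could fail to form a small set.\<close>

definition chain_colimit :: "(nat \<Rightarrow> 'o) \<times> (nat \<Rightarrow> 'a) \<Rightarrow> 'o \<times> (nat \<Rightarrow> 'a)" where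
  "chain_colimit = (\<lambda>(X, w). SOME (D, d). graph_colimit V UNIV X (chain_edges w) D d)"

lemma chain_colimit:
  assumes "(X, w) \<in> chains" "chain_colimit (X, w) = (D, d)"
  shows "graph_colimit V UNIV X (chain_edges w) D d"
proof -
  have "graph V UNIV X (chain_edges w)"
    using assms(1) P_ob by (auto simp: graph_def chain_edges_def chains_def)
  moreover have "small (chain_edges w)" unfolding chain_edges_def by (intro small_image small_nat)
  ultimately obtain D' d' where "graph_colimit V UNIV X (chain_edges w) D' d'"
    using small_colimit[OF _ small_nat] by blast
  then have "\<exists>p. case p of (D, d) \<Rightarrow> graph_colimit V UNIV X (chain_edges w) D d" by blast
  from someI_ex[OF this] show ?thesis using assms(2) by (simp add: chain_colimit_def)
qed

text \<open>All measurings on the chosen carriers are included, whatever their structure arrows.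
  Local smallness bounds the possible structures on each carrier.\<close>

definition small_meas :: "('o \<times> 'a \<times> 'a \<times> 'a) set" where
  "small_meas = {s. meas s \<and> fst s \<in> (fst \<circ> chain_colimit) ` chains}"

lemma small_small_meas: "small small_meas"
proof (rule small_subset)
  let ?S = "(fst \<circ> chain_colimit) ` chains \<inter> Ob V"
  have S: "small ?S" by (rule small_subset[OF small_image[OF small_chains]]) blast
  show "small (SIGMA D:?S. hom V D (D \<otimes> D) \<times> hom V D I \<times> hom V (A \<otimes> D) B)"
    by (intro small_Sigma small_Times S small_hom) auto
  show "small_meas \<subseteq> (SIGMA D:?S. hom V D (D \<otimes> D) \<times> hom V D I \<times> hom V (A \<otimes> D) B)"
  proof
    fix s assume s: "s \<in> small_meas"
    obtain D \<Delta> \<epsilon> t where ss: "s = (D, \<Delta>, \<epsilon>, t)" by (cases s)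
    have "meas (D, \<Delta>, \<epsilon>, t)" using s by (simp add: small_meas_def ss)
    note d = measD[OF this] comonoidD(1-3)[OF measD(1)[OF this]]
    show "s \<in> (SIGMA D:?S. hom V D (D \<otimes> D) \<times> hom V D I \<times> hom V (A \<otimes> D) B)"
      using s d by (auto simp: small_meas_def ss hom_def)
  qed
qed

lemma small_measD: "s \<in> small_meas \<Longrightarrow> meas s"
  by (simp add: small_meas_def)

text \<open>A presentable \<open>K\<close> maps into one stage of a filtered presentation of
  \<open>X\<close>, and the chain started at that stage yields a comonoid over \<open>X\<close>
  through which the leg factors. Restricting the measuring of \<open>X\<close> along this comonoid
  morphism makes it a small measuring over \<open>X\<close>.\<close>

lemma factor_small_meas:
  assumes X: "meas X" and K: "K \<in> P" and f: "f \<in> hom V K (fst X)"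
  obtains s g h where "s \<in> small_meas" "g \<in> hom V K (fst s)" "mhom s h X" "f = h \<cdot> g"
proof -
  obtain C \<Delta> \<epsilon> t where XX: "X = (C, \<Delta>, \<epsilon>, t)" by (cases X)
  note X' = measD[OF X[unfolded XX]]
  note com = comonoidD(1-3)[OF X'(1)]
  obtain J :: "('u, 'u) category" and F x where J: "small_category \<kappa> J" "filtered \<mu> J" "is_functor J V F"
    "\<And>j. j \<in> Ob J \<Longrightarrow> ObMap F j \<in> P" "is_colimit V J F C x"
    using presentation[OF com(1)] by auto
  have cJ: "category J" using J(2) by (simp add: filtered_def)
  have inf: "infinite (UNIV :: 'u set)" using infinite_field finite_subset subset_UNIV by blast
  interpret C: comonoid_presentation V \<kappa> \<mu> J F C x \<Delta> \<epsilon>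
  proof (intro comonoid_presentation.intro comonoid_presentation_axioms.intro smc_cat_axioms inaccessible_cardinal_axioms)
    show "filtered_category J \<mu>"
      using cJ J(2) aleph0 inf by (intro filtered_category.intro cat.intro filtered_category_axioms.intro)
  qed (use J X'(1) presentable_P in auto)
  obtain a b :: 'u where ab: "a \<noteq> b" by (rule C.distinct_elements)
  have f': "f \<in> hom V K C" using f by (simp add: XX)
  obtain j g where g: "j \<in> Ob J" "g \<in> hom V K (ObMap F j)" "f = x j \<cdot> g"
    by (rule presentable_factor[OF inaccessible ab category presentable_P[OF K] J(1,2,3,5) f'])
  obtain i u where i0: "i 0 = j" and iu: "\<forall>k. i k \<in> Ob J" "\<forall>k. u k \<in> hom J (i k) (i (Suc k))"
    and sub: "\<forall>D d. graph_colimit V UNIV (\<lambda>k. ObMap F (i k)) (chain_edges (\<lambda>k. ArMap F (u k))) D d \<longrightarrow>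
       (\<exists>\<Delta>' \<epsilon>' h. is_comonoid V (D, \<Delta>', \<epsilon>') \<and> is_comonoid_hom V (D, \<Delta>', \<epsilon>') h (C, \<Delta>, \<epsilon>) \<and> h \<cdot> d 0 = x j)"
    by (rule C.subcomonoid[OF g(1)])
  have ch: "(\<lambda>k. ObMap F (i k), \<lambda>k. ArMap F (u k)) \<in> chains"
    using iu J(4) C.Far by (simp add: chains_def)
  obtain D d where Dd: "chain_colimit (\<lambda>k. ObMap F (i k), \<lambda>k. ArMap F (u k)) = (D, d)" by fastforce
  note D = chain_colimit[OF ch Dd]
  obtain \<Delta>' \<epsilon>' h where h: "is_comonoid V (D, \<Delta>', \<epsilon>')" "is_comonoid_hom V (D, \<Delta>', \<epsilon>') h (C, \<Delta>, \<epsilon>)" "h \<cdot> d 0 = x j"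
    using sub[rule_format, OF D] by blast
  let ?s = "(D, \<Delta>', \<epsilon>', t \<cdot> (\<one> A \<boxtimes> h))"
  have s: "meas ?s"
    using measuring_comonoid_hom[OF monoid_B X'(1) monoid_A h(1,2) X'(5)] h(1) by (simp add: meas_def)
  moreover have "D \<in> (fst \<circ> chain_colimit) ` chains" using ch Dd by force
  ultimately have "?s \<in> small_meas" by (simp add: small_meas_def)
  moreover have "d 0 \<cdot> g \<in> hom V K (fst ?s)"
  proof -
    have "d 0 \<in> hom V (ObMap F j) D" using graph_colimit_cocone[OF D] i0 by (auto simp: graph_cocone_def)
    then show ?thesis using comp_hom[OF g(2)] by simp
  qed
  moreover have "mhom ?s h X" using h(2) by (simp add: mhom_def XX)
  moreover have "f = h \<cdot> (d 0 \<cdot> g)"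
  proof -
    have "d 0 \<in> hom V (ObMap F j) D" using graph_colimit_cocone[OF D] i0 by (auto simp: graph_cocone_def)
    moreover have "h \<in> hom V D C" using h(2) by (simp add: is_comonoid_hom_def)
    ultimately show ?thesis using g(2,3) h(3) comp_assoc[of g "d 0" h] by (simp add: hom_def)
  qed
  ultimately show ?thesis by (rule that)
qed

text \<open>Generalized elements of small measurings at presentable objects. The source of
  \<open>g\<close> is not recorded separately, because an arrow determines its domain.\<close>

definition pairs :: "(('o \<times> 'a \<times> 'a \<times> 'a) \<times> 'a) set" where
  "pairs = (SIGMA s:small_meas. \<Union>K\<in>P. hom V K (fst s))"

lemma small_pairs: "small pairs"
  unfolding pairs_def using small_measD by (intro small_Sigma small_small_meas small_UN small_P small_hom P_ob meas_ob)

definition compatible where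
  "compatible R z \<longleftrightarrow> (\<forall>((s, g), (s', g'))\<in>R. z s \<cdot> g = z s' \<cdot> g')"

text \<open>\<open>Y\<close> is, as an object of \<open>V\<close>, the universal recipient of an \<open>R\<close>-compatible family of arrows
  from the small measurings. Such a measuring is determined by \<open>R\<close> up to isomorphism.\<close>

definition represents where
  "represents R Y \<iota> \<longleftrightarrow> meas Y \<and> (\<forall>s\<in>small_meas. mhom s (\<iota> s) Y) \<and> compatible R \<iota> \<and>
     (\<forall>Z z. Z \<in> Ob V \<and> (\<forall>s\<in>small_meas. z s \<in> hom V (fst s) Z) \<and> compatible R z \<longrightarrow>
        (\<exists>k\<in>hom V (fst Y) Z. \<forall>s\<in>small_meas. k \<cdot> \<iota> s = z s)) \<and>
     jointly_epi V small_meas (fst Y) \<iota>"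

text \<open>The choice depends on \<open>R\<close> alone and not on the measuring that gave rise to
  it. This makes the solution set an image of a small set of relations.\<close>

definition representative where
  "representative R = (SOME Y. \<exists>\<iota>. represents R Y \<iota>)"

definition solution_set where
  "solution_set = representative ` {R. R \<subseteq> pairs \<times> pairs \<and> (\<exists>Y \<iota>. represents R Y \<iota>)}"

lemma representative:
  assumes "represents R Y \<iota>" shows "\<exists>\<iota>. represents R (representative R) \<iota>"
  unfolding representative_def using someI_ex[of "\<lambda>Y. \<exists>\<iota>. represents R Y \<iota>"] assms by blast

lemma solution_setD: "Y \<in> solution_set \<Longrightarrow> meas Y"
proof -
  assume "Y \<in> solution_set"
  then obtain R Y' \<iota> where R: "Y = representative R" "represents R Y' \<iota>" unfolding solution_set_def by blast
  obtain \<iota>' where "represents R Y \<iota>'" using representative[OF R(2)] unfolding R(1) by (elim exE)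
  then show "meas Y" unfolding represents_def by (rule conjunct1)
qed

lemma small_solution_set: "small solution_set"
  unfolding solution_set_def
  by (intro small_image small_subset[OF small_Pow[OF small_Times[OF small_pairs small_pairs]]]) auto

text \<open>Identifying all parallel arrows from small measurings to \<open>X\<close> yields a quotient of \<open>X\<close>
  that is represented by the relation of becoming equal in \<open>X\<close>.\<close>

lemma represented_quotient:
  assumes X: "meas X"
  obtains R Q \<iota> q where "R \<subseteq> pairs \<times> pairs" "represents R Q \<iota>" "mhom X q Q"
proof -
  let ?I = "insert None (Some ` small_meas)"
  define G where "G = case_option X (\<lambda>s. s)"
  \<comment> \<open>The vertex \<open>None\<close> stands for \<open>X\<close>, and every arrow from
    a small measuring to \<open>X\<close> is an edge. In a cocone all edges out of
    \<open>Some s\<close> are thereby identified with a single leg. A small measuring with no arrow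
    to \<open>X\<close> remains an isolated vertex, which gives it a leg as well.\<close>
  define E :: "(('o \<times> 'a \<times> 'a \<times> 'a) option \<times> 'a \<times> ('o \<times> 'a \<times> 'a \<times> 'a) option) set"
    where "E = {(Some s, h, None) | s h. s \<in> small_meas \<and> mhom s h X}"
  have G: "meas (G i)" if "i \<in> ?I" for i using that X small_measD by (auto simp: G_def)
  have E: "i \<in> ?I \<and> j \<in> ?I \<and> mhom (G i) u (G j)" if "(i, u, j) \<in> E" for i u j
    using that by (auto simp: E_def G_def)
  have gr: "graph V ?I (\<lambda>i. fst (G i)) E"
    by (rule meas_graph[OF G E])
  have sI: "small ?I" using small_Un[OF small_finite[of "{None}"] small_image[OF small_small_meas, of Some]] by simp
  have sE: "small E"
  proof (rule small_image_subset)
    show "small (SIGMA s:small_meas. hom V (fst s) (fst X))"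
      by (intro small_Sigma small_small_meas small_hom meas_ob small_measD X)
    show "E \<subseteq> (\<lambda>(s, h). (Some s, h, None)) ` (SIGMA s:small_meas. hom V (fst s) (fst X))"
    proof
      fix e assume "e \<in> E"
      then obtain s h where "e = (Some s, h, None)" "s \<in> small_meas" "mhom s h X" unfolding E_def by blast
      then show "e \<in> (\<lambda>(s, h). (Some s, h, None)) ` (SIGMA s:small_meas. hom V (fst s) (fst X))"
        using mhom_hom by (intro image_eqI[of _ _ "(s, h)"]) (simp_all add: mhom_hom)
    qed
  qed
  obtain Q c where Q: "graph_colimit V ?I (\<lambda>i. fst (G i)) E Q c" by (rule small_colimit[OF gr sI sE])
  obtain \<Delta> \<epsilon> t where M1: "meas (Q, \<Delta>, \<epsilon>, t)" and M2: "\<forall>i\<in>?I. mhom (G i) (c i) (Q, \<Delta>, \<epsilon>, t)"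
    by (rule meas_colimit[OF G E Q])
  note M = M1 M2[rule_format]
  let ?Q = "(Q, \<Delta>, \<epsilon>, t)"
  \<comment> \<open>It does not matter which arrows \<open>h\<close> and \<open>h'\<close> witness
    the relation: after composition with \<open>?q\<close> each becomes the leg of its small
    measuring.\<close>
  define R where "R = {((s, g), (s', g')). (s, g) \<in> pairs \<and> (s', g') \<in> pairs \<and> (\<exists>h h'. mhom s h X \<and> mhom s' h' X \<and> h \<cdot> g = h' \<cdot> g')}"
  let ?\<iota> = "\<lambda>s. c (Some s)" and ?q = "c None"
  have q: "mhom X ?q ?Q" using M(2)[of None] by (simp add: G_def)
  have \<iota>: "mhom s (?\<iota> s) ?Q" if "s \<in> small_meas" for s using M(2)[of "Some s"] that by (simp add: G_def)
  have qh: "?q \<cdot> h = ?\<iota> s" if "s \<in> small_meas" "mhom s h X" for s h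
    using graph_colimit_cocone[OF Q] that unfolding graph_cocone_def E_def by blast
  have Xob: "fst X \<in> Ob V" by (rule meas_ob[OF X])
  obtain J :: "('u, 'u) category" and F x where J: "small_category \<kappa> J" "filtered \<mu> J" "is_functor J V F"
    "\<And>j. j \<in> Ob J \<Longrightarrow> ObMap F j \<in> P" "is_colimit V J F (fst X) x"
    using presentation[OF Xob] by auto
  note gX = J(5)[unfolded colimit_iff_graph_colimit[OF category J(3)]]
  have leg: "x j \<in> hom V (ObMap F j) (fst X)" if "j \<in> Ob J" for j
    using J(5) that by (auto simp: is_colimit_def is_cocone_def)
  \<comment> \<open>Each leg of a presentation of \<open>X\<close> has a presentable source and so
    factors through a small measuring. These factorizations express \<open>X\<close> through
    elements that \<open>R\<close> can compare.\<close>
  have "\<forall>j\<in>Ob J. \<exists>s g h. s \<in> small_meas \<and> g \<in> hom V (ObMap F j) (fst s) \<and> mhom s h X \<and> x j = h \<cdot> g"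
  proof
    fix j assume j: "j \<in> Ob J"
    obtain s g h where "s \<in> small_meas" "g \<in> hom V (ObMap F j) (fst s)" "mhom s h X" "x j = h \<cdot> g"
      by (rule factor_small_meas[OF X J(4)[OF j] leg[OF j]])
    then show "\<exists>s g h. s \<in> small_meas \<and> g \<in> hom V (ObMap F j) (fst s) \<and> mhom s h X \<and> x j = h \<cdot> g"
      by blast
  qed
  then obtain s g h where sgh: "\<forall>j\<in>Ob J. s j \<in> small_meas \<and> g j \<in> hom V (ObMap F j) (fst (s j)) \<and> mhom (s j) (h j) X \<and> x j = h j \<cdot> g j"
    unfolding bchoice_iff by (elim exE)
  then have s: "s j \<in> small_meas" and g: "g j \<in> hom V (ObMap F j) (fst (s j))" and h: "mhom (s j) (h j) X" 
    and xhg: "x j = h j \<cdot> g j" if "j \<in> Ob J" for j using that by auto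
  have Rsub: "R \<subseteq> pairs \<times> pairs" by (auto simp: R_def)
  have Rcompat: "compatible R ?\<iota>"
    unfolding compatible_def
  proof clarify
    fix s1 g1 s2 g2 assume "((s1, g1), (s2, g2)) \<in> R"
    then obtain h1 h2 where *: "s1 \<in> small_meas" "s2 \<in> small_meas" "mhom s1 h1 X" "mhom s2 h2 X" "h1 \<cdot> g1 = h2 \<cdot> g2"
      and gs: "g1 \<in> Ar V" "Cod V g1 = fst s1" "g2 \<in> Ar V" "Cod V g2 = fst s2" by (auto simp: R_def pairs_def hom_def)
    note [simp] = homD[OF mhom_hom[OF *(3)]] homD[OF mhom_hom[OF *(4)]] homD[OF mhom_hom[OF q]] gs
    have "c (Some s1) \<cdot> g1 = ?q \<cdot> (h1 \<cdot> g1)" by (simp add: comp_reduce[OF qh[OF *(1,3)]])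
    also have "\<dots> = c (Some s2) \<cdot> g2" unfolding *(5) by (simp add: comp_reduce[OF qh[OF *(2,4)]])
    finally show "c (Some s1) \<cdot> g1 = c (Some s2) \<cdot> g2" .
  qed
  have desc: "\<exists>k\<in>hom V (fst ?Q) Z. \<forall>s\<in>small_meas. k \<cdot> ?\<iota> s = z s" 
    if Z: "Z \<in> Ob V" and z: "\<forall>s\<in>small_meas. z s \<in> hom V (fst s) Z" and Rz: "compatible R z" for Z z
  proof -
    have R: "z s1 \<cdot> g1 = z s2 \<cdot> g2" if "s1 \<in> small_meas" "s2 \<in> small_meas" "K \<in> P" "g1 \<in> hom V K (fst s1)" "g2 \<in> hom V K (fst s2)"
      "mhom s1 h1 X" "mhom s2 h2 X" "h1 \<cdot> g1 = h2 \<cdot> g2" for s1 s2 K g1 g2 h1 h2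
    proof -
      have "((s1, g1), (s2, g2)) \<in> R" using that by (auto simp: R_def pairs_def)
      then show ?thesis using Rz by (auto simp: compatible_def)
    qed
    have zh: "z s' \<in> hom V (fst s') Z" if "s' \<in> small_meas" for s' using z that by blast
    have Fu: "ArMap F u \<in> hom V (ObMap F (Dom J u)) (ObMap F (Cod J u)) \<and> Dom J u \<in> Ob J \<and> Cod J u \<in> Ob J" if "u \<in> Ar J" for u
      using J(3) that by (auto simp: is_functor_def category_def)
    \<comment> \<open>The family \<open>z\<close> prescribes an arrow out of \<open>X\<close> on the
      legs of its presentation. Along a transition arrow the two prescriptions belong to elements
      that agree in \<open>X\<close>, hence to a pair in \<open>R\<close>, and compatibility makes
      them equal.\<close>
    have "is_cocone V J F Z (\<lambda>j. z (s j) \<cdot> g j)"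
      unfolding is_cocone_def
    proof (intro conjI ballI Z)
      fix j assume "j \<in> Ob J" then show "z (s j) \<cdot> g j \<in> hom V (ObMap F j) Z" using comp_hom[OF g zh[OF s]] by blast
    next
      fix u assume u: "u \<in> Ar J"
      let ?j = "Dom J u" and ?k = "Cod J u"
      have o: "?j \<in> Ob J" "?k \<in> Ob J" and Fu: "ArMap F u \<in> hom V (ObMap F ?j) (ObMap F ?k)" using Fu[OF u] by auto
      note [simp] = homD[OF Fu] homD[OF g[OF o(1)]] homD[OF g[OF o(2)]] homD[OF mhom_hom[OF h[OF o(1)]]] homD[OF mhom_hom[OF h[OF o(2)]]] homD[OF zh[OF s[OF o(2)]]]
      have "x ?k \<cdot> ArMap F u = x ?j" using J(5) u by (auto simp: is_colimit_def is_cocone_def)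
      then have e: "h ?k \<cdot> (g ?k \<cdot> ArMap F u) = h ?j \<cdot> g ?j" unfolding xhg[OF o(1)] xhg[OF o(2)] by (simp add: comp_assoc)
      have "z (s ?k) \<cdot> (g ?k \<cdot> ArMap F u) = z (s ?j) \<cdot> g ?j"
        by (rule R[OF s[OF o(2)] s[OF o(1)] J(4)[OF o(1)] comp_hom[OF Fu g[OF o(2)]] g[OF o(1)] h[OF o(2)] h[OF o(1)] e])
      then show "z (s ?k) \<cdot> g ?k \<cdot> ArMap F u = z (s ?j) \<cdot> g ?j" by (simp add: comp_assoc)
    qed
    then obtain w where w: "w \<in> hom V (fst X) Z" "\<forall>j\<in>Ob J. w \<cdot> x j = z (s j) \<cdot> g j"
      using J(5) unfolding is_colimit_def by blast
    have wh: "w \<cdot> h1 = z s1" if s1: "s1 \<in> small_meas" and h1: "mhom s1 h1 X" for s1 h1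
    proof -
      have o1: "fst s1 \<in> Ob V" using s1 small_measD meas_ob by blast
      \<comment> \<open>Equality of arrows out of \<open>s1\<close> is tested on a presentation of
        its own. Each composite \<open>h1 \<cdot> y i\<close> factors through some stage of the
        presentation of \<open>X\<close>, where \<open>R\<close> compares it with the elements used
        to define \<open>w\<close>.\<close>
      obtain J' :: "('u, 'u) category" and F' y where J': "small_category \<kappa> J'" "filtered \<mu> J'" "is_functor J' V F'"
        "\<And>j. j \<in> Ob J' \<Longrightarrow> ObMap F' j \<in> P" "is_colimit V J' F' (fst s1) y"
        using presentation[OF o1] by auto
      note epi = graph_colimit_epi[OF J'(5)[unfolded colimit_iff_graph_colimit[OF category J'(3)]]]
      show ?thesis
      proof (rule jointly_epiD[OF epi])
        show "w \<cdot> h1 \<in> hom V (fst s1) Z" by (rule comp_hom[OF mhom_hom[OF h1] w(1)])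
        show "z s1 \<in> hom V (fst s1) Z" by (rule zh[OF s1])
        fix i assume i: "i \<in> Ob J'"
        have y: "y i \<in> hom V (ObMap F' i) (fst s1)" using J'(5) i by (auto simp: is_colimit_def is_cocone_def)
        have hy: "h1 \<cdot> y i \<in> hom V (ObMap F' i) (fst X)" by (rule comp_hom[OF y mhom_hom[OF h1]])
        have inf: "infinite (UNIV :: 'u set)" using infinite_field finite_subset subset_UNIV by blast
        then obtain a b :: 'u where ab: "a \<noteq> b" by (metis ex_new_if_finite finite.emptyI finite.insertI insertI1)
        obtain j k where k: "j \<in> Ob J" "k \<in> hom V (ObMap F' i) (ObMap F j)" "h1 \<cdot> y i = x j \<cdot> k"
          by (rule presentable_factor[OF inaccessible ab category presentable_P[OF J'(4)[OF i]] J(1,2,3,5) hy])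
        note [simp] = homD[OF y] homD[OF mhom_hom[OF h1]] homD[OF w(1)] homD[OF k(2)] homD[OF leg[OF k(1)]] 
          homD[OF g[OF k(1)]] homD[OF mhom_hom[OF h[OF k(1)]]] homD[OF zh[OF s[OF k(1)]]]
        have e: "h j \<cdot> (g j \<cdot> k) = h1 \<cdot> y i" unfolding k(3) xhg[OF k(1)] by (simp add: comp_assoc)
        have "w \<cdot> h1 \<cdot> y i = (w \<cdot> x j) \<cdot> k" by (simp add: comp_assoc k(3))
        also have "\<dots> = z (s j) \<cdot> (g j \<cdot> k)" using w(2) k(1) by (simp add: comp_assoc)
        also have "\<dots> = z s1 \<cdot> y i"
          by (rule R[OF s[OF k(1)] s1 J'(4)[OF i] comp_hom[OF k(2) g[OF k(1)]] y h[OF k(1)] h1 e])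
        finally show "w \<cdot> h1 \<cdot> y i = z s1 \<cdot> y i" .
      qed
    qed
    \<comment> \<open>The value \<open>w\<close> at the vertex of \<open>X\<close> completes
      \<open>z\<close> to a cocone on the whole graph; \<open>wh\<close> is its cocone
      equation.\<close>
    have "graph_cocone V ?I (\<lambda>i. fst (G i)) E Z (case_option w z)"
      unfolding graph_cocone_def using Z w(1) zh wh by (auto simp: G_def E_def)
    then obtain k where "k \<in> hom V Q Z" "\<And>i. i \<in> ?I \<Longrightarrow> k \<cdot> c i = case_option w z i"
      by (rule graph_colimit_desc[OF Q]) simp
    then show ?thesis by (intro bexI[of _ k]) auto
  qed
  have "jointly_epi V small_meas (fst ?Q) ?\<iota>"
    unfolding jointly_epi_def
  proof (intro allI ballI impI)
    fix Z f k assume f: "f \<in> hom V (fst ?Q) Z" and k: "k \<in> hom V (fst ?Q) Z" and e: "\<forall>s\<in>small_meas. f \<cdot> ?\<iota> s = k \<cdot> ?\<iota> s"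
    note [simp] = homD[OF f] homD[OF k] homD[OF mhom_hom[OF q]]
    \<comment> \<open>The leg at \<open>X\<close> is already determined by the others, since every
      leg of the presentation of \<open>X\<close> factors through a small measuring.\<close>
    have "f \<cdot> ?q = k \<cdot> ?q"
    proof (rule jointly_epiD[OF graph_colimit_epi[OF gX]])
      fix j assume j: "j \<in> Ob J"
      note [simp] = homD[OF g[OF j]] homD[OF mhom_hom[OF h[OF j]]]
      have "?q \<cdot> x j = ?\<iota> (s j) \<cdot> g j"
        unfolding xhg[OF j] by (simp add: comp_reduce[OF qh[OF s[OF j] h[OF j]]])
      moreover have "f \<cdot> (?\<iota> (s j) \<cdot> g j) = k \<cdot> (?\<iota> (s j) \<cdot> g j)"
      proof -
        note [simp] = homD[OF mhom_hom[OF \<iota>[OF s[OF j]]]]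
        show ?thesis using e s[OF j] by (simp flip: comp_assoc)
      qed
      ultimately show "f \<cdot> ?q \<cdot> x j = k \<cdot> ?q \<cdot> x j" using homD[OF leg[OF j]] by (simp add: comp_assoc)
    qed (auto simp: hom_def)
    moreover have "f \<cdot> c i = k \<cdot> c i" if "i \<in> ?I" for i using that e calculation by auto
    ultimately show "f = k" using jointly_epiD[OF graph_colimit_epi[OF Q], of f Z k] f k by simp
  qed
  then have "represents R ?Q ?\<iota>"
    unfolding represents_def using M(1) \<iota> Rcompat desc by blast
  then show ?thesis using that Rsub q by blast
qed

text \<open>The representative of \<open>R\<close> carries an \<open>R\<close>-compatible family, so
  universality of \<open>Q\<close> gives an arrow in \<open>V\<close> between them. It is a morphism
  of measurings because the family on \<open>Q\<close> is jointly epimorphic and consists of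
  morphisms.\<close>

lemma solution_set:
  assumes X: "meas X" obtains Y f where "Y \<in> solution_set" "mhom X f Y"
proof -
  obtain R Q \<iota> q where R: "R \<subseteq> pairs \<times> pairs" "represents R Q \<iota>" "mhom X q Q" by (rule represented_quotient[OF X])
  let ?Y = "representative R"
  obtain \<iota>' where Y: "represents R ?Y \<iota>'" using representative[OF R(2)] by blast
  have Yo: "meas ?Y" and Qo: "meas Q" using Y R(2) by (auto simp: represents_def)
  have "\<exists>k\<in>hom V (fst Q) (fst ?Y). \<forall>s\<in>small_meas. k \<cdot> \<iota> s = \<iota>' s"
  proof -
    have "fst ?Y \<in> Ob V" "\<forall>s\<in>small_meas. \<iota>' s \<in> hom V (fst s) (fst ?Y)" "compatible R \<iota>'"
      using Y meas_ob[OF Yo] mhom_hom by (auto simp: represents_def)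
    then show ?thesis using R(2) unfolding represents_def by blast
  qed
  then obtain k where k: "k \<in> hom V (fst Q) (fst ?Y)" "\<And>s. s \<in> small_meas \<Longrightarrow> k \<cdot> \<iota> s = \<iota>' s" by blast
  have "mhom Q k ?Y"
  proof (rule mhom_of_jointly_epi[OF _ _ Qo Yo _ k(1)])
    show "jointly_epi V small_meas (fst Q) \<iota>" using R(2) by (simp add: represents_def)
    show "mhom s (\<iota> s) Q" if "s \<in> small_meas" for s using R(2) that by (simp add: represents_def)
    show "mhom s (k \<cdot> \<iota> s) ?Y" if "s \<in> small_meas" for s using Y that k(2)[OF that] by (simp add: represents_def)
  qed (rule small_measD)
  then have "mhom X (k \<cdot> q) ?Y" by (rule mhom_comp[OF X Qo Yo R(3)])
  moreover have "?Y \<in> solution_set" unfolding solution_set_def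
    by (intro imageI CollectI conjI exI) (fact R(1), fact R(2))
  ultimately show ?thesis using that by blast
qed

text \<open>The colimit \<open>T\<close> of the solution set is terminal: if \<open>p : T \<rightarrow> Q\<close> coequalizes two arrows
  into \<open>T\<close>, then composing \<open>p\<close> with an arrow from \<open>Q\<close> back to \<open>T\<close> through the solution set
  gives the identity of \<open>T\<close>.\<close>

theorem terminal_measuring:
  obtains T where "meas T" "\<forall>X. meas X \<longrightarrow> (\<exists>!f. mhom X f T)"
proof -
  define E where "E = {(Y, h, Y'). Y \<in> solution_set \<and> Y' \<in> solution_set \<and> mhom Y h Y'}"
  have gr: "graph V solution_set fst E"
    by (rule meas_graph[of _ "\<lambda>Y. Y", simplified]) (use solution_setD in \<open>auto simp: E_def\<close>)
  have "small (SIGMA Y:solution_set. (\<Union>Y'\<in>solution_set. hom V (fst Y) (fst Y')) \<times> solution_set)"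
    by (intro small_Sigma small_Times small_UN small_solution_set small_hom meas_ob solution_setD)
  then have sE: "small E" by (rule small_subset) (use mhom_hom in \<open>auto simp: E_def\<close>)
  obtain T c where T: "graph_colimit V solution_set fst E T c" by (rule small_colimit[OF gr small_solution_set sE])
  obtain \<Delta> \<epsilon> t where M1: "meas (T, \<Delta>, \<epsilon>, t)" and M2: "\<forall>i\<in>solution_set. mhom i (c i) (T, \<Delta>, \<epsilon>, t)"
    by (rule meas_colimit[of solution_set "\<lambda>Y. Y" E T c]) (use T solution_setD in \<open>auto simp: E_def\<close>)
  note M = M1 M2[rule_format]
  let ?T = "(T, \<Delta>, \<epsilon>, t)"
  have "\<exists>!f. mhom X f ?T" if X: "meas X" for X
  proof (rule ex_ex1I)
    obtain Y f where Y: "Y \<in> solution_set" "mhom X f Y" by (rule solution_set[OF X])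
    then show "\<exists>f. mhom X f ?T" using mhom_comp[OF X solution_setD M(1) _ M(2)] by blast
  next
    fix f g assume f: "mhom X f ?T" and g: "mhom X g ?T"
    define G where "G = (\<lambda>b. if b then ?T else X)"
    let ?E = "{(False, f, True), (False, g, True)}"
    have "graph V UNIV (\<lambda>i. fst (G i)) ?E" 
      using meas_ob[OF X] meas_ob[OF M(1)] mhom_hom[OF f] mhom_hom[OF g] by (auto simp: graph_def G_def)
    then obtain Q p where Q: "graph_colimit V UNIV (\<lambda>i. fst (G i)) ?E Q p"
      by (rule small_colimit) (simp_all add: small_finite)
    obtain \<Delta>' \<epsilon>' t' where M1': "meas (Q, \<Delta>', \<epsilon>', t')" and M2': "\<forall>i\<in>UNIV. mhom (G i) (p i) (Q, \<Delta>', \<epsilon>', t')"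
      by (rule meas_colimit[OF _ _ Q]) (use X M(1) f g in \<open>auto simp: G_def\<close>)
    note M' = M1' M2'[rule_format, OF UNIV_I]
    let ?Q = "(Q, \<Delta>', \<epsilon>', t')"
    have p: "mhom ?T (p True) ?Q" using M'(2)[of True] by (simp add: G_def)
    have pfg: "p True \<cdot> f = p True \<cdot> g" using graph_colimit_cocone[OF Q] by (auto simp: graph_cocone_def)
    obtain Y r where Y: "Y \<in> solution_set" "mhom ?Q r Y" by (rule solution_set[OF M'(1)])
    note Ym = solution_setD[OF Y(1)]
    have rp: "mhom ?T (r \<cdot> p True) Y" by (rule mhom_comp[OF M(1) M'(1) Ym p Y(2)])
    note [simp] = homD[OF mhom_hom[OF p]] homD[OF mhom_hom[OF Y(2)]] homD[OF mhom_hom[OF M(2)[OF Y(1)]]] 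
      homD[OF mhom_hom[OF f]] homD[OF mhom_hom[OF g]]
    have To: "T \<in> Ob V" using meas_ob[OF M(1)] by simp
    let ?e = "c Y \<cdot> (r \<cdot> p True)"
    have "?e = \<one> T"
    proof (rule jointly_epiD[OF graph_colimit_epi[OF T]])
      fix Z assume Z: "Z \<in> solution_set"
      note [simp] = homD[OF mhom_hom[OF M(2)[OF Z]]]
      have "mhom Z ((r \<cdot> p True) \<cdot> c Z) Y" by (rule mhom_comp[OF solution_setD[OF Z] M(1) Ym M(2)[OF Z] rp])
      \<comment> \<open>The graph has all morphisms between members of the solution set as edges.
        The arrow from \<open>Z\<close> to \<open>Y\<close> through \<open>T\<close> is therefore
        absorbed by the leg \<open>c Y\<close>.\<close>
      then have "(Z, (r \<cdot> p True) \<cdot> c Z, Y) \<in> E" using Z Y(1) by (simp add: E_def)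
      then have "c Y \<cdot> ((r \<cdot> p True) \<cdot> c Z) = c Z" using graph_colimit_cocone[OF T] by (auto simp: graph_cocone_def)
      then show "?e \<cdot> c Z = \<one> T \<cdot> c Z" by (simp add: comp_assoc)
    qed (use To in \<open>auto simp: hom_def\<close>)
    then have "f = ?e \<cdot> f" "g = ?e \<cdot> g" by simp_all
    moreover have "?e \<cdot> f = ?e \<cdot> g" by (simp add: comp_assoc pfg)
    ultimately show "f = g" by metis
  qed
  then show ?thesis using that M(1) by blast
qed

end

section \<open>The adjunction\<close>

context smc_cat
begin

lemma comonoid_ob [simp]: "is_comonoid V C \<Longrightarrow> fst C \<in> Ob V"
  by (cases C) (use comonoidD(1) in simp)

lemma monoid_ob [simp]: "is_monoid V M \<Longrightarrow> fst M \<in> Ob V"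
  by (cases M) (use monoidD(1) in simp)

lemma comonoid_hom_hom: "is_comonoid_hom V C f D \<Longrightarrow> f \<in> hom V (fst C) (fst D)"
  by (cases C; cases D) (simp add: is_comonoid_hom_def)

lemma monoid_hom_hom: "is_monoid_hom V M f N \<Longrightarrow> f \<in> hom V (fst M) (fst N)"
  by (cases M; cases N) (simp add: is_monoid_hom_def)

lemma measuring_hom: "measuring A B C t \<Longrightarrow> t \<in> hom V (fst A \<otimes> fst C) (fst B)"
  by (cases A; cases B; cases C) (simp add: measuring_def)

lemma fst_convolution [simp]: "fst (convolution V C B) = IHom V (fst C) (fst B)"
  by (simp add: convolution_def)

lemma is_monoid_convolution: "is_monoid V B \<Longrightarrow> is_comonoid V C \<Longrightarrow> is_monoid V (convolution V C B)"
  by (cases B; cases C) (simp add: monoid_convolution)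

lemma measuring_iff:
  "is_monoid V A \<Longrightarrow> is_monoid V B \<Longrightarrow> is_comonoid V C \<Longrightarrow> g \<in> hom V (fst A) (IHom V (fst C) (fst B)) \<Longrightarrow>
   measuring A B C (Eval V (fst C) (fst B) \<cdot> (g \<boxtimes> \<one> (fst C))) \<longleftrightarrow> is_monoid_hom V A g (convolution V C B)"
  by (cases A; cases B; cases C) (simp add: measuring_iff_monoid_hom)

lemma measuring_precomp:
  "is_monoid V A \<Longrightarrow> is_monoid V B \<Longrightarrow> is_comonoid V C \<Longrightarrow> is_comonoid V C' \<Longrightarrow> is_comonoid_hom V C' f C \<Longrightarrow>
   measuring A B C t \<Longrightarrow> measuring A B C' (t \<cdot> (\<one> (fst A) \<boxtimes> f))"
  by (cases A; cases B; cases C; cases C') (simp add: measuring_comonoid_hom)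

text \<open>Naturality of the convolution product in its two objects. This provides the action of
  the right adjoint on monoid morphisms.\<close>

lemma measuring_monoid_hom:
  assumes A: "is_monoid V A" and A': "is_monoid V A'" and B: "is_monoid V B" and C: "is_comonoid V C"
    and a: "is_monoid_hom V A' a A" and t: "measuring A B C t"
  shows "measuring A' B C (t \<cdot> (a \<boxtimes> \<one> (fst C)))"
proof -
  obtain X m \<eta> X' m' \<eta>' b n \<theta> D \<Delta> \<epsilon> where s: "A = (X, m, \<eta>)" "A' = (X', m', \<eta>')" "B = (b, n, \<theta>)" "C = (D, \<Delta>, \<epsilon>)"
    by (cases A; cases A'; cases B; cases C)
  note [simp] = monoidD(1-3)[OF A[unfolded s]] monoidD(1-3)[OF A'[unfolded s]] monoidD(1-3)[OF B[unfolded s]] comonoidD(1-3)[OF C[unfolded s]]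
  have a': "a \<in> hom V X' X" "a \<cdot> m' = m \<cdot> (a \<boxtimes> a)" "a \<cdot> \<eta>' = \<eta>" using a by (auto simp: is_monoid_hom_def s)
  have t': "t \<in> hom V (X \<otimes> D) b" "t \<cdot> (m \<boxtimes> \<one> D) = convolve n D \<Delta> X X t t" "t \<cdot> (\<eta> \<boxtimes> \<one> D) = \<theta> \<cdot> (\<epsilon> \<cdot> \<lambda>\<^sub>I D)"
    using t by (auto simp: measuring_def s)
  note [simp] = homD[OF a'(1)] homD[OF t'(1)]
  have "t \<cdot> (a \<boxtimes> \<one> D) \<cdot> (m' \<boxtimes> \<one> D) = (t \<cdot> (m \<boxtimes> \<one> D)) \<cdot> (a \<boxtimes> a \<boxtimes> \<one> D)" by (simp add: merge a'(2))
  also have "\<dots> = convolve n D \<Delta> X' X' (t \<cdot> (a \<boxtimes> \<one> D)) (t \<cdot> (a \<boxtimes> \<one> D))"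
    unfolding t'(2) by (rule convolve_nat[OF B[unfolded s] C[unfolded s] t'(1) t'(1) a'(1) a'(1), symmetric])
  finally show ?thesis unfolding measuring_def s
    by (simp add: hom_def comp_assoc tens_comp a'(3) t'(3))
qed

definition universal_measuring where
  "universal_measuring A B P t \<longleftrightarrow> is_comonoid V P \<and> measuring A B P t \<and>
     (\<forall>C s. is_comonoid V C \<longrightarrow> measuring A B C s \<longrightarrow> (\<exists>!f. is_comonoid_hom V C f P \<and> t \<cdot> (\<one> (fst A) \<boxtimes> f) = s))"

text \<open>Representability for each monoid separately is enough: the uniqueness in the universal
  property forces the action on arrows, its functoriality and the naturality of the
  bijection.\<close>

theorem adjunction_of_universal_measurings:
  assumes B: "is_monoid V B" and ex: "\<And>A. is_monoid V A \<Longrightarrow> \<exists>P t. universal_measuring A B P t"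
  shows "\<exists>P. right_adjoint (Comon V) (op_cat (Mon V)) (op_func (H_fix V B)) P"
proof -
  obtain P T where PT: "universal_measuring A B (P A) (T A)" if "is_monoid V A" for A
    using ex by metis
  have P: "is_comonoid V (P A)" and T: "measuring A B (P A) (T A)" if "is_monoid V A" for A
    using PT[OF that] by (auto simp: universal_measuring_def)
  define F where "F C A s = (THE f. is_comonoid_hom V C f (P A) \<and> T A \<cdot> (\<one> (fst A) \<boxtimes> f) = s)" for C A s
  have F: "is_comonoid_hom V C (F C A s) (P A)" "T A \<cdot> (\<one> (fst A) \<boxtimes> F C A s) = s"
    if "is_monoid V A" "is_comonoid V C" "measuring A B C s" for C A s
  proof -
    have "\<exists>!f. is_comonoid_hom V C f (P A) \<and> T A \<cdot> (\<one> (fst A) \<boxtimes> f) = s"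
      using PT[OF that(1)] that(2,3) unfolding universal_measuring_def by blast
    from theI'[OF this] show "is_comonoid_hom V C (F C A s) (P A)" "T A \<cdot> (\<one> (fst A) \<boxtimes> F C A s) = s"
      unfolding F_def by auto
  qed
  \<comment> \<open>The form in which uniqueness is applied: an equation for a comonoid morphism
    into \<open>P A\<close> is verified after composition with the universal measuring.\<close>
  have F_eq: "F C A s = f" 
    if A: "is_monoid V A" and C: "is_comonoid V C" and f: "is_comonoid_hom V C f (P A)" "T A \<cdot> (\<one> (fst A) \<boxtimes> f) = s" for C A s f
  proof -
    have s: "measuring A B C s" using measuring_precomp[OF A B P[OF A] C f(1) T[OF A]] f(2) by simp
    have "\<exists>!f. is_comonoid_hom V C f (P A) \<and> T A \<cdot> (\<one> (fst A) \<boxtimes> f) = s"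
      using PT[OF A] C s unfolding universal_measuring_def by blast
    then show ?thesis by (rule ex1_unique) (use F[OF A C s] f in auto)
  qed
  define b where "b = fst B"
  have b [simp]: "b \<in> Ob V" using B by (simp add: b_def)
  define tr where "tr C g = Eval V (fst C) b \<cdot> (g \<boxtimes> \<one> (fst C))" for C :: "('o, 'a) struct" and g
  have tr: "measuring A B C (tr C g)" if "is_monoid V A" "is_comonoid V C" "is_monoid_hom V A g (convolution V C B)" for A C g
    using measuring_iff[OF that(1) B that(2)] monoid_hom_hom[OF that(3)] that(3) by (simp add: tr_def b_def)
  \<comment> \<open>The triple \<open>(A', a, A)\<close> is a monoid morphism from \<open>A'\<close>
    to \<open>A\<close>, hence an arrow from \<open>A\<close> to \<open>A'\<close> in the opposite
    category. Restricting \<open>T A\<close> along \<open>a\<close> measures \<open>A'\<close> by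
    \<open>P A\<close> and so induces an arrow from \<open>P A\<close> to
    \<open>P A'\<close>.\<close>
  define Q where "Q = \<lparr>ObMap = P, ArMap = (\<lambda>(A', a, A). (P A, F (P A) A' (T A \<cdot> (a \<boxtimes> \<one> (fst (P A)))), P A'))\<rparr>"
  have Q: "ObMap Q A = P A" "ArMap Q (A', a, A) = (P A, F (P A) A' (T A \<cdot> (a \<boxtimes> \<one> (fst (P A)))), P A')" for A A' a
    by (simp_all add: Q_def)
  have Qm: "measuring A' B (P A) (T A \<cdot> (a \<boxtimes> \<one> (fst (P A))))" 
    if "is_monoid V A" "is_monoid V A'" "is_monoid_hom V A' a A" for A A' a
    by (rule measuring_monoid_hom[OF that(1,2) B P[OF that(1)] that(3) T[OF that(1)]])
  note Th = homD[OF measuring_hom[OF T]]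
  have functor_Q: "is_functor (op_cat (Mon V)) (Comon V) Q"
    unfolding is_functor_def
  proof (intro conjI ballI impI category_op_Mon category_Comon)
    fix A assume "A \<in> Ob (op_cat (Mon V))"
    then have A: "is_monoid V A" by (simp add: op_cat_def Mon_def)
    show "ObMap Q A \<in> Ob (Comon V)" using P[OF A] by (simp add: Q Comon_def)
    have "F (P A) A (T A) = \<one> (fst (P A))"
      by (rule F_eq[OF A P[OF A] comonoid_hom_id[OF P[OF A]]]) (use A P[OF A] Th[OF A] in simp)
    then show "ArMap Q (Ident (op_cat (Mon V)) A) = Ident (Comon V) (ObMap Q A)"
      using A P[OF A] Th[OF A] by (simp add: Q op_cat_def Mon_def Comon_def)
  next
    fix f assume "f \<in> Ar (op_cat (Mon V))"
    then obtain A' a A where f: "f = (A', a, A)" "is_monoid V A'" "is_monoid V A" "is_monoid_hom V A' a A"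
      by (auto simp: op_cat_def Mon_def)
    show "ArMap Q f \<in> hom (Comon V) (ObMap Q (Dom (op_cat (Mon V)) f)) (ObMap Q (Cod (op_cat (Mon V)) f))"
      using F(1)[OF f(2) P[OF f(3)] Qm[OF f(3,2,4)]] P[OF f(2)] P[OF f(3)] 
      by (simp add: f(1) Q op_cat_def Mon_def Comon_def hom_def)
  next
    fix f g assume "f \<in> Ar (op_cat (Mon V))" "g \<in> Ar (op_cat (Mon V))" "Dom (op_cat (Mon V)) g = Cod (op_cat (Mon V)) f"
    then obtain A0 A1 A2 a a' where fg: "f = (A1, a, A0)" "g = (A2, a', A1)" 
      and M: "is_monoid V A0" "is_monoid V A1" "is_monoid V A2"
      and a: "is_monoid_hom V A1 a A0" and a': "is_monoid_hom V A2 a' A1"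
      by (auto simp: op_cat_def Mon_def)
    let ?f = "F (P A0) A1 (T A0 \<cdot> (a \<boxtimes> \<one> (fst (P A0))))" and ?g = "F (P A1) A2 (T A1 \<cdot> (a' \<boxtimes> \<one> (fst (P A1))))"
    note Ff = F[OF M(2) P[OF M(1)] Qm[OF M(1,2) a]] and Fg = F[OF M(3) P[OF M(2)] Qm[OF M(2,3) a']]
    note [simp] = M P[OF M(1)] P[OF M(2)] P[OF M(3)] Th[OF M(1)] Th[OF M(2)] Th[OF M(3)] 
      homD[OF monoid_hom_hom[OF a]] homD[OF monoid_hom_hom[OF a']] homD[OF comonoid_hom_hom[OF Ff(1)]] homD[OF comonoid_hom_hom[OF Fg(1)]]
    have "F (P A0) A2 (T A0 \<cdot> ((a \<cdot> a') \<boxtimes> \<one> (fst (P A0)))) = ?g \<cdot> ?f"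
    proof (rule F_eq[OF M(3) P[OF M(1)] comonoid_hom_comp[OF P[OF M(1)] P[OF M(2)] P[OF M(3)] Ff(1) Fg(1)]])
      have "T A2 \<cdot> (\<one> (fst A2) \<boxtimes> (?g \<cdot> ?f)) = T A1 \<cdot> ((a' \<boxtimes> \<one> (fst (P A1))) \<cdot> (\<one> (fst A2) \<boxtimes> ?f))"
        by (simp add: whisker comp_reduce[OF Fg(2)])
      also have "\<dots> = (T A1 \<cdot> (\<one> (fst A1) \<boxtimes> ?f)) \<cdot> (a' \<boxtimes> \<one> (fst (P A0)))" by (simp add: merge)
      also have "\<dots> = T A0 \<cdot> ((a \<cdot> a') \<boxtimes> \<one> (fst (P A0)))" unfolding Ff(2) by (simp add: merge)
      finally show "T A2 \<cdot> (\<one> (fst A2) \<boxtimes> (?g \<cdot> ?f)) = T A0 \<cdot> ((a \<cdot> a') \<boxtimes> \<one> (fst (P A0)))" .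
    qed
    then show "ArMap Q (g \<cdot>\<^bsub>op_cat (Mon V)\<^esub> f) = ArMap Q g \<cdot>\<^bsub>Comon V\<^esub> ArMap Q f"
      by (simp add: fg Q op_cat_def Mon_def Comon_def)
  qed
  define \<phi> where "\<phi> C A h = (C, F C A (tr C (fst (snd h))), P A)" for C A and h :: "('o, 'a) struct_arrow"
  have op_hom: "h \<in> hom (op_cat (Mon V)) (ObMap (op_func (H_fix V B)) C) A \<longleftrightarrow> 
      (\<exists>g. h = (A, g, convolution V C B) \<and> is_monoid_hom V A g (convolution V C B))" 
    if "is_monoid V A" "is_comonoid V C" for h C A
    using that is_monoid_convolution[OF B that(2)] by (auto simp: hom_def op_cat_def Mon_def op_func_def H_fix_simps)
  have bij: "bij_betw (\<phi> C A) (hom (op_cat (Mon V)) (ObMap (op_func (H_fix V B)) C) A) (hom (Comon V) C (ObMap Q A))"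
    if C: "is_comonoid V C" and A: "is_monoid V A" for C A
    unfolding bij_betw_def
  proof
    note [simp] = C A P[OF A]
    show "inj_on (\<phi> C A) (hom (op_cat (Mon V)) (ObMap (op_func (H_fix V B)) C) A)"
    proof (rule inj_onI)
      fix h k assume "h \<in> hom (op_cat (Mon V)) (ObMap (op_func (H_fix V B)) C) A" "k \<in> hom (op_cat (Mon V)) (ObMap (op_func (H_fix V B)) C) A"
        and e: "\<phi> C A h = \<phi> C A k"
      then obtain g g' where g: "h = (A, g, convolution V C B)" "is_monoid_hom V A g (convolution V C B)"
        "k = (A, g', convolution V C B)" "is_monoid_hom V A g' (convolution V C B)" by (auto simp: op_hom[OF A C])
      have "F C A (tr C g) = F C A (tr C g')" using e g by (simp add: \<phi>_def)
      from arg_cong[OF this, of "\<lambda>f. T A \<cdot> (\<one> (fst A) \<boxtimes> f)"] have "tr C g = tr C g'"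
        unfolding F(2)[OF A C tr[OF A C g(2)]] F(2)[OF A C tr[OF A C g(4)]] .
      then have "g = g'" 
        by (intro eval_cancel[of "fst C" b g "fst A" g']) (use monoid_hom_hom[OF g(2)] monoid_hom_hom[OF g(4)] B in \<open>simp_all add: tr_def b_def\<close>)
      then show "h = k" by (simp add: g)
    qed
    show "\<phi> C A ` hom (op_cat (Mon V)) (ObMap (op_func (H_fix V B)) C) A = hom (Comon V) C (ObMap Q A)"
    proof (intro equalityI subsetI)
      fix p assume "p \<in> \<phi> C A ` hom (op_cat (Mon V)) (ObMap (op_func (H_fix V B)) C) A"
      then obtain g where g: "p = (C, F C A (tr C g), P A)" "is_monoid_hom V A g (convolution V C B)"
        by (auto simp: op_hom[OF A C] \<phi>_def)
      then show "p \<in> hom (Comon V) C (ObMap Q A)"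
        using F(1)[OF A C tr[OF A C g(2)]] by (simp add: hom_def Comon_def Q)
    next
      fix p assume "p \<in> hom (Comon V) C (ObMap Q A)"
      then obtain f where f: "p = (C, f, P A)" "is_comonoid_hom V C f (P A)" by (auto simp: hom_def Comon_def Q)
      let ?s = "T A \<cdot> (\<one> (fst A) \<boxtimes> f)"
      have s: "measuring A B C ?s" by (rule measuring_precomp[OF A B P[OF A] C f(2) T[OF A]])
      let ?g = "transpose V (fst A) (fst C) b ?s"
      have "?s \<in> hom V (fst A \<otimes> fst C) b" using measuring_hom[OF s] by (simp add: b_def)
      from transpose[OF _ _ _ this] have g: "?g \<in> hom V (fst A) (IHom V (fst C) b)" "tr C ?g = ?s" by (simp_all add: tr_def)
      have "is_monoid_hom V A ?g (convolution V C B)"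
      proof (rule iffD1[OF measuring_iff[OF A B C]])
        show "?g \<in> hom V (fst A) (IHom V (fst C) (fst B))" using g(1) by (simp only: b_def)
        show "measuring A B C (Eval V (fst C) (fst B) \<cdot> (?g \<boxtimes> \<one> (fst C)))"
          using s g(2) by (simp only: tr_def b_def)
      qed
      moreover have "F C A ?s = f" by (rule F_eq[OF A C f(2)]) simp
      ultimately show "p \<in> \<phi> C A ` hom (op_cat (Mon V)) (ObMap (op_func (H_fix V B)) C) A"
        using g(2) f(1) by (intro image_eqI[of _ _ "(A, ?g, convolution V C B)"]) (auto simp: op_hom[OF A C] \<phi>_def)
    qed
  qed
  have nat: "\<phi> (Dom (Comon V) u) (Cod (op_cat (Mon V)) v) (v \<cdot>\<^bsub>op_cat (Mon V)\<^esub> h \<cdot>\<^bsub>op_cat (Mon V)\<^esub> ArMap (op_func (H_fix V B)) u)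
      = ArMap Q v \<cdot>\<^bsub>Comon V\<^esub> \<phi> (Cod (Comon V) u) (Dom (op_cat (Mon V)) v) h \<cdot>\<^bsub>Comon V\<^esub> u"
    if u: "u \<in> Ar (Comon V)" and v: "v \<in> Ar (op_cat (Mon V))" 
      and h: "h \<in> hom (op_cat (Mon V)) (ObMap (op_func (H_fix V B)) (Cod (Comon V) u)) (Dom (op_cat (Mon V)) v)" for u v h
  proof -
    obtain C' f C where uu: "u = (C', f, C)" and C: "is_comonoid V C'" "is_comonoid V C" and f: "is_comonoid_hom V C' f C"
      using u by (auto simp: Comon_def)
    obtain A' a A where vv: "v = (A', a, A)" and A: "is_monoid V A'" "is_monoid V A" and a: "is_monoid_hom V A' a A"
      using v by (auto simp: op_cat_def Mon_def)
    have "h \<in> hom (op_cat (Mon V)) (ObMap (op_func (H_fix V B)) C) A"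
      using h by (simp add: uu vv Comon_def op_cat_def Mon_def)
    then obtain g where hh: "h = (A, g, convolution V C B)" and g: "is_monoid_hom V A g (convolution V C B)"
      by (auto simp: op_hom[OF A(2) C(2)])
    let ?i = "ihom_arr V f (\<one> b)"
    let ?p = "F (P A) A' (T A \<cdot> (a \<boxtimes> \<one> (fst (P A))))" and ?q = "F C A (tr C g)"
    note p = F[OF A(1) P[OF A(2)] Qm[OF A(2,1) a]] and q = F[OF A(2) C(2) tr[OF A(2) C(2) g]]
    note i = ihom_arr[OF comonoid_hom_hom[OF f] id_hom[OF b]]
    note [simp] = A C P[OF A(1)] P[OF A(2)] homD[OF comonoid_hom_hom[OF f]] homD[OF monoid_hom_hom[OF a]]
      homD[OF monoid_hom_hom[OF g, simplified, folded b_def]] homD[OF i(1)] homD[OF comonoid_hom_hom[OF p(1)]] homD[OF comonoid_hom_hom[OF q(1)]] Th[OF A(1)] Th[OF A(2)]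
    \<comment> \<open>Naturality in both variables at once: either side, composed with the universal
      measuring of \<open>A'\<close>, is \<open>tr C g\<close> restricted along \<open>a\<close> and
      \<open>f\<close>.\<close>
    have "F C' A' (tr C' (?i \<cdot> (g \<cdot> a))) = ?p \<cdot> ?q \<cdot> f"
    proof (rule F_eq[OF A(1) C(1)])
      show "is_comonoid_hom V C' (?p \<cdot> ?q \<cdot> f) (P A')"
        by (rule comonoid_hom_comp[OF C(1,2) P[OF A(1)] f comonoid_hom_comp[OF C(2) P[OF A(2)] P[OF A(1)] q(1) p(1)]])
      have "T A' \<cdot> (\<one> (fst A') \<boxtimes> (?p \<cdot> ?q \<cdot> f)) = T A \<cdot> ((a \<boxtimes> \<one> (fst (P A))) \<cdot> ((\<one> (fst A') \<boxtimes> ?q) \<cdot> (\<one> (fst A') \<boxtimes> f)))"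
        by (simp add: whisker comp_reduce[OF p(2)])
      also have "\<dots> = (T A \<cdot> (\<one> (fst A) \<boxtimes> ?q)) \<cdot> (a \<boxtimes> f)" by (simp add: merge)
      also have "\<dots> = (Eval V (fst C) b \<cdot> (\<one> (IHom V (fst C) b) \<boxtimes> f)) \<cdot> ((g \<cdot> a) \<boxtimes> \<one> (fst C'))"
        unfolding q(2) by (simp add: tr_def merge)
      also have "\<dots> = (Eval V (fst C') b \<cdot> (?i \<boxtimes> \<one> (fst C'))) \<cdot> ((g \<cdot> a) \<boxtimes> \<one> (fst C'))"
        unfolding i(2) by simp
      also have "\<dots> = tr C' (?i \<cdot> (g \<cdot> a))" by (simp add: tr_def merge)
      finally show "T A' \<cdot> (\<one> (fst A') \<boxtimes> (?p \<cdot> ?q \<cdot> f)) = tr C' (?i \<cdot> (g \<cdot> a))" .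
    qed
    then show ?thesis
      by (simp add: uu vv hh \<phi>_def Q Comon_def op_cat_def Mon_def op_func_def H_fix_simps b_def)
  qed
  have "right_adjoint (Comon V) (op_cat (Mon V)) (op_func (H_fix V B)) Q"
    unfolding right_adjoint_def
  proof (intro conjI functor_H_fix[OF B] functor_Q exI[of _ \<phi>] ballI nat)
    fix C A assume "C \<in> Ob (Comon V)" "A \<in> Ob (op_cat (Mon V))"
    then show "bij_betw (\<phi> C A) (hom (op_cat (Mon V)) (ObMap (op_func (H_fix V B)) C) A) (hom (Comon V) C (ObMap Q A))"
      by (intro bij) (simp_all add: Comon_def op_cat_def Mon_def)
  qed
  then show ?thesis by blast
qed

text \<open>Local presentability supplies the cardinal \<open>\<mu>\<close> and the small set of
  presentable objects required by the construction. A terminal quadruple is then regrouped as a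
  comonoid together with its measuring.\<close>

lemma universal_measuring_exists:
  assumes \<kappa>: "inaccessible (\<kappa> :: 'u rel)" and lp: "locally_presentable \<kappa> V" and A: "is_monoid V A" and B: "is_monoid V B"
  shows "\<exists>P t. universal_measuring A B P t"
proof -
  obtain X m \<eta> b n \<theta> where s: "A = (X, m, \<eta>)" "B = (b, n, \<theta>)" by (cases A; cases B)
  obtain \<mu> :: "'u rel" and S where \<mu>: "regular_cardinal \<mu>" and S: "|S| <o \<kappa>" "\<forall>K\<in>S. presentable \<kappa> \<mu> V K"
    "\<forall>X\<in>Ob V. \<exists>(J::('u, 'u) category) F c. small_category \<kappa> J \<and> filtered \<mu> J \<and> is_functor J V F \<and>
            (\<forall>j\<in>Ob J. ObMap F j \<in> S) \<and> is_colimit V J F X c"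
    using lp unfolding locally_presentable_def by blast
  interpret presentable_measurings V X m \<eta> b n \<theta> \<kappa> \<mu> S
  proof (intro presentable_measurings.intro presentable_measurings_axioms.intro measurings.intro measurings_axioms.intro
      inaccessible_cardinal.intro smc_cat_axioms)
    show "natLeq \<le>o \<mu>" using \<mu> by (simp add: regular_cardinal_def)
  qed (use \<kappa> lp A B S in \<open>simp_all add: s locally_presentable_def\<close>)
  obtain T where T: "meas T" "\<forall>X. meas X \<longrightarrow> (\<exists>!f. mhom X f T)" using terminal_measuring .
  obtain D \<Delta> \<epsilon> t where TT: "T = (D, \<Delta>, \<epsilon>, t)" by (cases T)
  have "universal_measuring A B (D, \<Delta>, \<epsilon>) t"
    unfolding universal_measuring_def
  proof (intro conjI allI impI)
    show "is_comonoid V (D, \<Delta>, \<epsilon>)" "measuring A B (D, \<Delta>, \<epsilon>) t"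
      using T(1) by (simp_all add: TT meas_def s)
    fix C r assume C: "is_comonoid V C" and r: "measuring A B C r"
    obtain c \<Delta>' \<epsilon>' where cc: "C = (c, \<Delta>', \<epsilon>')" by (cases C)
    have "meas (c, \<Delta>', \<epsilon>', r)" using C r by (simp add: meas_def s cc)
    from T(2)[rule_format, OF this] show "\<exists>!f. is_comonoid_hom V C f (D, \<Delta>, \<epsilon>) \<and> t \<cdot> (\<one> (fst A) \<boxtimes> f) = r"
      by (simp add: TT mhom_def cc s)
  qed
  then show ?thesis by blast
qed

end

theorem proposition3p1:
  fixes \<kappa> :: "'u rel"
    and V :: "('o, 'a) smc_category"
    and B :: "('o, 'a) struct"
  assumes "inaccessible \<kappa>"
    and "symmetric_monoidal_closed V"
    and "admissible \<kappa> V"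
    and "B \<in> Ob (Mon V)"
  shows "\<exists>P. right_adjoint (Comon V) (op_cat (Mon V)) (op_func (H_fix V B)) P"
proof -
  interpret smc_cat V
  proof
    show "category V" using assms(2)
      by (simp add: symmetric_monoidal_closed_def symmetric_monoidal_def monoidal_def)
  qed (rule assms(2))
  have B: "is_monoid V B" using assms(4) by (simp add: Mon_def)
  have "locally_presentable \<kappa> V" using assms(3) by (simp add: admissible_def)
  then show ?thesis
    using adjunction_of_universal_measurings[OF B] universal_measuring_exists[OF assms(1) _ _ B] by blast
qed

end
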